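(* Let $k,\ell,n$ denote non-negative integers. Then the hypergeometric equation $E(k+1/2,\ell+1/2,n)$ has logarithmic solutions if and only if $$n\le k+\ell\quad\text{if } n+k+\ell \text{ is even},\qquad\qquad n<|k-\ell|\quad\text{if } n+k+\ell\text{ is odd}.$$ If this is the case, the monodromy group of the hypergeometric equation is an infinite dihedral group; otherwise the monodromy group is isomorphic to $\mathbb{Z}/2\mathbb{Z}$.
   Context: The hypergeometric differential equation with parameters $A,B,C\in\mathbb{C}$ is $$z(1-z)\,y''(z)+\big(C-(A+B+1)z\big)\,y'(z)-AB\,y(z)=0 .$$ It is Fuchsian on $\mathbb{P}^1$ with singular points $z=0,1,\infty$; its local exponents are $0,1-C$ at $z=0$; $0,C-A-B$ at $z=1$; $A,B$ at $z=\infty$. The local exponent differences are, up to sign, $1-C$, $C-A-B$, $A-B$ at $0,1,\infty$ respectively. $E(d_1,d_2,d_3)$ denotes a hypergeometric equation whose local exponent differences at the three singular points are (up to sign) $d_1,d_2,d_3$; the order of the three arguments is considered unimportant. For the statements on the monodromy group, the equation is normalized so that the difference $k+1/2$ is at $z=0$, the difference $n$ is at $z=1$, and the difference $\ell+1/2$ is at $z=\infty$, i.e. $1-C=\pm(k+\frac12)$, $C-A-B=\pm n$, $A-B=\pm(\ell+\frac12)$. The equation has logarithmic solutions if at some singular point $P$ with local parameter $t$ there is no basis of local solutions of the form $t^{\alpha}f(t)$ with $\alpha\in\mathbb{C}$ and $f$ analytic at $t=0$ (so that $\log t$ occurs in local solutions). The monodromy group is the image in $GL_2(\mathbb{C})$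 (up to conjugation) of $\pi_1(\mathbb{P}^1\setminus\{0,1,\infty\})$ acting by analytic continuation on the solution space. *)

theory Defs
  imports
    "HOL-Complex_Analysis.Complex_Analysis"
    "HOL-Algebra.Elementary_Groups"
    "HOL-Library.Multiset"
begin

section \<open>The hypergeometric equation and its solutions\<close>

definition hypergeometric_solution ::
    "complex \<Rightarrow> complex \<Rightarrow> complex \<Rightarrow> complex set \<Rightarrow> (complex \<Rightarrow> complex) \<Rightarrow> bool" where
  "hypergeometric_solution A B C S y \<longleftrightarrow>
     y holomorphic_on S \<and>
     (\<forall>z\<in>S. z * (1 - z) * deriv (deriv y) z + (C - (A + B + 1) * z) * deriv y z - A * B * y z = 0)"

text \<open>A basis \<open>Y 1, Y 2\<close> of the space of solutions on an open set \<open>S\<close>. Functions are only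
  compared on \<open>S\<close>.\<close>

definition solution_basis ::
    "complex \<Rightarrow> complex \<Rightarrow> complex \<Rightarrow> complex set \<Rightarrow> (2 \<Rightarrow> complex \<Rightarrow> complex) \<Rightarrow> bool" where
  "solution_basis A B C S Y \<longleftrightarrow>
     (\<forall>i. hypergeometric_solution A B C S (Y i)) \<and>
     (\<forall>y. hypergeometric_solution A B C S y \<longrightarrow>
        (\<exists>!c :: complex ^ 2. \<forall>z\<in>S. y z = (\<Sum>i\<in>UNIV. c $ i * Y i z)))"

section \<open>Local exponent differences\<close>

text \<open>The local exponents are \<open>0, 1 - C\<close> at \<open>0\<close>, \<open>0, C - A - B\<close> at \<open>1\<close>, and \<open>A, B\<close> at infinity.\<close>

definition exponent_differences ::
    "complex \<Rightarrow> complex \<Rightarrow> complex \<Rightarrow> complex \<Rightarrow> complex \<Rightarrow> complex \<Rightarrow> bool" where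
  "exponent_differences A B C e\<^sub>0 e\<^sub>1 e\<^sub>i \<longleftrightarrow>
     1 - C \<in> {e\<^sub>0, - e\<^sub>0} \<and> C - A - B \<in> {e\<^sub>1, - e\<^sub>1} \<and> A - B \<in> {e\<^sub>i, - e\<^sub>i}"

text \<open>The parameters \<open>A, B, C\<close> give an equation \<open>E(d\<^sub>1, d\<^sub>2, d\<^sub>3)\<close>; the assignment of the differences
  to the three singular points is left open.\<close>

definition hypergeometric_E ::
    "complex \<Rightarrow> complex \<Rightarrow> complex \<Rightarrow> complex \<Rightarrow> complex \<Rightarrow> complex \<Rightarrow> bool" where
  "hypergeometric_E d\<^sub>1 d\<^sub>2 d\<^sub>3 A B C \<longleftrightarrow>
     (\<exists>e\<^sub>0 e\<^sub>1 e\<^sub>i. {#e\<^sub>0, e\<^sub>1, e\<^sub>i#} = {#d\<^sub>1, d\<^sub>2, d\<^sub>3#} \<and> exponent_differences A B C e\<^sub>0 e\<^sub>1 e\<^sub>i)"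

section \<open>Logarithmic solutions\<close>

text \<open>Local parameters (as functions of \<open>z\<close>) at the singular points \<open>0\<close>, \<open>1\<close> and infinity.\<close>

definition local_parameters :: "(complex \<Rightarrow> complex) set" where
  "local_parameters = {\<lambda>z. z, \<lambda>z. z - 1, \<lambda>z. inverse z}"

text \<open>The disc \<open>\<bar>t\<bar> < r\<close> slit along the branch cut of the principal power \<open>t powr \<alpha>\<close>. The slit also
  removes the singular point itself, and the spurious point \<open>z = 0\<close>, at which \<open>inverse z = 0\<close>.
  For \<open>r \<le> 1\<close> no other singular point lies in this set.\<close>

definition slit_disc :: "(complex \<Rightarrow> complex) \<Rightarrow> real \<Rightarrow> complex set" where
  "slit_disc t r = {z. norm (t z) < r \<and> t z \<notin> \<real>\<^sub>\<le>\<^sub>0}"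

definition has_power_basis_at ::
    "complex \<Rightarrow> complex \<Rightarrow> complex \<Rightarrow> (complex \<Rightarrow> complex) \<Rightarrow> bool" where
  "has_power_basis_at A B C t \<longleftrightarrow>
     (\<exists>r (\<alpha> :: 2 \<Rightarrow> complex) (f :: 2 \<Rightarrow> complex \<Rightarrow> complex).
        0 < r \<and> r \<le> 1 \<and> (\<forall>i. f i analytic_on {0}) \<and>
        solution_basis A B C (slit_disc t r) (\<lambda>i z. t z powr \<alpha> i * f i (t z)))"

definition has_logarithmic_solutions :: "complex \<Rightarrow> complex \<Rightarrow> complex \<Rightarrow> bool" where
  "has_logarithmic_solutions A B C \<longleftrightarrow> (\<exists>t\<in>local_parameters. \<not> has_power_basis_at A B C t)"

section \<open>The monodromy group\<close>

text \<open>\<open>w\<close> (as a germ at the end of \<open>g\<close>) is the analytic continuation along \<open>g\<close> of \<open>y\<close> (as a germ at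
  the start of \<open>g\<close>): there are germs \<open>F s\<close> at \<open>g s\<close> such that for \<open>s\<close> near \<open>u\<close>, the germ \<open>F s\<close> is the
  one that the function \<open>F u\<close> defines at \<open>g s\<close>.\<close>

definition analytic_continuation_along ::
    "(real \<Rightarrow> complex) \<Rightarrow> (complex \<Rightarrow> complex) \<Rightarrow> (complex \<Rightarrow> complex) \<Rightarrow> bool" where
  "analytic_continuation_along g y w \<longleftrightarrow>
     (\<exists>F :: real \<Rightarrow> complex \<Rightarrow> complex.
        (\<forall>u\<in>{0..1}. F u analytic_on {g u}) \<and>
        (\<forall>u\<in>{0..1}. \<forall>\<^sub>F s in at u within {0..1}. \<forall>\<^sub>F z in nhds (g s). F s z = F u z) \<and>
        (\<forall>\<^sub>F z in nhds (pathstart g). F 0 z = y z) \<and>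
        (\<forall>\<^sub>F z in nhds (pathfinish g). F 1 z = w z))"

definition GL2 :: "(complex ^ 2 ^ 2) monoid" where
  "GL2 = \<lparr>carrier = {M. invertible M}, mult = (**), one = mat 1\<rparr>"

text \<open>The monodromy group at the base point \<open>b\<close> as a group of matrices with respect to the basis
  \<open>Y 1, Y 2\<close> of the solutions near \<open>b\<close>: continuation along a loop maps \<open>Y j\<close> to the combination
  whose coefficients are the \<open>j\<close>-th column of the matrix. Homotopic loops give the same matrix,
  so ranging over loops instead of their classes in the fundamental group gives the same image.\<close>

definition monodromy_group ::
    "complex \<Rightarrow> (2 \<Rightarrow> complex \<Rightarrow> complex) \<Rightarrow> (complex ^ 2 ^ 2) monoid" where
  "monodromy_group b Y = GL2\<lparr>carrier := {M \<in> carrier GL2.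
     \<exists>g. path g \<and> path_image g \<subseteq> - {0, 1} \<and> pathstart g = b \<and> pathfinish g = b \<and>
         (\<forall>j. analytic_continuation_along g (Y j) (\<lambda>z. \<Sum>i\<in>UNIV. M $ i $ j * Y i z))}\<rparr>"

text \<open>The infinite dihedral group, as the group of the maps \<open>x \<mapsto> c \<plusminus> x\<close> on the integers.\<close>

definition infinite_dihedral_group :: "(int \<Rightarrow> int) monoid" where
  "infinite_dihedral_group =
     \<lparr>carrier = {f. \<exists>c. f = (\<lambda>x. c + x) \<or> f = (\<lambda>x. c - x)}, mult = (\<circ>), one = id\<rparr>"

end

theory Submission
  imports Defs
begin

text \<open>
  The proof has two halves: a local one, which decides where logarithms occur, and a global one, which finds the monodromy.

  \<^bold>\<open>Logarithms.\<close> At each singular point the hypergeometric equation has the form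
  \<open>(\<theta> - \<rho>) (\<theta> - \<rho>') y = \<plusminus> t (\<theta> + \<mu>) (\<theta> + \<nu>) y\<close> with \<open>\<theta> = t d/dt\<close>, in a suitable local parameter \<open>t\<close>. Power
  series solutions obey a two-term recursion, so a logarithm can only be forced if the exponents differ by an integer
  \<open>n\<close>, and it is absent exactly if one of the \<open>n\<close> numbers \<open>(\<rho> + j + \<mu>) (\<rho> + j + \<nu>)\<close>, \<open>0 \<le> j < n\<close>, vanishes, where \<open>\<rho>\<close> is
  the smaller exponent (\<open>has_local_power_basisI\<close>, \<open>has_local_power_basisD\<close>). Since all exponents add up to \<open>1\<close>,
  this is a condition on \<open>k, l, n\<close>, and it is the stated one (\<open>obstruction_iff\<close>).

  \<^bold>\<open>Monodromy.\<close> The map \<open>x \<mapsto> - tan\<^sup>2 x\<close> is a Galois covering of the plane without \<open>0\<close> and \<open>1\<close>, and its deck group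
  consists of the maps \<open>x \<mapsto> \<plusminus> x + m \<pi>\<close>: it is itself an infinite dihedral group. For the parameters in question every solution
  becomes single-valued on the covering surface, so the monodromy group is the image of the deck group
  in its action on the lifted solutions (\<open>carrier_monodromy_group\<close>). To see this, and to find the action, note that one of
  \<open>A, B\<close>, say \<open>A\<close>, is an integer, that \<open>B\<close> is a half-integer, and that \<open>C - B\<close> is an integer. Contiguity relations are
  differential operators that shift the parameters by integers; they commute with the deck group, and they are
  invertible unless \<open>A\<close> or \<open>C - B\<close> steps between \<open>0\<close> and \<open>1\<close>. This leaves four equations, with the solutions
  \<open>1, x\<close> and \<open>cot x, x cot x\<close> and \<open>1, cot x\<close> and \<open>cos\<^sup>2 x, sin x cos x\<close> (\<open>elementary_equivariant_pairs\<close>). In the first two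
  cases the translation by \<open>\<pi>\<close> acts by a nontrivial unipotent matrix and the deck group acts faithfully; in the last two it acts
  through the sign \<open>\<plusminus>\<close>. Which case occurs depends on whether \<open>A\<close> and \<open>C - B\<close> are both \<open>\<le> 0\<close> or
  both \<open>\<ge> 1\<close>, and this is once more the vanishing of an obstruction, now at \<open>z = 1\<close> (\<open>integer_parameter_class\<close>).
\<close>

section \<open>Euler operator and slit discs\<close>

text \<open>The Euler operator is \<open>\<theta> = t d/dt\<close>. It acts on \<open>t\<^sup>\<alpha>\<close> by the scalar \<open>\<alpha>\<close> and is invariant
  under rescaling of \<open>t\<close>, which keeps the computations with local exponents linear.\<close>

definition euler :: "(complex \<Rightarrow> complex) \<Rightarrow> complex \<Rightarrow> complex" where
  "euler y t = t * deriv y t"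

text \<open>The equation \<open>(\<theta> - \<rho>) (\<theta> - \<rho>') y = \<sigma> t (\<theta> + \<mu>) (\<theta> + \<nu>) y\<close>, expanded. With \<open>\<sigma> = \<plusminus>1\<close> it is
  the common form of the hypergeometric equation in each of the three local parameters; \<open>\<rho>\<close> and
  \<open>\<rho>'\<close> are the local exponents at \<open>t = 0\<close>.\<close>

definition euler_solution ::
    "complex \<Rightarrow> complex \<Rightarrow> complex \<Rightarrow> complex \<Rightarrow> complex \<Rightarrow> complex set \<Rightarrow> (complex \<Rightarrow> complex) \<Rightarrow> bool" where
  "euler_solution \<sigma> \<rho> \<rho>' \<mu> \<nu> S y \<longleftrightarrow> y holomorphic_on S \<and>
     (\<forall>t\<in>S. euler (euler y) t - (\<rho> + \<rho>') * euler y t + \<rho> * \<rho>' * y t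
            = \<sigma> * t * (euler (euler y) t + (\<mu> + \<nu>) * euler y t + \<mu> * \<nu> * y t))"

abbreviation slit :: "real \<Rightarrow> complex set" where "slit r \<equiv> slit_disc (\<lambda>t. t) r"

lemma deriv_cong_open:
  fixes f g :: "complex \<Rightarrow> complex"
  assumes "open S" "z \<in> S" "\<And>z. z \<in> S \<Longrightarrow> f z = g z"
  shows "deriv f z = deriv g z"
  using assms eventually_nhds by (intro deriv_cong_ev refl) blast

lemma euler_cong_open:
  assumes "open S" "z \<in> S" "\<And>z. z \<in> S \<Longrightarrow> f z = g z"
  shows "euler f z = euler g z" "euler (euler f) z = euler (euler g) z"
proof -
  have *: "euler f z = euler g z" if "z \<in> S" for z
    unfolding euler_def using deriv_cong_open[OF assms(1) that assms(3)] by simp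
  have "deriv (euler f) z = deriv (euler g) z"
    by (rule deriv_cong_open[OF assms(1,2) *])
  then show "euler (euler f) z = euler (euler g) z" unfolding euler_def[of "euler f"] euler_def[of "euler g"] by simp
  show "euler f z = euler g z" by (rule *[OF assms(2)])
qed

lemma euler_holomorphic:
  assumes "open S" "f holomorphic_on S" shows "euler f holomorphic_on S"
  unfolding euler_def[abs_def] using assms by (intro holomorphic_intros)

lemma euler_euler_eq:
  assumes "open S" "f holomorphic_on S" "t \<in> S"
  shows "euler (euler f) t = t * deriv f t + t^2 * deriv (deriv f) t"
proof -
  have "(deriv f has_field_derivative deriv (deriv f) t) (at t)"
    using assms holomorphic_derivI holomorphic_deriv by blast
  then have "(euler f has_field_derivative (deriv f t + t * deriv (deriv f) t)) (at t)"
    unfolding euler_def[abs_def] by (auto intro!: derivative_eq_intros)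
  then show ?thesis unfolding euler_def[of "euler f"] by (simp add: DERIV_imp_deriv algebra_simps power2_eq_square)
qed

lemma euler_mult:
  assumes "open S" "f holomorphic_on S" "g holomorphic_on S" "t \<in> S"
  shows "euler (\<lambda>t. f t * g t) t = euler f t * g t + f t * euler g t"
proof -
  have "f field_differentiable at t" "g field_differentiable at t"
    using assms holomorphic_on_imp_differentiable_at by blast+
  then show ?thesis unfolding euler_def by (simp add: deriv_mult algebra_simps)
qed

lemma euler_add:
  assumes "open S" "f holomorphic_on S" "g holomorphic_on S" "t \<in> S"
  shows "euler (\<lambda>t. f t + g t) t = euler f t + euler g t"
proof -
  have "f field_differentiable at t" "g field_differentiable at t"
    using assms holomorphic_on_imp_differentiable_at by blast+
  then show ?thesis unfolding euler_def by (simp add: algebra_simps)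
qed

lemma euler_cmult:
  assumes "open S" "f holomorphic_on S" "t \<in> S"
  shows "euler (\<lambda>t. c * f t) t = c * euler f t"
proof -
  have "f field_differentiable at t"
    using assms holomorphic_on_imp_differentiable_at by blast+
  then show ?thesis unfolding euler_def by (simp add: algebra_simps)
qed

lemma open_slit: "open (slit r)"
proof -
  have "slit r = ball 0 r \<inter> - \<real>\<^sub>\<le>\<^sub>0" by (auto simp: slit_disc_def)
  then show ?thesis by (simp add: open_Int open_Compl)
qed

lemma slit_nonzero: "t \<in> slit r \<Longrightarrow> t \<noteq> 0" by (auto simp: slit_disc_def)

lemma slit_one_minus: "t \<in> slit r \<Longrightarrow> r \<le> 1 \<Longrightarrow> \<sigma> \<in> {1,-1} \<Longrightarrow> 1 - \<sigma> * t \<noteq> 0"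
proof
  assume t: "t \<in> slit r" "r \<le> 1" "\<sigma> \<in> {1,-1}" and "1 - \<sigma> * t = 0"
  then have "norm (\<sigma> * t) = 1" by simp
  moreover have "norm \<sigma> = 1" using t(3) by auto
  ultimately show False using t by (auto simp: slit_disc_def norm_mult)
qed

text \<open>The slit disc is star-shaped about the points of its positive radius.\<close>

lemma connected_slit: "connected (slit r)"
proof (cases "0 < r")
  case True
  have "starlike (slit r)"
    unfolding starlike_def
  proof (intro bexI[of _ "of_real (r/2)"] ballI subsetI)
    fix t x assume t: "t \<in> slit r" and x: "x \<in> closed_segment (complex_of_real (r/2)) t"
    then obtain u where u: "0 \<le> u" "u \<le> 1" and xu: "x = (1-u) *\<^sub>R of_real (r/2) + u *\<^sub>R t"
      by (auto simp: closed_segment_def)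
    have 1: "x \<in> ball 0 r"
    proof -
      have "closed_segment (complex_of_real (r/2)) t \<subseteq> ball 0 r"
        using t True by (intro closed_segment_subset convex_ball) (auto simp: slit_disc_def)
      then show ?thesis using x by blast
    qed
    have 2: "x \<notin> \<real>\<^sub>\<le>\<^sub>0"
    proof
      assume "x \<in> \<real>\<^sub>\<le>\<^sub>0"
      then have im: "u * Im t = 0" and re: "(1-u) * (r/2) + u * Re t \<le> 0"
        by (auto simp: complex_nonpos_Reals_iff xu)
      from im have "u = 0 \<or> Im t = 0" by simp
      then show False
      proof
        assume "u = 0" then show False using re True by simp
      next
        assume "Im t = 0"
        then have "Re t > 0" using t by (auto simp: slit_disc_def complex_nonpos_Reals_iff)
        then have "u * Re t \<ge> 0" using u by simp
        then show False
        proof (cases "u = 1")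
          case False
          then have "(1-u) * (r/2) > 0" using u True by simp
          then show ?thesis using re \<open>u * Re t \<ge> 0\<close> by linarith
        qed (use re \<open>Re t > 0\<close> in simp)
      qed
    qed
    show "x \<in> slit r" using 1 2 by (auto simp: slit_disc_def)
  next
    show "complex_of_real (r/2) \<in> slit r" using True by (auto simp: slit_disc_def complex_nonpos_Reals_iff)
  qed
  then show ?thesis by (rule starlike_imp_connected)
next
  case False
  then have "slit r = {}" by (auto simp: slit_disc_def) (meson dual_order.trans norm_ge_zero not_less)
  then show ?thesis by simp
qed

lemma islimpt_slit: assumes "0 < r" shows "0 islimpt slit r"
proof (rule islimptI)
  fix T :: "complex set" assume "0 \<in> T" "open T"
  then obtain e where e: "e > 0" "ball 0 e \<subseteq> T" by (meson openE)
  have "complex_of_real (min e r / 2) \<in> slit r" "complex_of_real (min e r / 2) \<in> T"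
    "complex_of_real (min e r / 2) \<noteq> 0"
    using assms e by (auto simp: slit_disc_def complex_nonpos_Reals_iff subset_iff)
  then show "\<exists>y\<in>slit r. y \<in> T \<and> y \<noteq> 0" by blast
qed

lemma slit_mono: "r \<le> r' \<Longrightarrow> slit r \<subseteq> slit r'" by (auto simp: slit_disc_def)

lemma powr_holomorphic_slit: "(\<lambda>t. t powr \<alpha>) holomorphic_on slit r"
  by (intro holomorphic_intros) (auto simp: slit_disc_def)

lemma euler_powr:
  assumes "t \<in> slit r"
  shows "euler (\<lambda>t. t powr \<alpha>) t = \<alpha> * t powr \<alpha>"
proof -
  have "((\<lambda>t. t powr \<alpha>) has_field_derivative (\<alpha> * t powr (\<alpha> - 1))) (at t)"
    using assms by (intro has_field_derivative_powr) (auto simp: slit_disc_def)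
  then have "deriv (\<lambda>t. t powr \<alpha>) t = \<alpha> * t powr (\<alpha> - 1)" by (rule DERIV_imp_deriv)
  then show ?thesis using slit_nonzero[OF assms] unfolding euler_def by (simp add: powr_diff)
qed

lemma euler_powr_mult:
  assumes "f holomorphic_on slit r" "t \<in> slit r"
  shows "euler (\<lambda>t. t powr \<alpha> * f t) t = t powr \<alpha> * (\<alpha> * f t + euler f t)"
    and "euler (euler (\<lambda>t. t powr \<alpha> * f t)) t = t powr \<alpha> * (\<alpha>^2 * f t + 2 * \<alpha> * euler f t + euler (euler f) t)"
proof -
  have *: "euler (\<lambda>t. t powr \<alpha> * f t) t = t powr \<alpha> * (\<alpha> * f t + euler f t)"
    if "f holomorphic_on slit r" "t \<in> slit r" for f t
    using that euler_mult[OF open_slit powr_holomorphic_slit, of f r t \<alpha>] euler_powr[of t r \<alpha>]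
    by (simp add: algebra_simps)
  show "euler (\<lambda>t. t powr \<alpha> * f t) t = t powr \<alpha> * (\<alpha> * f t + euler f t)" by (rule *[OF assms])
  have h: "(\<lambda>t. \<alpha> * f t) holomorphic_on slit r" "euler f holomorphic_on slit r"
    using assms(1) euler_holomorphic[OF open_slit] by (auto intro!: holomorphic_intros)
  have "euler (euler (\<lambda>t. t powr \<alpha> * f t)) t = euler (\<lambda>t. t powr \<alpha> * (\<alpha> * f t + euler f t)) t"
    by (rule euler_cong_open(1)[OF open_slit assms(2) *[OF assms(1)]])
  also have "\<dots> = t powr \<alpha> * (\<alpha> * (\<alpha> * f t + euler f t) + euler (\<lambda>t. \<alpha> * f t + euler f t) t)"
    by (rule *) (use assms h in \<open>auto intro!: holomorphic_intros\<close>)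
  also have "euler (\<lambda>t. \<alpha> * f t + euler f t) t = \<alpha> * euler f t + euler (euler f) t"
    using euler_add[OF open_slit h assms(2)] euler_cmult[OF open_slit assms] by simp
  finally show "euler (euler (\<lambda>t. t powr \<alpha> * f t)) t = t powr \<alpha> * (\<alpha>^2 * f t + 2 * \<alpha> * euler f t + euler (euler f) t)"
    by (simp add: algebra_simps power2_eq_square)
qed

text \<open>Conjugation by \<open>t\<^sup>\<alpha>\<close> replaces \<open>\<theta>\<close> by \<open>\<theta> + \<alpha>\<close>. Hence a factor \<open>t\<^sup>\<alpha>\<close> only shifts the four
  parameters, and questions about \<open>t\<^sup>\<alpha> f(t)\<close> become questions about the power series \<open>f\<close>.\<close>

lemma euler_solution_powr_mult_iff:
  assumes f: "f holomorphic_on slit r"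
  shows "euler_solution \<sigma> \<rho> \<rho>' \<mu> \<nu> (slit r) (\<lambda>t. t powr \<alpha> * f t) \<longleftrightarrow>
         euler_solution \<sigma> (\<rho> - \<alpha>) (\<rho>' - \<alpha>) (\<mu> + \<alpha>) (\<nu> + \<alpha>) (slit r) f"
proof -
  have hol: "(\<lambda>t. t powr \<alpha> * f t) holomorphic_on slit r"
    by (intro holomorphic_on_mult powr_holomorphic_slit f)
  define G where "G t = (\<alpha>^2 * f t + 2 * \<alpha> * euler f t + euler (euler f) t) - (\<rho> + \<rho>') * (\<alpha> * f t + euler f t)
      + \<rho> * \<rho>' * f t - \<sigma> * t * ((\<alpha>^2 * f t + 2 * \<alpha> * euler f t + euler (euler f) t)
      + (\<mu> + \<nu>) * (\<alpha> * f t + euler f t) + \<mu> * \<nu> * f t)" for t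
  have "euler_solution \<sigma> \<rho> \<rho>' \<mu> \<nu> (slit r) (\<lambda>t. t powr \<alpha> * f t) \<longleftrightarrow> (\<forall>t\<in>slit r. t powr \<alpha> * G t = 0)"
    unfolding euler_solution_def using hol euler_powr_mult[OF f] by (simp add: G_def algebra_simps)
  also have "\<dots> \<longleftrightarrow> (\<forall>t\<in>slit r. G t = 0)"
    using slit_nonzero by auto
  also have "\<dots> \<longleftrightarrow> euler_solution \<sigma> (\<rho> - \<alpha>) (\<rho>' - \<alpha>) (\<mu> + \<alpha>) (\<nu> + \<alpha>) (slit r) f"
    unfolding euler_solution_def using f by (simp add: G_def algebra_simps power2_eq_square)
  finally show ?thesis .
qed

section \<open>Frobenius series\<close>

text \<open>Since \<open>\<theta> t\<^sup>n = n t\<^sup>n\<close>, the equation for a power series is a two-term recursion. At an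
  index \<open>n + 1\<close> equal to an exponent its left side vanishes, and the recursion becomes a
  condition on the earlier coefficients: this is the only possible obstruction.\<close>

definition frobenius_recursion ::
    "complex \<Rightarrow> complex \<Rightarrow> complex \<Rightarrow> complex \<Rightarrow> complex \<Rightarrow> complex fps \<Rightarrow> bool" where
  "frobenius_recursion \<sigma> \<rho> \<rho>' \<mu> \<nu> F \<longleftrightarrow> \<rho> * \<rho>' * fps_nth F 0 = 0 \<and>
     (\<forall>n. (of_nat n + 1 - \<rho>) * (of_nat n + 1 - \<rho>') * fps_nth F (Suc n)
          = \<sigma> * (of_nat n + \<mu>) * (of_nat n + \<nu>) * fps_nth F n)"

lemma has_fps_expansion_euler:
  assumes "f has_fps_expansion F"
  shows "euler f has_fps_expansion (fps_X * fps_deriv F)"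
  unfolding euler_def[abs_def] using assms
  by (intro has_fps_expansion_mult has_fps_expansion_deriv has_fps_expansion_fps_X)

lemma has_fps_expansion_equation:
  assumes "f has_fps_expansion F"
  shows "\<exists>G. (\<lambda>t. euler (euler f) t - (\<rho> + \<rho>') * euler f t + \<rho> * \<rho>' * f t
      - \<sigma> * (t * (euler (euler f) t + (\<mu> + \<nu>) * euler f t + \<mu> * \<nu> * f t))) has_fps_expansion G \<and>
      (G = 0 \<longleftrightarrow> frobenius_recursion \<sigma> \<rho> \<rho>' \<mu> \<nu> F)"
proof -
  define T where "T F = fps_X * fps_deriv F" for F :: "complex fps"
  have T: "fps_nth (T F) n = of_nat n * fps_nth F n" for F n
    by (cases n) (simp_all add: T_def)
  define G where "G = T (T F) - fps_const (\<rho> + \<rho>') * T F + fps_const (\<rho> * \<rho>') * F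
      - fps_const \<sigma> * (fps_X * (T (T F) + fps_const (\<mu> + \<nu>) * T F + fps_const (\<mu> * \<nu>) * F))"
  have exps: "euler f has_fps_expansion T F" "euler (euler f) has_fps_expansion T (T F)"
    unfolding T_def using assms by (intro has_fps_expansion_euler; assumption)+
  have "(\<lambda>t. euler (euler f) t - (\<rho> + \<rho>') * euler f t + \<rho> * \<rho>' * f t
      - \<sigma> * (t * (euler (euler f) t + (\<mu> + \<nu>) * euler f t + \<mu> * \<nu> * f t))) has_fps_expansion G"
    unfolding G_def using assms exps
    by (intro has_fps_expansion_add has_fps_expansion_diff has_fps_expansion_cmult_left
        has_fps_expansion_mult[of "\<lambda>t. t"] has_fps_expansion_fps_X)
  moreover have "G = 0 \<longleftrightarrow> frobenius_recursion \<sigma> \<rho> \<rho>' \<mu> \<nu> F"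
  proof -
    have 0: "fps_nth G 0 = \<rho> * \<rho>' * fps_nth F 0"
      by (simp add: G_def T)
    have S: "fps_nth G (Suc n) = (of_nat n + 1 - \<rho>) * (of_nat n + 1 - \<rho>') * fps_nth F (Suc n)
          - \<sigma> * (of_nat n + \<mu>) * (of_nat n + \<nu>) * fps_nth F n" for n
      by (simp add: G_def T) (simp add: algebra_simps)
    have "G = 0 \<longleftrightarrow> fps_nth G 0 = 0 \<and> (\<forall>n. fps_nth G (Suc n) = 0)"
      unfolding fps_eq_iff by (metis fps_zero_nth not0_implies_Suc)
    then show ?thesis unfolding frobenius_recursion_def by (simp add: 0 S)
  qed
  ultimately show ?thesis by blast
qed

lemma recursion_imp_euler_solution:
  assumes f: "f has_fps_expansion F" and rec: "frobenius_recursion \<sigma> \<rho> \<rho>' \<mu> \<nu> F"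
  shows "\<exists>r>0. euler_solution \<sigma> \<rho> \<rho>' \<mu> \<nu> (ball 0 r) f"
proof -
  have "(\<lambda>t. euler (euler f) t - (\<rho> + \<rho>') * euler f t + \<rho> * \<rho>' * f t
      - \<sigma> * (t * (euler (euler f) t + (\<mu> + \<nu>) * euler f t + \<mu> * \<nu> * f t))) has_fps_expansion 0"
    using has_fps_expansion_equation[OF f, of \<rho> \<rho>' \<sigma> \<mu> \<nu>] rec by blast
  then have "\<forall>\<^sub>F t in nhds 0. euler (euler f) t - (\<rho> + \<rho>') * euler f t + \<rho> * \<rho>' * f t
      - \<sigma> * (t * (euler (euler f) t + (\<mu> + \<nu>) * euler f t + \<mu> * \<nu> * f t)) = 0"
    by (auto simp: has_fps_expansion_def elim: eventually_mono)
  then obtain d where d: "d > 0" "\<And>t. dist t 0 < d \<Longrightarrow> euler (euler f) t - (\<rho> + \<rho>') * euler f t + \<rho> * \<rho>' * f t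
      - \<sigma> * (t * (euler (euler f) t + (\<mu> + \<nu>) * euler f t + \<mu> * \<nu> * f t)) = 0"
    unfolding eventually_nhds_metric by blast
  obtain s where s: "open s" "0 \<in> s" "f holomorphic_on s"
    using has_fps_expansion_imp_holomorphic[OF f] by metis
  then obtain e where e: "e > 0" "ball 0 e \<subseteq> s" by (meson openE)
  show ?thesis
    unfolding euler_solution_def
  proof (intro exI[of _ "min d e"] conjI ballI)
    show "f holomorphic_on ball 0 (min d e)"
      by (rule holomorphic_on_subset[OF s(3)]) (use e in auto)
  qed (use d e in \<open>auto simp: mult.assoc\<close>)
qed

text \<open>A solution on the slit disc satisfies the equation near \<open>0\<close> by analytic continuation,
  because \<open>0\<close> is a limit point of the slit disc.\<close>

lemma euler_solution_imp_recursion: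
  assumes f: "f has_fps_expansion F" and sol: "euler_solution \<sigma> \<rho> \<rho>' \<mu> \<nu> (slit r) f" and "r > 0"
  shows "frobenius_recursion \<sigma> \<rho> \<rho>' \<mu> \<nu> F"
proof -
  define g where "g t = euler (euler f) t - (\<rho> + \<rho>') * euler f t + \<rho> * \<rho>' * f t
      - \<sigma> * (t * (euler (euler f) t + (\<mu> + \<nu>) * euler f t + \<mu> * \<nu> * f t))" for t
  obtain G where G: "g has_fps_expansion G" "G = 0 \<longleftrightarrow> frobenius_recursion \<sigma> \<rho> \<rho>' \<mu> \<nu> F"
    using has_fps_expansion_equation[OF f, of \<rho> \<rho>' \<sigma> \<mu> \<nu>] unfolding g_def[abs_def] by blast
  obtain s where s: "open s" "0 \<in> s" "g holomorphic_on s"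
    using has_fps_expansion_imp_holomorphic[OF G(1)] by metis
  then obtain e where e: "e > 0" "ball 0 e \<subseteq> s" by (meson openE)
  have lim: "0 islimpt slit (min r e)" by (rule islimpt_slit) (use assms e in auto)
  have "g t = 0" if "t \<in> ball 0 e" for t
  proof (rule analytic_continuation[of g "ball 0 e" "slit (min r e)" 0])
    show "g holomorphic_on ball 0 e" using s e holomorphic_on_subset by blast
    show "g z = 0" if "z \<in> slit (min r e)" for z
      using sol that slit_mono[of "min r e" r] unfolding euler_solution_def g_def by (auto simp: mult.assoc)
  qed (use e lim that in \<open>auto simp: slit_disc_def\<close>)
  then have "\<forall>\<^sub>F t in nhds 0. g t = 0"
    using e by (auto simp: eventually_nhds_metric dist_commute)
  then have "(\<lambda>_. 0) has_fps_expansion G"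
    using G(1) has_fps_expansion_cong by fastforce
  then have "G = 0"
    using fps_expansion_unique_complex has_fps_expansion_0 by blast
  then show ?thesis using G by simp
qed

text \<open>The solution with exponent \<open>0\<close> and constant term \<open>1\<close>. If \<open>\<delta>\<close> is a positive integer, one
  factor has denominator \<open>0\<close> and therefore counts as \<open>0\<close>: the series is cut off before the
  resonant index. In the unobstructed case this truncation is again a solution.\<close>

definition frobenius_series :: "complex \<Rightarrow> complex \<Rightarrow> complex \<Rightarrow> complex \<Rightarrow> complex fps" where
  "frobenius_series \<sigma> \<delta> a b = Abs_fps (\<lambda>n. \<Prod>i<n. \<sigma> * (of_nat i + a) * (of_nat i + b) / ((of_nat i + 1) * (of_nat i + 1 - \<delta>)))"

lemma frobenius_series_recursion:
  assumes "\<And>n. of_nat n + 1 = \<delta> \<Longrightarrow> \<exists>j\<le>n. (of_nat j + a) * (of_nat j + b) = 0"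
  shows "frobenius_recursion \<sigma> 0 \<delta> a b (frobenius_series \<sigma> \<delta> a b)"
  unfolding frobenius_recursion_def
proof (intro conjI allI)
  fix n
  define F where "F = frobenius_series \<sigma> \<delta> a b"
  have Suc: "fps_nth F (Suc n) = fps_nth F n * (\<sigma> * (of_nat n + a) * (of_nat n + b) / ((of_nat n + 1) * (of_nat n + 1 - \<delta>)))" for n
    by (simp add: F_def frobenius_series_def)
  have n1: "(of_nat n + 1 :: complex) \<noteq> 0" by (metis of_nat_Suc of_nat_neq_0 add.commute)
  show "(of_nat n + 1 - 0) * (of_nat n + 1 - \<delta>) * fps_nth F (Suc n)
          = \<sigma> * (of_nat n + a) * (of_nat n + b) * fps_nth F n"
  proof (cases "of_nat n + 1 = \<delta>")
    case False
    then show ?thesis using n1 by (simp add: Suc)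
  next
    case True
    then obtain j where j: "j \<le> n" "(of_nat j + a) * (of_nat j + b) = 0" using assms by blast
    have "(of_nat n + a) * (of_nat n + b) * fps_nth F n = 0"
    proof (cases "j = n")
      case True then show ?thesis using j by simp
    next
      case False
      then have "fps_nth F n = 0" using j unfolding F_def frobenius_series_def
        by (auto simp: prod_zero_iff intro!: bexI[of _ j])
      then show ?thesis by simp
    qed
    then have "\<sigma> * (of_nat n + a) * (of_nat n + b) * fps_nth F n = 0" by auto
    then show ?thesis using True by simp
  qed
qed simp

text \<open>The quotients of consecutive coefficients converge to \<open>\<sigma>\<close>, hence are bounded by some
  \<open>K\<close>, and the coefficients are bounded by \<open>K\<^sup>n\<close>. A positive radius suffices for all local
  statements.\<close>

lemma frobenius_series_conv_radius:
  "fps_conv_radius (frobenius_series \<sigma> \<delta> a b) > 0"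
proof -
  define q where "q i = \<sigma> * (of_nat i + a) * (of_nat i + b) / ((of_nat i + 1) * (of_nat i + 1 - \<delta>))" for i :: nat
  have *: "(\<lambda>i. (of_nat i + x) / (of_nat i + 1 - y)) \<longlonglongrightarrow> 1" for x y :: complex
  proof -
    have "(\<lambda>i. (1 + x / of_nat i) / (1 + (1 - y) / of_nat i)) \<longlonglongrightarrow> (1 + 0) / (1 + 0)"
      by (intro tendsto_divide tendsto_add tendsto_const lim_const_over_n) simp
    moreover have "\<forall>\<^sub>F i in sequentially. (1 + x / of_nat i) / (1 + (1 - y) / of_nat i) = (of_nat i + x) / (of_nat i + 1 - y)"
      using eventually_gt_at_top[of 0]
    proof eventually_elim
      case (elim i)
      then have "(1 + x / of_nat i) = (of_nat i + x) / of_nat i" "(1 + (1 - y) / of_nat i) = (of_nat i + 1 - y) / of_nat i"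
        by (simp_all add: field_simps)
      then show ?case using elim by simp
    qed
    ultimately show ?thesis by (simp add: Lim_transform_eventually)
  qed
  have "(\<lambda>i. \<sigma> * ((of_nat i + a) / (of_nat i + 1 - 0)) * ((of_nat i + b) / (of_nat i + 1 - \<delta>))) \<longlonglongrightarrow> \<sigma> * 1 * 1"
    by (intro tendsto_mult tendsto_const *)
  then have "q \<longlonglongrightarrow> \<sigma>" by (simp add: q_def[abs_def] mult.assoc)
  then have "Bseq q" using convergentI convergent_imp_Bseq by blast
  then obtain K where K: "K > 0" "\<And>i. norm (q i) \<le> K" unfolding Bseq_def by auto
  have bound: "norm (fps_nth (frobenius_series \<sigma> \<delta> a b) n) \<le> K ^ n" for n
  proof -
    have "norm (\<Prod>i<n. q i) \<le> (\<Prod>i<n. K)"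
      unfolding prod_norm[symmetric] by (rule prod_mono) (use K in auto)
    then show ?thesis by (simp add: frobenius_series_def q_def)
  qed
  have "fps_conv_radius (frobenius_series \<sigma> \<delta> a b) \<ge> norm (complex_of_real (1 / (2 * K)))"
    unfolding fps_conv_radius_def
  proof (rule conv_radius_geI)
    show "summable (\<lambda>n. fps_nth (frobenius_series \<sigma> \<delta> a b) n * of_real (1 / (2 * K)) ^ n)"
    proof (rule summable_comparison_test'[of "\<lambda>n. (1/2)^n" 0])
      fix n
      have "norm (fps_nth (frobenius_series \<sigma> \<delta> a b) n * of_real (1 / (2 * K)) ^ n) \<le> K ^ n * (1 / (2 * K)) ^ n"
        using K bound[of n] by (simp add: norm_mult norm_power norm_divide divide_right_mono)
      also have "\<dots> = (1/2)^n" using K by (simp add: power_divide power_mult_distrib)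
      finally show "norm (fps_nth (frobenius_series \<sigma> \<delta> a b) n * of_real (1 / (2 * K)) ^ n) \<le> (1/2)^n" .
    qed simp
  qed
  moreover have "(0::ereal) < norm (complex_of_real (1 / (2 * K)))" using K by (simp add: norm_divide)
  ultimately show ?thesis by (meson less_le_trans)
qed

section \<open>Bases of local solutions and the resonance obstruction\<close>

definition euler_basis ::
    "complex \<Rightarrow> complex \<Rightarrow> complex \<Rightarrow> complex \<Rightarrow> complex \<Rightarrow> complex set \<Rightarrow> (2 \<Rightarrow> complex \<Rightarrow> complex) \<Rightarrow> bool" where
  "euler_basis \<sigma> \<rho> \<rho>' \<mu> \<nu> S Y \<longleftrightarrow>
     (\<forall>i. euler_solution \<sigma> \<rho> \<rho>' \<mu> \<nu> S (Y i)) \<and>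
     (\<forall>y. euler_solution \<sigma> \<rho> \<rho>' \<mu> \<nu> S y \<longrightarrow>
        (\<exists>!c :: complex ^ 2. \<forall>t\<in>S. y t = (\<Sum>i\<in>UNIV. c $ i * Y i t)))"

lemma euler_solution_subset:
  "euler_solution \<sigma> \<rho> \<rho>' \<mu> \<nu> S y \<Longrightarrow> T \<subseteq> S \<Longrightarrow> euler_solution \<sigma> \<rho> \<rho>' \<mu> \<nu> T y"
  unfolding euler_solution_def using holomorphic_on_subset by (meson subsetD)

lemma euler_solution_zero:
  assumes "open S" shows "euler_solution \<sigma> \<rho> \<rho>' \<mu> \<nu> S (\<lambda>_. 0)"
proof -
  have "euler (\<lambda>_. 0) = (\<lambda>_. 0)" by (auto simp: euler_def)
  then show ?thesis by (simp add: euler_solution_def)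
qed

lemma euler_diff:
  assumes "open S" "f holomorphic_on S" "g holomorphic_on S" "t \<in> S"
  shows "euler (\<lambda>t. f t - g t) t = euler f t - euler g t"
proof -
  have "f field_differentiable at t" "g field_differentiable at t"
    using assms holomorphic_on_imp_differentiable_at by blast+
  then show ?thesis unfolding euler_def by (simp add: algebra_simps)
qed

abbreviation wronskian :: "(complex \<Rightarrow> complex) \<Rightarrow> (complex \<Rightarrow> complex) \<Rightarrow> complex \<Rightarrow> complex" where
  "wronskian u v t \<equiv> u t * euler v t - v t * euler u t"

text \<open>All Wronskians satisfy one and the same first-order equation. Consequently the quotient
  of two of them is constant, which yields the coordinates of a solution without any existence
  or uniqueness theorem for differential equations.\<close>

lemma euler_wronskian:
  assumes "open S" "euler_solution \<sigma> \<rho> \<rho>' \<mu> \<nu> S u" "euler_solution \<sigma> \<rho> \<rho>' \<mu> \<nu> S v" "t \<in> S"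
  shows "(1 - \<sigma> * t) * euler (wronskian u v) t = (\<rho> + \<rho>' + \<sigma> * t * (\<mu> + \<nu>)) * wronskian u v t"
proof -
  have u: "u holomorphic_on S" "euler u holomorphic_on S" and v: "v holomorphic_on S" "euler v holomorphic_on S"
    using assms euler_holomorphic unfolding euler_solution_def by auto
  have "euler (wronskian u v) t = euler (\<lambda>t. u t * euler v t) t - euler (\<lambda>t. v t * euler u t) t"
    by (rule euler_diff[OF assms(1) _ _ assms(4)]) (intro holomorphic_intros u v)+
  then have *: "euler (wronskian u v) t = u t * euler (euler v) t - v t * euler (euler u) t"
    using euler_mult[OF assms(1) u(1) v(2) assms(4)] euler_mult[OF assms(1) v(1) u(2) assms(4)] by simp
  have eu: "euler (euler u) t - (\<rho> + \<rho>') * euler u t + \<rho> * \<rho>' * u t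
            = \<sigma> * t * (euler (euler u) t + (\<mu> + \<nu>) * euler u t + \<mu> * \<nu> * u t)"
    and ev: "euler (euler v) t - (\<rho> + \<rho>') * euler v t + \<rho> * \<rho>' * v t
            = \<sigma> * t * (euler (euler v) t + (\<mu> + \<nu>) * euler v t + \<mu> * \<nu> * v t)"
    using assms unfolding euler_solution_def by blast+
  show ?thesis unfolding * using eu ev by algebra
qed

lemma wronskian_ratio_constant:
  assumes S: "open S" "connected S" "0 \<notin> S" "\<And>t. t \<in> S \<Longrightarrow> 1 - \<sigma> * t \<noteq> 0"
    and sol: "euler_solution \<sigma> \<rho> \<rho>' \<mu> \<nu> S u" "euler_solution \<sigma> \<rho> \<rho>' \<mu> \<nu> S v"
      "euler_solution \<sigma> \<rho> \<rho>' \<mu> \<nu> S u'" "euler_solution \<sigma> \<rho> \<rho>' \<mu> \<nu> S v'"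
    and nz: "\<And>t. t \<in> S \<Longrightarrow> wronskian u v t \<noteq> 0"
  shows "\<exists>c. \<forall>t\<in>S. wronskian u' v' t = c * wronskian u v t"
proof -
  have hol: "wronskian u v holomorphic_on S" "wronskian u' v' holomorphic_on S"
    using sol S(1) unfolding euler_solution_def by (auto intro!: holomorphic_intros euler_holomorphic)
  define q where "q t = wronskian u' v' t / wronskian u v t" for t
  have q: "q holomorphic_on S" unfolding q_def using hol nz by (intro holomorphic_on_divide)
  have "(q has_field_derivative 0) (at t)" if t: "t \<in> S" for t
  proof -
    have d: "(wronskian u v has_field_derivative deriv (wronskian u v) t) (at t)"
       "(wronskian u' v' has_field_derivative deriv (wronskian u' v') t) (at t)"
      using hol S(1) t holomorphic_derivI by blast+
    have "t \<noteq> 0" using S(3) t by auto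
    have "(1 - \<sigma> * t) * t * (deriv (wronskian u' v') t * wronskian u v t - wronskian u' v' t * deriv (wronskian u v) t) = 0"
      using euler_wronskian[OF S(1) sol(1,2) t] euler_wronskian[OF S(1) sol(3,4) t]
      unfolding euler_def[of "wronskian u v"] euler_def[of "wronskian u' v'"] by algebra
    then have 0: "deriv (wronskian u' v') t * wronskian u v t - wronskian u' v' t * deriv (wronskian u v) t = 0"
      using \<open>t \<noteq> 0\<close> S(4)[OF t] by simp
    have "(q has_field_derivative (deriv (wronskian u' v') t * wronskian u v t - wronskian u' v' t * deriv (wronskian u v) t)
        / (wronskian u v t * wronskian u v t)) (at t)"
      unfolding q_def by (rule DERIV_divide[OF d(2,1) nz[OF t]])
    then show ?thesis by (simp only: 0 div_0)
  qed
  then obtain c where "\<And>t. t \<in> S \<Longrightarrow> q t = c"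
    using DERIV_zero_connected_constant[OF S(2,1) finite.emptyI holomorphic_on_imp_continuous_on[OF q]] by auto
  then have "\<forall>t\<in>S. wronskian u' v' t = c * wronskian u v t"
    using nz unfolding q_def by (metis nonzero_divide_eq_eq)
  then show ?thesis by blast
qed

text \<open>Cramer's rule: the coordinates of \<open>y\<close> are the quotients of the Wronskians of \<open>y, Y 2\<close>
  and \<open>Y 1, y\<close> by the Wronskian of \<open>Y 1, Y 2\<close>.\<close>

lemma euler_basisI:
  assumes S: "open S" "connected S" "0 \<notin> S" "\<And>t. t \<in> S \<Longrightarrow> 1 - \<sigma> * t \<noteq> 0" "S \<noteq> {}"
    and sol: "\<And>i. euler_solution \<sigma> \<rho> \<rho>' \<mu> \<nu> S (Y i)"
    and nz: "\<And>t. t \<in> S \<Longrightarrow> wronskian (Y 1) (Y 2) t \<noteq> 0"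
  shows "euler_basis \<sigma> \<rho> \<rho>' \<mu> \<nu> S Y"
  unfolding euler_basis_def
proof (intro conjI allI impI)
  fix y assume y: "euler_solution \<sigma> \<rho> \<rho>' \<mu> \<nu> S y"
  obtain a where a: "\<And>t. t \<in> S \<Longrightarrow> wronskian y (Y 2) t = a * wronskian (Y 1) (Y 2) t"
    using wronskian_ratio_constant[OF S(1-4) sol sol y sol nz] by blast
  obtain b where b: "\<And>t. t \<in> S \<Longrightarrow> wronskian (Y 1) y t = b * wronskian (Y 1) (Y 2) t"
    using wronskian_ratio_constant[OF S(1-4) sol sol sol y nz] by blast
  have Y: "Y i holomorphic_on S" for i using sol unfolding euler_solution_def by auto
  show "\<exists>!c :: complex ^ 2. \<forall>t\<in>S. y t = (\<Sum>i\<in>UNIV. c $ i * Y i t)"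
  proof (rule ex_ex1I)
    have "y t = a * Y 1 t + b * Y 2 t" if "t \<in> S" for t
    proof -
      have "wronskian (Y 1) (Y 2) t * (y t - (a * Y 1 t + b * Y 2 t)) = 0"
        using a[OF that] b[OF that] by algebra
      then show ?thesis using nz[OF that] by simp
    qed
    then show "\<exists>c :: complex ^ 2. \<forall>t\<in>S. y t = (\<Sum>i\<in>UNIV. c $ i * Y i t)"
      by (intro exI[of _ "vector [a,b]"]) (simp add: sum_2)
  next
    fix c d :: "complex ^ 2"
    assume c: "\<forall>t\<in>S. y t = (\<Sum>i\<in>UNIV. c $ i * Y i t)" and d: "\<forall>t\<in>S. y t = (\<Sum>i\<in>UNIV. d $ i * Y i t)"
    define e where "e = c - d"
    have 0: "e $ 1 * Y 1 t + e $ 2 * Y 2 t = 0" if "t \<in> S" for t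
      using c d that by (simp add: sum_2 e_def algebra_simps)
    obtain t where t: "t \<in> S" using S(5) by auto
    have "euler (\<lambda>t. e $ 1 * Y 1 t + e $ 2 * Y 2 t) t = euler (\<lambda>_. 0) t"
      using 0 by (intro euler_cong_open(1)[OF S(1) t]) auto
    also have "\<dots> = 0" by (simp add: euler_def)
    also have "euler (\<lambda>t. e $ 1 * Y 1 t + e $ 2 * Y 2 t) t = e $ 1 * euler (Y 1) t + e $ 2 * euler (Y 2) t"
      unfolding euler_cmult[OF S(1) Y t, symmetric]
      by (rule euler_add[OF S(1) _ _ t]) (intro holomorphic_intros Y)+
    finally have 1: "e $ 1 * euler (Y 1) t + e $ 2 * euler (Y 2) t = 0" .
    have "e $ 1 * wronskian (Y 1) (Y 2) t = 0" "e $ 2 * wronskian (Y 1) (Y 2) t = 0"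
      using 0[OF t] 1 by algebra+
    then have "e $ 1 = 0" "e $ 2 = 0" using nz[OF t] by auto
    then show "c = d" by (simp add: e_def vec_eq_iff forall_2)
  qed
qed (rule sol)

lemma frobenius_solution:
  assumes "\<And>n. of_nat n + 1 = \<rho>' - \<rho> \<Longrightarrow> \<exists>j\<le>n. (of_nat j + \<rho> + \<mu>) * (of_nat j + \<rho> + \<nu>) = 0"
  obtains r f where "0 < r" "f holomorphic_on ball 0 r" "f 0 = 1"
    "\<And>s. s \<le> r \<Longrightarrow> euler_solution \<sigma> \<rho> \<rho>' \<mu> \<nu> (slit s) (\<lambda>t. t powr \<rho> * f t)"
proof -
  define F where "F = frobenius_series \<sigma> (\<rho>' - \<rho>) (\<mu> + \<rho>) (\<nu> + \<rho>)"
  have rec: "frobenius_recursion \<sigma> (\<rho> - \<rho>) (\<rho>' - \<rho>) (\<mu> + \<rho>) (\<nu> + \<rho>) F"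
    unfolding F_def diff_self
    by (rule frobenius_series_recursion) (use assms in \<open>simp add: add.assoc add.commute[of \<rho>]\<close>)
  have F: "eval_fps F has_fps_expansion F"
    unfolding F_def by (rule eval_fps_has_fps_expansion[OF frobenius_series_conv_radius])
  have "eval_fps F 0 = 1" by (simp add: eval_fps_at_0 F_def frobenius_series_def)
  moreover obtain r where r: "r > 0" "euler_solution \<sigma> (\<rho> - \<rho>) (\<rho>' - \<rho>) (\<mu> + \<rho>) (\<nu> + \<rho>) (ball 0 r) (eval_fps F)"
    using recursion_imp_euler_solution[OF F rec] by blast
  moreover have "euler_solution \<sigma> \<rho> \<rho>' \<mu> \<nu> (slit s) (\<lambda>t. t powr \<rho> * eval_fps F t)" if "s \<le> r" for s
  proof -
    have "slit s \<subseteq> ball 0 r" using that by (auto simp: slit_disc_def)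
    then have *: "euler_solution \<sigma> (\<rho> - \<rho>) (\<rho>' - \<rho>) (\<mu> + \<rho>) (\<nu> + \<rho>) (slit s) (eval_fps F)"
      using r euler_solution_subset by blast
    then have "eval_fps F holomorphic_on slit s" unfolding euler_solution_def by blast
    from euler_solution_powr_mult_iff[OF this] * show ?thesis by blast
  qed
  ultimately show ?thesis using that[of r "eval_fps F"] unfolding euler_solution_def by blast
qed

lemma euler_solution_swap:
  "euler_solution \<sigma> \<rho> \<rho>' \<mu> \<nu> S y \<longleftrightarrow> euler_solution \<sigma> \<rho>' \<rho> \<mu> \<nu> S y"
  unfolding euler_solution_def by (simp add: add.commute mult.commute)

definition has_local_power_basis :: "complex \<Rightarrow> complex \<Rightarrow> complex \<Rightarrow> complex \<Rightarrow> complex \<Rightarrow> bool" where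
  "has_local_power_basis \<sigma> \<rho> \<rho>' \<mu> \<nu> \<longleftrightarrow>
     (\<exists>r (\<alpha> :: 2 \<Rightarrow> complex) (f :: 2 \<Rightarrow> complex \<Rightarrow> complex).
        0 < r \<and> r \<le> 1 \<and> (\<forall>i. f i analytic_on {0}) \<and>
        euler_basis \<sigma> \<rho> \<rho>' \<mu> \<nu> (slit r) (\<lambda>i t. t powr \<alpha> i * f i t))"

lemma slit_nonempty: "0 < r \<Longrightarrow> slit r \<noteq> {}"
  using islimpt_slit[of r] by auto

text \<open>The Wronskian of \<open>t\<^sup>\<rho> f\<^sub>1\<close> and \<open>t\<^bsup>\<rho>'\<^esup> f\<^sub>2\<close> is \<open>t\<^bsup>\<rho> + \<rho>'\<^esup>\<close> times an analytic function
  with value \<open>\<rho>' - \<rho>\<close> at \<open>0\<close>, so it has no zeros on a small slit disc. The two remaining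
  hypotheses say that neither Frobenius series meets an obstruction.\<close>

lemma has_local_power_basisI:
  assumes \<sigma>: "\<sigma> \<in> {1, -1}" and "\<rho> \<noteq> \<rho>'"
    and 1: "\<And>n. of_nat n + 1 = \<rho>' - \<rho> \<Longrightarrow> \<exists>j\<le>n. (of_nat j + \<rho> + \<mu>) * (of_nat j + \<rho> + \<nu>) = 0"
    and 2: "\<And>n. of_nat n + 1 = \<rho> - \<rho>' \<Longrightarrow> \<exists>j\<le>n. (of_nat j + \<rho>' + \<mu>) * (of_nat j + \<rho>' + \<nu>) = 0"
  shows "has_local_power_basis \<sigma> \<rho> \<rho>' \<mu> \<nu>"
proof -
  obtain r1 f1 where f1: "0 < r1" "f1 holomorphic_on ball 0 r1" "f1 0 = 1"
    "\<And>s. s \<le> r1 \<Longrightarrow> euler_solution \<sigma> \<rho> \<rho>' \<mu> \<nu> (slit s) (\<lambda>t. t powr \<rho> * f1 t)"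
    using frobenius_solution[OF 1, where \<sigma>=\<sigma>] by blast
  obtain r2 f2 where f2: "0 < r2" "f2 holomorphic_on ball 0 r2" "f2 0 = 1"
    "\<And>s. s \<le> r2 \<Longrightarrow> euler_solution \<sigma> \<rho> \<rho>' \<mu> \<nu> (slit s) (\<lambda>t. t powr \<rho>' * f2 t)"
    using frobenius_solution[OF 2, where \<sigma>=\<sigma>] euler_solution_swap[of \<sigma> \<rho> \<rho>'] by metis
  define h where "h t = f1 t * (\<rho>' * f2 t + euler f2 t) - f2 t * (\<rho> * f1 t + euler f1 t)" for t
  define r0 where "r0 = min r1 r2"
  have r0: "0 < r0" using f1 f2 by (auto simp: r0_def)
  have hol: "f1 holomorphic_on ball 0 r0" "f2 holomorphic_on ball 0 r0"
    using f1(2) f2(2) by (auto intro: holomorphic_on_subset simp: r0_def)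
  have "h holomorphic_on ball 0 r0"
    unfolding h_def using hol by (intro holomorphic_intros euler_holomorphic) auto
  then have "isCont h 0"
    using continuous_on_eq_continuous_at[OF open_ball, of 0 r0 h] holomorphic_on_imp_continuous_on r0 by auto
  moreover have "h 0 \<noteq> 0" using \<open>\<rho> \<noteq> \<rho>'\<close> f1 f2 by (simp add: h_def euler_def)
  ultimately obtain e where e: "e > 0" "\<And>t. dist 0 t < e \<Longrightarrow> h t \<noteq> 0"
    using continuous_at_avoid[of 0 h 0] by blast
  define r where "r = min 1 (min e r0)"
  have r: "0 < r" "r \<le> 1" "r \<le> e" "r \<le> r0" using e r0 by (auto simp: r_def)
  define \<alpha> :: "2 \<Rightarrow> complex" where "\<alpha> i = (if i = 1 then \<rho> else \<rho>')" for i
  define f :: "2 \<Rightarrow> complex \<Rightarrow> complex" where "f i = (if i = 1 then f1 else f2)" for i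
  have holr: "f1 holomorphic_on slit r" "f2 holomorphic_on slit r"
    using r by (auto intro!: holomorphic_on_subset[OF hol(1)] holomorphic_on_subset[OF hol(2)] simp: slit_disc_def)
  have an: "f i analytic_on {0}" for i
    unfolding f_def analytic_at using hol r0 by (auto intro: exI[of _ "ball 0 r0"])
  have "euler_basis \<sigma> \<rho> \<rho>' \<mu> \<nu> (slit r) (\<lambda>i t. t powr \<alpha> i * f i t)"
  proof (rule euler_basisI[OF open_slit connected_slit])
    show "0 \<notin> slit r" using slit_nonzero by blast
    show "1 - \<sigma> * t \<noteq> 0" if "t \<in> slit r" for t using slit_one_minus that r \<sigma> by blast
    show "slit r \<noteq> {}" using r by (intro slit_nonempty)
    show "euler_solution \<sigma> \<rho> \<rho>' \<mu> \<nu> (slit r) (\<lambda>t. t powr \<alpha> i * f i t)" for i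
      using f1(4)[of r] f2(4)[of r] r by (auto simp: \<alpha>_def f_def r0_def)
    show "wronskian (\<lambda>t. t powr \<alpha> 1 * f 1 t) (\<lambda>t. t powr \<alpha> 2 * f 2 t) t \<noteq> 0" if t: "t \<in> slit r" for t
    proof -
      have "wronskian (\<lambda>t. t powr \<alpha> 1 * f 1 t) (\<lambda>t. t powr \<alpha> 2 * f 2 t) t = t powr \<rho> * t powr \<rho>' * h t"
        using euler_powr_mult(1)[OF holr(1) t] euler_powr_mult(1)[OF holr(2) t]
        by (simp add: \<alpha>_def f_def h_def algebra_simps)
      moreover have "h t \<noteq> 0" using e(2)[of t] t r by (auto simp: slit_disc_def)
      ultimately show ?thesis using slit_nonzero[OF t] by simp
    qed
  qed
  then show ?thesis unfolding has_local_power_basis_def using an r(1,2) by blast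
qed

lemma slit_identity:
  assumes "g holomorphic_on slit r" "0 < e" "e \<le> r" "\<And>t. t \<in> slit e \<Longrightarrow> g t = 0" "t \<in> slit r"
  shows "g t = 0"
proof -
  obtain p where p: "p \<in> slit e" using slit_nonempty[OF assms(2)] by blast
  have "p islimpt slit e" using p open_slit interior_limit_point interior_open by metis
  then show ?thesis
    using analytic_continuation[OF assms(1) open_slit connected_slit slit_mono[OF assms(3)] _ _ _ assms(5)]
      p slit_mono[OF assms(3)] assms(4) by blast
qed

lemma euler_basis_independent:
  fixes c :: "complex ^ 2"
  assumes "euler_basis \<sigma> \<rho> \<rho>' \<mu> \<nu> S Y" "open S" "\<And>t. t \<in> S \<Longrightarrow> c $ 1 * Y 1 t + c $ 2 * Y 2 t = 0"
  shows "c = 0"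
proof -
  have "\<exists>!c :: complex ^ 2. \<forall>t\<in>S. (\<lambda>_. 0) t = (\<Sum>i\<in>UNIV. c $ i * Y i t)"
    using assms(1) euler_solution_zero[OF assms(2)] unfolding euler_basis_def by blast
  moreover have "\<forall>t\<in>S. (\<lambda>_. 0) t = (\<Sum>i\<in>UNIV. c $ i * Y i t)"
    using assms(3) by (simp add: sum_2)
  moreover have "\<forall>t\<in>S. (\<lambda>_. 0) t = (\<Sum>i\<in>UNIV. (0 :: complex ^ 2) $ i * Y i t)" by simp
  ultimately show ?thesis by blast
qed

lemma frobenius_recursion_step:
  assumes "frobenius_recursion \<sigma> (\<rho> - \<alpha>) (\<rho>' - \<alpha>) (\<mu> + \<alpha>) (\<nu> + \<alpha>) F" "of_nat m + \<alpha> = \<beta>"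
  shows "(of_nat n + 1 + \<beta> - \<rho>) * (of_nat n + 1 + \<beta> - \<rho>') * fps_nth F (m + Suc n)
         = \<sigma> * (of_nat n + \<beta> + \<mu>) * (of_nat n + \<beta> + \<nu>) * fps_nth F (m + n)"
proof -
  have "(of_nat (m + n) + 1 - (\<rho> - \<alpha>)) * (of_nat (m + n) + 1 - (\<rho>' - \<alpha>)) * fps_nth F (Suc (m + n))
          = \<sigma> * (of_nat (m + n) + (\<mu> + \<alpha>)) * (of_nat (m + n) + (\<nu> + \<alpha>)) * fps_nth F (m + n)"
    using assms(1) unfolding frobenius_recursion_def by blast
  then show ?thesis unfolding assms(2)[symmetric] by (simp add: algebra_simps)
qed

text \<open>Suppose that none of the products vanishes. A solution \<open>t\<^sup>\<alpha> f(t)\<close> whose leading exponent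
  is the smaller exponent \<open>\<rho>\<close> would have nonzero coefficients all the way up to the resonant
  index \<open>N\<close>, where the recursion fails. So both members of the basis have leading exponent
  \<open>\<rho> + N\<close>; from there the recursion determines a series by its first coefficient, and the two
  members are proportional.\<close>

lemma has_local_power_basisD:
  assumes \<sigma>: "\<sigma> \<in> {1, -1}" and basis: "has_local_power_basis \<sigma> \<rho> (\<rho> + of_nat N) \<mu> \<nu>"
  shows "\<exists>j<N. (of_nat j + \<rho> + \<mu>) * (of_nat j + \<rho> + \<nu>) = 0"
proof (rule ccontr)
  assume "\<not> ?thesis"
  then have nz: "\<And>j. j < N \<Longrightarrow> (of_nat j + \<rho> + \<mu>) * (of_nat j + \<rho> + \<nu>) \<noteq> 0" by blast
  obtain r and \<alpha> :: "2 \<Rightarrow> complex" and f :: "2 \<Rightarrow> complex \<Rightarrow> complex" where r: "0 < r" "r \<le> 1"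
    and f: "\<And>i. f i analytic_on {0}"
    and Y: "euler_basis \<sigma> \<rho> (\<rho> + of_nat N) \<mu> \<nu> (slit r) (\<lambda>i t. t powr \<alpha> i * f i t)"
    using basis unfolding has_local_power_basis_def by blast
  note indep = euler_basis_independent[OF Y open_slit]
  have sol: "euler_solution \<sigma> \<rho> (\<rho> + of_nat N) \<mu> \<nu> (slit r) (\<lambda>t. t powr \<alpha> i * f i t)" for i
    using Y unfolding euler_basis_def by blast
  have fhol: "f i holomorphic_on slit r" for i
  proof -
    have "(\<lambda>t. t powr \<alpha> i * f i t) holomorphic_on slit r"
      using sol[of i] unfolding euler_solution_def by blast
    then have "(\<lambda>t. t powr (- \<alpha> i) * (t powr \<alpha> i * f i t)) holomorphic_on slit r"
      by (rule holomorphic_on_mult[OF powr_holomorphic_slit])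
    then show ?thesis
      by (rule holomorphic_transform) (use slit_nonzero in \<open>auto simp: powr_minus field_simps\<close>)
  qed
  define F where "F i = fps_expansion (f i) 0" for i
  have F: "f i has_fps_expansion F i" for i
    unfolding F_def by (rule analytic_at_imp_has_fps_expansion_0[OF f])
  have rec: "frobenius_recursion \<sigma> (\<rho> - \<alpha> i) (\<rho> + of_nat N - \<alpha> i) (\<mu> + \<alpha> i) (\<nu> + \<alpha> i) (F i)" for i
    using euler_solution_imp_recursion[OF F _ r(1)] sol euler_solution_powr_mult_iff[OF fhol] by blast
  define m where "m i = subdegree (F i)" for i
  have Fnz: "F i \<noteq> 0" for i
  proof
    assume "F i = 0"
    then have "\<forall>\<^sub>F t in nhds 0. f i t = 0"
      using F[of i] by (auto simp: has_fps_expansion_def elim: eventually_mono)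
    then obtain e where e: "e > 0" "\<And>t. dist t 0 < e \<Longrightarrow> f i t = 0"
      unfolding eventually_nhds_metric by blast
    have z: "f i t = 0" if "t \<in> slit r" for t
      by (rule slit_identity[OF fhol[of i], of "min r e"]) (use e r that in \<open>auto simp: slit_disc_def\<close>)
    have "(axis i 1 :: complex ^ 2) = 0"
      by (rule indep) (use z exhaust_2[of i] in \<open>auto simp: axis_def\<close>)
    then show False by simp
  qed
  have lead: "fps_nth (F i) (m i) \<noteq> 0" for i
    unfolding m_def using Fnz by (intro nth_subdegree_nonzero)
  have below: "fps_nth (F i) n = 0" if "n < m i" for i n
    using that unfolding m_def by (rule nth_less_subdegree_zero)
  \<comment> \<open>The leading exponent is the larger one, as the smaller one would run into the obstruction.\<close>
  have expo: "of_nat (m i) + \<alpha> i = \<rho> + of_nat N" for i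
  proof (rule ccontr)
    assume neq: "of_nat (m i) + \<alpha> i \<noteq> \<rho> + of_nat N"
    have "(of_nat (m i) + \<alpha> i - \<rho>) * (of_nat (m i) + \<alpha> i - (\<rho> + of_nat N)) = 0"
    proof (cases "m i")
      case 0
      then have "(\<rho> - \<alpha> i) * (\<rho> + of_nat N - \<alpha> i) = 0"
        using rec[of i] lead[of i] unfolding frobenius_recursion_def by simp
      then show ?thesis using 0 by (auto simp: algebra_simps)
    next
      case (Suc k)
      then have "(of_nat k + 1 - (\<rho> - \<alpha> i)) * (of_nat k + 1 - (\<rho> + of_nat N - \<alpha> i)) * fps_nth (F i) (m i) = 0"
        using rec[of i] below[of k i] unfolding frobenius_recursion_def by simp
      then have *: "(of_nat k + 1 - (\<rho> - \<alpha> i)) * (of_nat k + 1 - (\<rho> + of_nat N - \<alpha> i)) = 0"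
        using lead[of i] by simp
      have "of_nat (m i) = (of_nat k + 1 :: complex)" using Suc by simp
      then show ?thesis using * by algebra
    qed
    with neq have e: "of_nat (m i) + \<alpha> i = \<rho>" by simp
    have step: "(of_nat n + 1) * (of_nat n + 1 - of_nat N) * fps_nth (F i) (m i + Suc n)
         = \<sigma> * (of_nat n + \<rho> + \<mu>) * (of_nat n + \<rho> + \<nu>) * fps_nth (F i) (m i + n)" for n
      using frobenius_recursion_step[OF rec e, of n] by (simp add: algebra_simps)
    have ne: "fps_nth (F i) (m i + n) \<noteq> 0" if "n \<le> N" for n
      using that
    proof (induction n)
      case 0 then show ?case using lead by simp
    next
      case (Suc n)
      then show ?case using step[of n] nz[of n] \<sigma> by auto
    qed
    have "N \<noteq> 0" using neq e by auto
    then obtain n where n: "N = Suc n" using not0_implies_Suc by blast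
    show False using step[of n] nz[of n] ne[of n] \<sigma> n by auto
  qed
  define c where "c i = fps_nth (F i) (m i)" for i
  have ratio: "fps_nth (F 1) (m 1 + n) * c 2 = fps_nth (F 2) (m 2 + n) * c 1" for n
  proof (induction n)
    case 0 then show ?case by (simp add: c_def)
  next
    case (Suc n)
    have st: "(of_nat n + 1 + of_nat N) * (of_nat n + 1) * fps_nth (F i) (m i + Suc n)
         = \<sigma> * (of_nat n + (\<rho> + of_nat N) + \<mu>) * (of_nat n + (\<rho> + of_nat N) + \<nu>) * fps_nth (F i) (m i + n)" for i
      using frobenius_recursion_step[OF rec expo, of n] by (simp add: algebra_simps)
    have "(of_nat n + 1 + of_nat N :: complex) * (of_nat n + 1) = of_nat ((n + 1 + N) * (n + 1))"
      by (simp only: of_nat_mult of_nat_add of_nat_1)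
    then have nn: "(of_nat n + 1 + of_nat N :: complex) * (of_nat n + 1) \<noteq> 0"
      by (simp only: of_nat_eq_0_iff) simp
    have "(of_nat n + 1 + of_nat N) * (of_nat n + 1) * (fps_nth (F 1) (m 1 + Suc n) * c 2 - fps_nth (F 2) (m 2 + Suc n) * c 1) = 0"
      using st[of 1] st[of 2] Suc.IH by algebra
    then show ?case using nn by simp
  qed
  \<comment> \<open>Cross-multiplication with powers of \<open>t\<close> compares the two series although they start at different indices.\<close>
  have "fps_const (c 2) * (fps_X ^ m 2 * F 1) = fps_const (c 1) * (fps_X ^ m 1 * F 2)"
  proof (rule fps_ext)
    fix n
    show "fps_nth (fps_const (c 2) * (fps_X ^ m 2 * F 1)) n = fps_nth (fps_const (c 1) * (fps_X ^ m 1 * F 2)) n"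
    proof (cases "n < m 1 + m 2")
      case True
      then show ?thesis using below[of "n - m 2" 1] below[of "n - m 1" 2]
        by (auto simp: fps_X_power_mult_nth)
    next
      case False
      then obtain k where k: "n = m 1 + m 2 + k" using le_Suc_ex not_less by blast
      then have "\<not> n < m 2" "\<not> n < m 1" "n - m 2 = m 1 + k" "n - m 1 = m 2 + k" by auto
      then show ?thesis
        using ratio[of k] by (simp add: fps_X_power_mult_nth) (simp add: mult.commute)
    qed
  qed
  moreover have "(\<lambda>t. c 2 * (t ^ m 2 * f 1 t) - c 1 * (t ^ m 1 * f 2 t)) has_fps_expansion
      fps_const (c 2) * (fps_X ^ m 2 * F 1) - fps_const (c 1) * (fps_X ^ m 1 * F 2)"
    by (intro has_fps_expansion_diff has_fps_expansion_cmult_left has_fps_expansion_mult has_fps_expansion_fps_X_power F)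
  ultimately have "(\<lambda>t. c 2 * (t ^ m 2 * f 1 t) - c 1 * (t ^ m 1 * f 2 t)) has_fps_expansion 0" by simp
  then have "\<forall>\<^sub>F t in nhds 0. c 2 * (t ^ m 2 * f 1 t) - c 1 * (t ^ m 1 * f 2 t) = 0"
    by (auto simp: has_fps_expansion_def elim: eventually_mono)
  then obtain e where e: "e > 0" "\<And>t. dist t 0 < e \<Longrightarrow> c 2 * (t ^ m 2 * f 1 t) - c 1 * (t ^ m 1 * f 2 t) = 0"
    unfolding eventually_nhds_metric by blast
  have near: "c 2 * (t powr \<alpha> 1 * f 1 t) - c 1 * (t powr \<alpha> 2 * f 2 t) = 0" if t: "t \<in> slit (min r e)" for t
  proof -
    have t0: "t \<noteq> 0" using slit_nonzero[OF t] .
    have pw: "t powr \<alpha> i * t ^ m i = t powr (\<rho> + of_nat N)" for i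
    proof -
      have "t powr (of_nat (m i) + \<alpha> i) = t ^ m i * t powr \<alpha> i"
        using t0 by (simp add: powr_add powr_nat)
      then show ?thesis using expo[of i] by (simp add: mult.commute)
    qed
    have "c 2 * (t ^ m 2 * f 1 t) - c 1 * (t ^ m 1 * f 2 t) = 0"
      using e(2)[of t] t by (auto simp: slit_disc_def)
    note vanish = this
    have "t ^ m 1 * t ^ m 2 * (c 2 * (t powr \<alpha> 1 * f 1 t) - c 1 * (t powr \<alpha> 2 * f 2 t)) = 0"
    proof -
      have "a * b * (x * (P * u) - y * (P' * v)) = 0"
        if "P * a = Q" "P' * b = Q" "x * (b * u) - y * (a * v) = 0" for a b P P' Q x y u v :: complex
      proof -
        have "a * b * (x * (P * u) - y * (P' * v)) = (P * a) * (x * (b * u)) - (P' * b) * (y * (a * v))"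
          by (simp add: algebra_simps)
        also have "\<dots> = Q * (x * (b * u) - y * (a * v))"
          unfolding that(1,2) by (simp add: algebra_simps)
        finally show ?thesis using that(3) by simp
      qed
      from this[OF pw[of 1] pw[of 2] vanish] show ?thesis .
    qed
    then show ?thesis using t0 by simp
  qed
  have "c 2 * (t powr \<alpha> 1 * f 1 t) - c 1 * (t powr \<alpha> 2 * f 2 t) = 0" if "t \<in> slit r" for t
    by (rule slit_identity[where e="min r e", OF _ _ _ near that])
      (use e r fhol in \<open>auto intro!: holomorphic_intros powr_holomorphic_slit\<close>)
  then have "(vector [c 2, - c 1] :: complex ^ 2) = 0"
    by (intro indep) (simp add: )
  then have "c 2 = 0" by (metis vector_2(1) zero_index)
  then show False using lead c_def by simp
qed

section \<open>The three singular points\<close>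

lemma hypergeometric_solution_cong:
  assumes "open S" "\<And>z. z \<in> S \<Longrightarrow> y z = y' z"
  shows "hypergeometric_solution A B C S y \<longleftrightarrow> hypergeometric_solution A B C S y'"
proof -
  have 1: "deriv y z = deriv y' z" if "z \<in> S" for z
    by (rule deriv_cong_open[OF assms(1) that assms(2)])
  have 2: "deriv (deriv y) z = deriv (deriv y') z" if "z \<in> S" for z
    by (rule deriv_cong_open[OF assms(1) that 1])
  show ?thesis
    unfolding hypergeometric_solution_def
    using holomorphic_cong[OF refl, of S y y'] assms(2) 1 2 by auto
qed

lemma hypergeometric_solution_iff_euler:
  assumes "open S" "0 \<notin> S"
  shows "hypergeometric_solution A B C S y \<longleftrightarrow> euler_solution 1 0 (1 - C) A B S y"
proof (cases "y holomorphic_on S")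
  case True
  have "z * (1 - z) * deriv (deriv y) z + (C - (A + B + 1) * z) * deriv y z - A * B * y z = 0 \<longleftrightarrow>
        euler (euler y) z - (0 + (1 - C)) * euler y z + 0 * (1 - C) * y z
          = 1 * z * (euler (euler y) z + (A + B) * euler y z + A * B * y z)" if "z \<in> S" for z
  proof -
    have "z \<noteq> 0" using that assms by auto
    have "euler (euler y) z - (0 + (1 - C)) * euler y z + 0 * (1 - C) * y z
          - 1 * z * (euler (euler y) z + (A + B) * euler y z + A * B * y z)
        = z * (z * (1 - z) * deriv (deriv y) z + (C - (A + B + 1) * z) * deriv y z - A * B * y z)"
      unfolding euler_euler_eq[OF assms(1) True that] unfolding euler_def by algebra
    then show ?thesis using \<open>z \<noteq> 0\<close> by (metis eq_iff_diff_eq_0 mult_eq_0_iff)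
  qed
  then show ?thesis unfolding hypergeometric_solution_def euler_solution_def using True by blast
qed (simp add: hypergeometric_solution_def euler_solution_def)

text \<open>A change of variable \<open>t\<close> with inverse \<open>\<tau>\<close> that matches the two equations also matches
  their bases of solutions.\<close>

lemma has_power_basis_transfer:
  assumes op: "\<And>r. r \<le> 1 \<Longrightarrow> open (slit_disc t r)"
    and \<tau>: "\<And>r z. z \<in> slit_disc t r \<Longrightarrow> t z \<in> slit r \<and> \<tau> (t z) = z"
       "\<And>r x. x \<in> slit r \<Longrightarrow> \<tau> x \<in> slit_disc t r \<and> t (\<tau> x) = x"
    and eq: "\<And>r Y. r \<le> 1 \<Longrightarrow> hypergeometric_solution A B C (slit_disc t r) (\<lambda>z. Y (t z)) \<longleftrightarrow>
              euler_solution \<sigma> \<rho> \<rho>' \<mu> \<nu> (slit r) Y"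
  shows "has_power_basis_at A B C t \<longleftrightarrow> has_local_power_basis \<sigma> \<rho> \<rho>' \<mu> \<nu>"
proof -
  have basis: "solution_basis A B C (slit_disc t r) (\<lambda>i z. Y i (t z)) \<longleftrightarrow> euler_basis \<sigma> \<rho> \<rho>' \<mu> \<nu> (slit r) Y"
    if r: "r \<le> 1" for r and Y :: "2 \<Rightarrow> complex \<Rightarrow> complex"
  proof -
    have ball: "(\<forall>z\<in>slit_disc t r. P (t z)) \<longleftrightarrow> (\<forall>x\<in>slit r. P x)" for P
      using \<tau> by metis
    have ball': "(\<forall>z\<in>slit_disc t r. y z = (\<Sum>i\<in>UNIV. c $ i * Y i (t z))) \<longleftrightarrow>
        (\<forall>x\<in>slit r. y (\<tau> x) = (\<Sum>i\<in>UNIV. c $ i * Y i x))" for y and c :: "complex ^ 2"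
      using ball[of "\<lambda>x. y (\<tau> x) = (\<Sum>i\<in>UNIV. c $ i * Y i x)"] \<tau>(1) by simp
    have sol: "hypergeometric_solution A B C (slit_disc t r) y \<longleftrightarrow> euler_solution \<sigma> \<rho> \<rho>' \<mu> \<nu> (slit r) (\<lambda>x. y (\<tau> x))" for y
      unfolding eq[OF r, symmetric]
      by (rule hypergeometric_solution_cong[OF op[OF r]]) (use \<tau> in auto)
    show ?thesis
    proof
      assume L: "solution_basis A B C (slit_disc t r) (\<lambda>i z. Y i (t z))"
      show "euler_basis \<sigma> \<rho> \<rho>' \<mu> \<nu> (slit r) Y"
        unfolding euler_basis_def
      proof (intro conjI allI impI)
        show "euler_solution \<sigma> \<rho> \<rho>' \<mu> \<nu> (slit r) (Y i)" for i
          using L eq[OF r] unfolding solution_basis_def by blast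
        fix y assume "euler_solution \<sigma> \<rho> \<rho>' \<mu> \<nu> (slit r) y"
        then have "hypergeometric_solution A B C (slit_disc t r) (\<lambda>z. y (t z))" using eq[OF r] by blast
        then have "\<exists>!c :: complex ^ 2. \<forall>z\<in>slit_disc t r. y (t z) = (\<Sum>i\<in>UNIV. c $ i * Y i (t z))"
          using L unfolding solution_basis_def by blast
        then show "\<exists>!c :: complex ^ 2. \<forall>x\<in>slit r. y x = (\<Sum>i\<in>UNIV. c $ i * Y i x)"
          using ball[of "\<lambda>x. y x = (\<Sum>i\<in>UNIV. _ $ i * Y i x)"] by simp
      qed
    next
      assume R: "euler_basis \<sigma> \<rho> \<rho>' \<mu> \<nu> (slit r) Y"
      show "solution_basis A B C (slit_disc t r) (\<lambda>i z. Y i (t z))"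
        unfolding solution_basis_def
      proof (intro conjI allI impI)
        show "hypergeometric_solution A B C (slit_disc t r) (\<lambda>z. Y i (t z))" for i
          using R eq[OF r] unfolding euler_basis_def by blast
        fix y assume "hypergeometric_solution A B C (slit_disc t r) y"
        then show "\<exists>!c :: complex ^ 2. \<forall>z\<in>slit_disc t r. y z = (\<Sum>i\<in>UNIV. c $ i * Y i (t z))"
          using R unfolding ball' sol euler_basis_def by blast
      qed
    qed
  qed
  have "0 < r \<and> r \<le> 1 \<and> (\<forall>i. f i analytic_on {0}) \<and>
      solution_basis A B C (slit_disc t r) (\<lambda>i z. t z powr \<alpha> i * f i (t z)) \<longleftrightarrow>
      0 < r \<and> r \<le> 1 \<and> (\<forall>i. f i analytic_on {0}) \<and>
      euler_basis \<sigma> \<rho> \<rho>' \<mu> \<nu> (slit r) (\<lambda>i x. x powr \<alpha> i * f i x)" for r and \<alpha> :: "2 \<Rightarrow> complex" and f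
    using basis[of r "\<lambda>i x. x powr \<alpha> i * f i x"] by blast
  then show ?thesis unfolding has_power_basis_at_def has_local_power_basis_def by simp
qed

lemma has_power_basis_at_0:
  "has_power_basis_at A B C (\<lambda>z. z) \<longleftrightarrow> has_local_power_basis 1 0 (1 - C) A B"
proof (rule has_power_basis_transfer[where \<tau> = "\<lambda>x. x"])
  have "0 \<notin> slit r" for r using slit_nonzero by blast
  then show "hypergeometric_solution A B C (slit r) (\<lambda>z. Y z) \<longleftrightarrow> euler_solution 1 0 (1 - C) A B (slit r) Y" for r Y
    by (rule hypergeometric_solution_iff_euler[OF open_slit])
qed (use open_slit in auto)

text \<open>In \<open>t = z - 1\<close> the slit lies on the left of \<open>z = 1\<close>, as in the principal power; the
  price is the sign \<open>\<sigma> = -1\<close> compared with the usual coordinate \<open>1 - z\<close>.\<close>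

lemma has_power_basis_at_1:
  "has_power_basis_at A B C (\<lambda>z. z - 1) \<longleftrightarrow> has_local_power_basis (- 1) 0 (C - A - B) A B"
proof (rule has_power_basis_transfer[where \<tau> = "\<lambda>x. x + 1"])
  have img: "slit_disc (\<lambda>z. z - 1) r = (\<lambda>x. x + 1) ` slit r" for r
  proof -
    have "z \<in> (\<lambda>x. x + 1) ` slit r" if "z \<in> slit_disc (\<lambda>z. z - 1) r" for z
      by (rule image_eqI[of _ _ "z - 1"]) (use that in \<open>auto simp: slit_disc_def\<close>)
    then show ?thesis by (auto simp: slit_disc_def)
  qed
  show op: "open (slit_disc (\<lambda>z. z - 1) r)" for r
    unfolding img using open_translation[OF open_slit, of 1 r] by (simp add: add.commute)
  show "hypergeometric_solution A B C (slit_disc (\<lambda>z. z - 1) r) (\<lambda>z. Y (z - 1)) \<longleftrightarrow>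
        euler_solution (- 1) 0 (C - A - B) A B (slit r) Y" for r Y
  proof -
    let ?S = "slit_disc (\<lambda>z. z - 1) r"
    have hol: "(\<lambda>z. Y (z - 1)) holomorphic_on ?S \<longleftrightarrow> Y holomorphic_on slit r"
    proof
      assume "Y holomorphic_on slit r"
      then have "(Y \<circ> (\<lambda>z. z - 1)) holomorphic_on ?S"
        by (intro holomorphic_on_compose_gen[of _ _ _ "slit r"] holomorphic_intros) (auto simp: slit_disc_def)
      then show "(\<lambda>z. Y (z - 1)) holomorphic_on ?S" by (simp add: o_def)
    next
      assume "(\<lambda>z. Y (z - 1)) holomorphic_on ?S"
      then have "((\<lambda>z. Y (z - 1)) \<circ> (\<lambda>x. x + 1)) holomorphic_on slit r"
        by (intro holomorphic_on_compose_gen[of _ _ _ "?S"] holomorphic_intros) (auto simp: slit_disc_def)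
      then show "Y holomorphic_on slit r" by (simp add: o_def)
    qed
    show ?thesis
    proof (cases "Y holomorphic_on slit r")
      case True
      have d: "deriv (\<lambda>z. f (z - 1)) z = deriv f (z - 1)" if "f holomorphic_on slit r" "z \<in> ?S" for f z
      proof -
        have "(f has_field_derivative deriv f (z - 1)) (at (z - 1))"
          using that open_slit holomorphic_derivI[of f "slit r"] by (auto simp: slit_disc_def)
        then have "((\<lambda>z. f (z - 1)) has_field_derivative deriv f (z - 1) * 1) (at z)"
          by (intro DERIV_chain2[where g = "\<lambda>z. z - 1"]) (auto intro!: derivative_eq_intros)
        then show ?thesis by (simp add: DERIV_imp_deriv)
      qed
      have d2: "deriv (deriv (\<lambda>z. Y (z - 1))) z = deriv (deriv Y) (z - 1)" if "z \<in> ?S" for z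
      proof -
        have "deriv (deriv (\<lambda>z. Y (z - 1))) z = deriv (\<lambda>z. deriv Y (z - 1)) z"
          by (rule deriv_cong_open[OF op that d[OF True]])
        also have "\<dots> = deriv (deriv Y) (z - 1)"
          by (rule d[OF holomorphic_deriv[OF True open_slit] that])
        finally show ?thesis .
      qed
      have "(x + 1) * (1 - (x + 1)) * deriv (deriv Y) x + (C - (A + B + 1) * (x + 1)) * deriv Y x - A * B * Y x = 0 \<longleftrightarrow>
         euler (euler Y) x - (0 + (C - A - B)) * euler Y x + 0 * (C - A - B) * Y x
            = - 1 * x * (euler (euler Y) x + (A + B) * euler Y x + A * B * Y x)" if "x \<in> slit r" for x
      proof -
        have "euler (euler Y) x - (0 + (C - A - B)) * euler Y x + 0 * (C - A - B) * Y x
            - (- 1 * x * (euler (euler Y) x + (A + B) * euler Y x + A * B * Y x))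
          = - x * ((x + 1) * (1 - (x + 1)) * deriv (deriv Y) x + (C - (A + B + 1) * (x + 1)) * deriv Y x - A * B * Y x)"
          unfolding euler_euler_eq[OF open_slit True that] unfolding euler_def by algebra
        then show ?thesis using slit_nonzero[OF that] by (metis eq_iff_diff_eq_0 mult_eq_0_iff neg_equal_0_iff_equal)
      qed
      then show ?thesis
        unfolding hypergeometric_solution_def euler_solution_def hol using True
        by (simp add: d[OF True] d2) (simp add: img)
    qed (simp add: hol hypergeometric_solution_def euler_solution_def)
  qed
qed (auto simp: slit_disc_def)

text \<open>Under \<open>z = 1/t\<close> the operator \<open>\<theta>\<close> changes sign, so the two sides of the equation exchange
  their roles: the parameters \<open>A, B\<close> become the exponents and \<open>0, 1 - C\<close> the parameters.\<close>

lemma has_power_basis_at_infinity: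
  "has_power_basis_at A B C inverse \<longleftrightarrow> has_local_power_basis 1 A B 0 (1 - C)"
proof (rule has_power_basis_transfer[where \<tau> = inverse])
  have inv: "inverse z \<in> slit_disc inverse r \<longleftrightarrow> z \<in> slit r" for z r
    by (simp add: slit_disc_def)
  have nz: "z \<noteq> 0" if "z \<in> slit_disc inverse r" for z r
    using that by (auto simp: slit_disc_def)
  show op: "open (slit_disc inverse r)" for r
  proof -
    have "open (inverse -` slit r \<inter> (- {0 :: complex}))"
      by (rule continuous_open_preimage[OF _ _ open_slit, of "- {0}"] continuous_intros)?
        (auto intro!: continuous_open_preimage[OF _ _ open_slit] continuous_intros simp: Int_commute)
    moreover have "inverse -` slit r \<inter> - {0} = slit_disc inverse r"
      by (auto simp: slit_disc_def)
    ultimately show ?thesis by simp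
  qed
  show "hypergeometric_solution A B C (slit_disc inverse r) (\<lambda>z. Y (inverse z)) \<longleftrightarrow>
        euler_solution 1 A B 0 (1 - C) (slit r) Y" for r Y
  proof -
    let ?S = "slit_disc inverse r :: complex set"
    have holI: "(\<lambda>z. f (inverse z)) holomorphic_on ?S" if "f holomorphic_on slit r" for f
    proof -
      have "(f \<circ> inverse) holomorphic_on ?S"
        using that nz by (intro holomorphic_on_compose_gen[of _ _ _ "slit r"] holomorphic_intros) (auto simp: slit_disc_def)
      then show ?thesis by (simp add: o_def)
    qed
    have hol: "(\<lambda>z. Y (inverse z)) holomorphic_on ?S \<longleftrightarrow> Y holomorphic_on slit r"
    proof
      assume "(\<lambda>z. Y (inverse z)) holomorphic_on ?S"
      then have "((\<lambda>z. Y (inverse z)) \<circ> inverse) holomorphic_on slit r"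
        using slit_nonzero by (intro holomorphic_on_compose_gen[of _ _ _ "?S"] holomorphic_intros) (auto simp: inv)
      then show "Y holomorphic_on slit r" by (simp add: o_def)
    qed (rule holI)
    show ?thesis
    proof (cases "Y holomorphic_on slit r")
      case True
      have e: "euler (\<lambda>z. f (inverse z)) z = - euler f (inverse z)" if "f holomorphic_on slit r" "z \<in> ?S" for f z
      proof -
        have "inverse z \<in> slit r" using that(2) by (simp add: slit_disc_def)
        then have "(f has_field_derivative deriv f (inverse z)) (at (inverse z))"
          using that(1) open_slit holomorphic_derivI by blast
        then have "((\<lambda>z. f (inverse z)) has_field_derivative deriv f (inverse z) * (- (inverse z * 1 * inverse z))) (at z)"
          using nz[OF that(2)] by (intro DERIV_chain2[where g = inverse] DERIV_inverse' DERIV_ident) auto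
        then show ?thesis unfolding euler_def using nz[OF that(2)] by (simp add: DERIV_imp_deriv)
      qed
      have e2: "euler (euler (\<lambda>z. Y (inverse z))) z = euler (euler Y) (inverse z)" if "z \<in> ?S" for z
      proof -
        have "euler (euler (\<lambda>z. Y (inverse z))) z = euler (\<lambda>z. - 1 * euler Y (inverse z)) z"
          by (rule euler_cong_open(1)[OF op that]) (simp add: e[OF True])
        also have "\<dots> = - 1 * euler (\<lambda>z. euler Y (inverse z)) z"
          by (rule euler_cmult[OF op holI[OF euler_holomorphic[OF open_slit True]] that])
        also have "\<dots> = euler (euler Y) (inverse z)"
          using e[OF euler_holomorphic[OF open_slit True] that] by simp
        finally show ?thesis .
      qed
      have "hypergeometric_solution A B C ?S (\<lambda>z. Y (inverse z)) \<longleftrightarrow>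
        (\<forall>z\<in>?S. euler (euler Y) (inverse z) - (0 + (1 - C)) * (- euler Y (inverse z)) + 0 * (1 - C) * Y (inverse z)
            = 1 * z * (euler (euler Y) (inverse z) + (A + B) * (- euler Y (inverse z)) + A * B * Y (inverse z)))"
        using nz True e[OF True] e2
        by (subst hypergeometric_solution_iff_euler[OF op]) (auto simp: euler_solution_def hol)
      also have "\<dots> \<longleftrightarrow> (\<forall>x\<in>slit r. euler (euler Y) x - (0 + (1 - C)) * (- euler Y x) + 0 * (1 - C) * Y x
            = 1 * inverse x * (euler (euler Y) x + (A + B) * (- euler Y x) + A * B * Y x))"
        using inv by (metis inverse_inverse_eq)
      also have "\<dots> \<longleftrightarrow> euler_solution 1 A B 0 (1 - C) (slit r) Y"
        unfolding euler_solution_def using True slit_nonzero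
        by (auto simp: field_simps)
      finally show ?thesis .
    qed (simp add: hol hypergeometric_solution_def euler_solution_def)
  qed
qed (auto simp: slit_disc_def)

section \<open>The criterion for logarithms\<close>

lemma centred_odd_range:
  "(\<exists>j<n. 2 * int j + 1 - int n = X) \<longleftrightarrow> \<bar>X\<bar> < int n \<and> odd (X + int n)"
proof
  assume "\<bar>X\<bar> < int n \<and> odd (X + int n)"
  then have X: "\<bar>X\<bar> < int n" and "odd (X + int n)" by auto
  from this(2) obtain i where i: "X + int n = 2 * i + 1" by (rule oddE)
  with X have "nat i < n" "2 * int (nat i) + 1 - int n = X" by auto
  then show "\<exists>j<n. 2 * int j + 1 - int n = X" by blast
next
  assume "\<exists>j<n. 2 * int j + 1 - int n = X"
  then obtain j where j: "j < n" "X = 2 * int j + 1 - int n" by blast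
  then have "X + int n = 2 * int j + 1" by simp
  then have "odd (X + int n)" by simp
  moreover have "\<bar>X\<bar> < int n" using j by auto
  ultimately show "\<bar>X\<bar> < int n \<and> odd (X + int n)" by blast
qed

text \<open>The sum of all local exponents is \<open>1\<close>, which is the first hypothesis; \<open>d\<close> and \<open>\<mu> - \<nu>\<close>
  are the differences at the two other points. Then \<open>2 (\<rho> + \<mu>)\<close> and \<open>2 (\<rho> + \<nu>)\<close> are \<open>1 - n\<close>
  minus \<open>d \<mp> (\<mu> - \<nu>)\<close>, and up to sign these two numbers are \<open>k + l + 1\<close> and \<open>k - l\<close>. As
  \<open>2 j + 1 - n\<close> runs through the integers of absolute value less than \<open>n\<close> and parity opposite to
  \<open>n\<close>, the parity of \<open>n + k + l\<close> decides which of the two can be attained.\<close>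

lemma obstruction_iff:
  fixes \<rho> \<mu> \<nu> d :: complex and k l n :: nat
  assumes sum: "2 * \<rho> + of_nat n + \<mu> + \<nu> = 1 - d"
    and d: "d \<in> {of_nat k + 1/2, - (of_nat k + 1/2)}"
    and e: "\<mu> - \<nu> \<in> {of_nat l + 1/2, - (of_nat l + 1/2)}"
  shows "(\<exists>j<n. (of_nat j + \<rho> + \<mu>) * (of_nat j + \<rho> + \<nu>) = 0) \<longleftrightarrow>
         \<not> (if even (n + k + l) then n \<le> k + l else int n < \<bar>int k - int l\<bar>)"
proof -
  have \<mu>: "of_nat j + \<rho> + \<mu> = 0 \<longleftrightarrow> of_int (2 * int j + 1 - int n) = d - (\<mu> - \<nu>)" for j
  proof -
    have "of_int (2 * int j + 1 - int n) - (d - (\<mu> - \<nu>)) = 2 * (of_nat j + \<rho> + \<mu>)"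
      using sum by (simp add: algebra_simps)
    then show ?thesis by (metis eq_iff_diff_eq_0 mult_eq_0_iff zero_neq_numeral)
  qed
  have \<nu>: "of_nat j + \<rho> + \<nu> = 0 \<longleftrightarrow> of_int (2 * int j + 1 - int n) = d + (\<mu> - \<nu>)" for j
  proof -
    have "of_int (2 * int j + 1 - int n) - (d + (\<mu> - \<nu>)) = 2 * (of_nat j + \<rho> + \<nu>)"
      using sum by (simp add: algebra_simps)
    then show ?thesis by (metis eq_iff_diff_eq_0 mult_eq_0_iff zero_neq_numeral)
  qed
  have "\<exists>s t. {s, t} = {int k + int l + 1, int k - int l} \<and> (\<exists>u\<in>{1,-1}. \<exists>v\<in>{1,-1}. d - (\<mu> - \<nu>) = of_int (u * s) \<and> d + (\<mu> - \<nu>) = of_int (v * t))"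
  proof -
    from d e consider
      "d = of_nat k + 1/2" "\<mu> - \<nu> = of_nat l + 1/2" | "d = of_nat k + 1/2" "\<mu> - \<nu> = - (of_nat l + 1/2)"
      | "d = - (of_nat k + 1/2)" "\<mu> - \<nu> = of_nat l + 1/2" | "d = - (of_nat k + 1/2)" "\<mu> - \<nu> = - (of_nat l + 1/2)"
      by blast
    then show ?thesis
    proof cases
      case 1 then show ?thesis
        by (intro exI[of _ "int k - int l"] exI[of _ "int k + int l + 1"] conjI bexI[of _ 1]) (auto simp: 1)
    next
      case 2 then show ?thesis
        by (intro exI[of _ "int k - int l"] exI[of _ "int k + int l + 1"] conjI bexI[of _ 1]) (auto simp: 2)
    next
      case 3 then show ?thesis
        by (intro exI[of _ "int k - int l"] exI[of _ "int k + int l + 1"] conjI bexI[of _ "-1"]) (auto simp: 3)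
    next
      case 4 then show ?thesis
        by (intro exI[of _ "int k - int l"] exI[of _ "int k + int l + 1"] conjI bexI[of _ "-1"]) (auto simp: 4)
    qed
  qed
  then obtain s t u v where st: "{s, t} = {int k + int l + 1, int k - int l}"
    and uv: "u \<in> {1,-1}" "v \<in> {1,-1}" and eqs: "d - (\<mu> - \<nu>) = of_int (u * s)" "d + (\<mu> - \<nu>) = of_int (v * t)"
    by blast
  have sgn: "\<bar>w * x\<bar> < int n \<and> odd (w * x + int n) \<longleftrightarrow> \<bar>x\<bar> < int n \<and> odd (x + int n)" if "w \<in> {1,-1}" for w x :: int
    using that by auto
  have "(\<exists>j<n. (of_nat j + \<rho> + \<mu>) * (of_nat j + \<rho> + \<nu>) = 0) \<longleftrightarrow>
        (\<exists>j<n. 2 * int j + 1 - int n = u * s) \<or> (\<exists>j<n. 2 * int j + 1 - int n = v * t)"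
    unfolding mult_eq_0_iff \<mu> \<nu> eqs of_int_eq_iff by blast
  also have "\<dots> \<longleftrightarrow> (\<bar>s\<bar> < int n \<and> odd (s + int n)) \<or> (\<bar>t\<bar> < int n \<and> odd (t + int n))"
    unfolding centred_odd_range sgn[OF uv(1)] sgn[OF uv(2)] ..
  also have "\<dots> \<longleftrightarrow> (\<exists>x\<in>{s,t}. \<bar>x\<bar> < int n \<and> odd (x + int n))" by blast
  also have "\<dots> \<longleftrightarrow> (int k + int l + 1 < int n \<and> odd (int k + int l + 1 + int n)) \<or>
      (\<bar>int k - int l\<bar> < int n \<and> odd (int k - int l + int n))"
    unfolding st by auto
  also have "\<dots> \<longleftrightarrow> \<not> (if even (n + k + l) then n \<le> k + l else int n < \<bar>int k - int l\<bar>)"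
  proof (cases "even (n + k + l)")
    case True
    then have "odd (int k + int l + 1 + int n)" "\<not> odd (int k - int l + int n)" by auto
    moreover have "n \<noteq> k + l + 1" using True by auto
    ultimately show ?thesis using True by auto
  next
    case False
    then have "\<not> odd (int k + int l + 1 + int n)" "odd (int k - int l + int n)" by auto
    moreover have "int n \<noteq> \<bar>int k - int l\<bar>"
    proof
      assume "int n = \<bar>int k - int l\<bar>"
      then have "int k - int l + int n = 2 * int n \<or> int k - int l + int n = 0" by linarith
      then have "even (int k - int l + int n)" by (metis dvd_triv_left even_zero)
      then show False using \<open>odd (int k - int l + int n)\<close> by blast
    qed
    ultimately show ?thesis using False by auto
  qed
  finally show ?thesis .
qed

lemma half_integer_not_int:
  assumes "x \<in> {of_nat k + 1/2, - (of_nat k + 1/2) :: complex}"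
  shows "x \<noteq> of_int m"
proof
  assume "x = of_int m"
  then have "of_int m = of_nat k + (1/2 :: complex) \<or> of_int m = - (of_nat k + (1/2 :: complex))"
    using assms by blast
  then have "2 * of_int m = 2 * of_nat k + (1 :: complex) \<or> 2 * of_int m = - (2 * of_nat k + (1 :: complex))"
    by (elim disjE) (simp_all only:, simp_all)
  then have "of_int (2 * m) = (of_int (2 * int k + 1) :: complex) \<or> of_int (2 * m) = (of_int (- (2 * int k + 1)) :: complex)"
    by simp
  then have "2 * m = 2 * int k + 1 \<or> 2 * m = - (2 * int k + 1)" unfolding of_int_eq_iff .
  then show False by presburger
qed

text \<open>Exponents that do not differ by an integer never meet a resonance.\<close>

lemma half_integer_difference_power_basis:
  assumes "\<sigma> \<in> {1, -1}" "\<rho>' - \<rho> \<in> {of_nat k + 1/2, - (of_nat k + 1/2)}"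
  shows "has_local_power_basis \<sigma> \<rho> \<rho>' \<mu> \<nu>"
proof (rule has_local_power_basisI[OF assms(1)])
  note no = half_integer_not_int[OF assms(2)]
  show "\<rho> \<noteq> \<rho>'" using no[of 0] by auto
  show "\<exists>j\<le>n. (of_nat j + \<rho> + \<mu>) * (of_nat j + \<rho> + \<nu>) = 0" if "of_nat n + 1 = \<rho>' - \<rho>" for n
    using no[of "int n + 1"] that by simp
  show "\<exists>j\<le>n. (of_nat j + \<rho>' + \<mu>) * (of_nat j + \<rho>' + \<nu>) = 0" if "of_nat n + 1 = \<rho> - \<rho>'" for n
    using no[of "- int n - 1"] that by (simp add: algebra_simps)
qed

lemma has_local_power_basis_swap:
  "has_local_power_basis \<sigma> \<rho> \<rho>' \<mu> \<nu> \<longleftrightarrow> has_local_power_basis \<sigma> \<rho>' \<rho> \<mu> \<nu>"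
  unfolding has_local_power_basis_def euler_basis_def euler_solution_swap[of \<sigma> \<rho> \<rho>'] ..

lemma integer_difference_power_basis_iff:
  assumes \<sigma>: "\<sigma> \<in> {1, -1}" and "\<rho>' - \<rho> \<in> {of_nat n, - of_nat n}"
    and "\<rho> + \<rho>' + \<mu> + \<nu> = 1 - d"
    and d: "d \<in> {of_nat k + 1/2, - (of_nat k + 1/2)}"
    and e: "\<mu> - \<nu> \<in> {of_nat l + 1/2, - (of_nat l + 1/2)}"
  shows "has_local_power_basis \<sigma> \<rho> \<rho>' \<mu> \<nu> \<longleftrightarrow>
         \<not> (if even (n + k + l) then n \<le> k + l else int n < \<bar>int k - int l\<bar>)"
proof -
  have *: "has_local_power_basis \<sigma> \<rho> (\<rho> + of_nat n) \<mu> \<nu> \<longleftrightarrow>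
         \<not> (if even (n + k + l) then n \<le> k + l else int n < \<bar>int k - int l\<bar>)"
    if "2 * \<rho> + of_nat n + \<mu> + \<nu> = 1 - d" for \<rho>
    unfolding obstruction_iff[OF that d e, symmetric]
  proof
    assume "\<exists>j<n. (of_nat j + \<rho> + \<mu>) * (of_nat j + \<rho> + \<nu>) = 0"
    then obtain j where j: "j < n" "(of_nat j + \<rho> + \<mu>) * (of_nat j + \<rho> + \<nu>) = 0" by blast
    show "has_local_power_basis \<sigma> \<rho> (\<rho> + of_nat n) \<mu> \<nu>"
    proof (rule has_local_power_basisI[OF \<sigma>])
      show "\<rho> \<noteq> \<rho> + of_nat n" using j by simp
      show "\<exists>j\<le>m. (of_nat j + \<rho> + \<mu>) * (of_nat j + \<rho> + \<nu>) = 0" if "of_nat m + 1 = \<rho> + of_nat n - \<rho>" for m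
      proof -
        have "of_nat (m + 1) = (of_nat n :: complex)" using that by (simp add: add.commute)
        then have "m + 1 = n" unfolding of_nat_eq_iff .
        then show ?thesis using j by (intro exI[of _ j]) auto
      qed
      show "\<exists>j\<le>m. (of_nat j + (\<rho> + of_nat n) + \<mu>) * (of_nat j + (\<rho> + of_nat n) + \<nu>) = 0"
        if "of_nat m + 1 = \<rho> - (\<rho> + of_nat n)" for m
      proof -
        have "of_nat m + 1 + of_nat n = (0 :: complex)" using that by algebra
        then have "of_nat (m + 1 + n) = (of_nat 0 :: complex)" by (simp add: ac_simps)
        then have "m + 1 + n = 0" unfolding of_nat_eq_iff .
        then show ?thesis by simp
      qed
    qed
  qed (rule has_local_power_basisD[OF \<sigma>])
  from assms(2) consider "\<rho>' = \<rho> + of_nat n" | "\<rho> = \<rho>' + of_nat n" by (auto simp: algebra_simps)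
  then show ?thesis
  proof cases
    case 1
    then show ?thesis using *[of \<rho>] assms(3) by (simp add: algebra_simps)
  next
    case 2
    have "2 * \<rho>' + of_nat n + \<mu> + \<nu> = 1 - d" using assms(3) 2 by (simp add: algebra_simps)
    from *[OF this] show ?thesis unfolding 2 by (subst has_local_power_basis_swap)
  qed
qed

text \<open>Only the point with integer difference \<open>n\<close> matters. Each of the three points can play
  this part, and the criterion is symmetric in \<open>k\<close> and \<open>l\<close>.\<close>

lemma has_logarithmic_solutions_iff:
  assumes "hypergeometric_E (of_nat k + 1/2) (of_nat l + 1/2) (of_nat n) A B C"
  shows "has_logarithmic_solutions A B C \<longleftrightarrow>
            (if even (n + k + l) then n \<le> k + l else int n < \<bar>int k - int l\<bar>)"
proof -
  define L where "L k l \<longleftrightarrow> (if even (n + k + l) then n \<le> k + l else int n < \<bar>int k - int l\<bar>)" for k l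
  have sym: "L l k \<longleftrightarrow> L k l" for k l unfolding L_def by presburger
  have log: "has_logarithmic_solutions A B C \<longleftrightarrow> \<not> (has_local_power_basis 1 0 (1 - C) A B \<and>
      has_local_power_basis (- 1) 0 (C - A - B) A B \<and> has_local_power_basis 1 A B 0 (1 - C))"
    unfolding has_logarithmic_solutions_def local_parameters_def
    by (simp add: has_power_basis_at_0 has_power_basis_at_1 has_power_basis_at_infinity del: de_Morgan_conj) blast
  have main: "has_logarithmic_solutions A B C \<longleftrightarrow> L k l"
    if "exponent_differences A B C e\<^sub>0 e\<^sub>1 e\<^sub>i" and "(e\<^sub>0, e\<^sub>1, e\<^sub>i) \<in> {(of_nat k + 1/2, of_nat l + 1/2, of_nat n),
      (of_nat k + 1/2, of_nat n, of_nat l + 1/2), (of_nat n, of_nat k + 1/2, of_nat l + 1/2)}" for k l e\<^sub>0 e\<^sub>1 e\<^sub>i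
  proof -
    have ex: "1 - C - 0 \<in> {e\<^sub>0, - e\<^sub>0}" "C - A - B - 0 \<in> {e\<^sub>1, - e\<^sub>1}" "A - B \<in> {e\<^sub>i, - e\<^sub>i}"
      using that(1) unfolding exponent_differences_def by auto
    have ex': "B - A \<in> {e\<^sub>i, - e\<^sub>i}" "0 - (1 - C) \<in> {e\<^sub>0, - e\<^sub>0}" using ex by (auto simp: algebra_simps)
    from that(2) consider
       (i) "e\<^sub>0 = of_nat k + 1/2" "e\<^sub>1 = of_nat l + 1/2" "e\<^sub>i = of_nat n"
      | (o) "e\<^sub>0 = of_nat k + 1/2" "e\<^sub>1 = of_nat n" "e\<^sub>i = of_nat l + 1/2"
      | (z) "e\<^sub>0 = of_nat n" "e\<^sub>1 = of_nat k + 1/2" "e\<^sub>i = of_nat l + 1/2" by auto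
    then show ?thesis
    proof cases
      case i
      have "has_local_power_basis 1 0 (1 - C) A B" "has_local_power_basis (- 1) 0 (C - A - B) A B"
        using half_integer_difference_power_basis[of 1 "1 - C" 0 k] half_integer_difference_power_basis[of "- 1" "C - A - B" 0 l] ex i by auto
      moreover have "has_local_power_basis 1 A B 0 (1 - C) \<longleftrightarrow> \<not> L l k"
        unfolding L_def by (rule integer_difference_power_basis_iff[where d = "C - A - B"])
          (use ex ex' i in \<open>simp_all only:, auto simp: algebra_simps\<close>)
      ultimately show ?thesis unfolding log using sym[of l k] by simp
    next
      case o
      have "has_local_power_basis 1 0 (1 - C) A B" "has_local_power_basis 1 A B 0 (1 - C)"
        using half_integer_difference_power_basis[of 1 "1 - C" 0 k] half_integer_difference_power_basis[of 1 B A l] ex ex' o by auto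
      moreover have "has_local_power_basis (- 1) 0 (C - A - B) A B \<longleftrightarrow> \<not> L k l"
        unfolding L_def by (rule integer_difference_power_basis_iff[where d = "1 - C"])
          (use ex ex' o in \<open>simp_all only:, auto simp: algebra_simps\<close>)
      ultimately show ?thesis unfolding log by simp
    next
      case z
      have "has_local_power_basis (- 1) 0 (C - A - B) A B" "has_local_power_basis 1 A B 0 (1 - C)"
        using half_integer_difference_power_basis[of "- 1" "C - A - B" 0 k] half_integer_difference_power_basis[of 1 B A l] ex ex' z by auto
      moreover have "has_local_power_basis 1 0 (1 - C) A B \<longleftrightarrow> \<not> L k l"
        unfolding L_def by (rule integer_difference_power_basis_iff[where d = "C - A - B"])
          (use ex ex' z in \<open>simp_all only:, auto simp: algebra_simps\<close>)
      ultimately show ?thesis unfolding log by simp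
    qed
  qed
  obtain e\<^sub>0 e\<^sub>1 e\<^sub>i where E: "{#e\<^sub>0, e\<^sub>1, e\<^sub>i#} = {#of_nat k + 1/2, of_nat l + 1/2, of_nat n :: complex#}"
    and ex: "exponent_differences A B C e\<^sub>0 e\<^sub>1 e\<^sub>i"
    using assms unfolding hypergeometric_E_def by blast
  from E have "(e\<^sub>0, e\<^sub>1, e\<^sub>i) \<in> {(of_nat k + 1/2, of_nat l + 1/2, of_nat n),
      (of_nat k + 1/2, of_nat n, of_nat l + 1/2), (of_nat n, of_nat k + 1/2, of_nat l + 1/2)} \<or>
      (e\<^sub>0, e\<^sub>1, e\<^sub>i) \<in> {(of_nat l + 1/2, of_nat k + 1/2, of_nat n),
      (of_nat l + 1/2, of_nat n, of_nat k + 1/2), (of_nat n, of_nat l + 1/2, of_nat k + 1/2)}"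
    by (auto simp: add_eq_conv_ex)
  then show ?thesis using main[OF ex, of k l] main[OF ex, of l k] sym[of l k] unfolding L_def[symmetric] by blast
qed

section \<open>The covering by the tangent\<close>

text \<open>The function \<open>x \<mapsto> - tan\<^sup>2 x\<close> is a Galois covering of the plane without \<open>0, 1\<close> by the
  plane without the zeros of \<open>sin\<close> and \<open>cos\<close>, with deck transformations \<open>x \<mapsto> \<plusminus> x + m \<pi>\<close>. It is
  branched of order two over \<open>0\<close> and \<open>\<infinity>\<close>, which absorbs the square roots of the solutions, and
  logarithmic over \<open>1\<close>.\<close>

definition cover :: "complex \<Rightarrow> complex" where "cover x = - (tan x)\<^sup>2"

definition cover_space :: "complex set" where "cover_space = {x. sin x \<noteq> 0 \<and> cos x \<noteq> 0}"

text \<open>Differentiation with respect to \<open>z = cover x\<close>, as a derivation of the functions of \<open>x\<close>.\<close>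

definition cover_deriv :: "(complex \<Rightarrow> complex) \<Rightarrow> complex \<Rightarrow> complex" where
  "cover_deriv U x = deriv U x / deriv cover x"

lemma cover_space_tan: "x \<in> cover_space \<Longrightarrow> tan x \<noteq> 0" "x \<in> cover_space \<Longrightarrow> 1 + (tan x)\<^sup>2 \<noteq> 0"
  "x \<in> cover_space \<Longrightarrow> cos x \<noteq> 0"
proof -
  assume x: "x \<in> cover_space"
  then show "tan x \<noteq> 0" "cos x \<noteq> 0" by (auto simp: cover_space_def tan_def)
  have "1 + (tan x)\<^sup>2 = inverse ((cos x)\<^sup>2)"
    using tan_sec[of x] x by (simp add: cover_space_def power_inverse)
  then show "1 + (tan x)\<^sup>2 \<noteq> 0" using x by (simp add: cover_space_def)
qed

lemma has_field_derivative_tan_sq: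
  fixes x :: complex
  assumes "cos x \<noteq> 0" shows "(tan has_field_derivative 1 + (tan x)\<^sup>2) (at x)"
  using DERIV_tan[OF assms] tan_sec[OF assms] by (simp add: power_inverse)

lemma open_cover_space: "open cover_space"
proof -
  have "cover_space = (sin -` (- {0 :: complex})) \<inter> (cos -` (- {0 :: complex}))" by (auto simp: cover_space_def)
  moreover have "open (sin -` (- {0 :: complex}))" "open (cos -` (- {0 :: complex}))"
    by (rule open_vimage; force intro: continuous_intros)+
  ultimately show ?thesis by (metis open_Int)
qed

lemma has_field_derivative_cover:
  assumes "x \<in> cover_space"
  shows "(cover has_field_derivative - 2 * tan x * (1 + (tan x)\<^sup>2)) (at x)"
  unfolding cover_def[abs_def]
  by (rule DERIV_cong[OF DERIV_minus[OF DERIV_power[OF has_field_derivative_tan_sq[OF cover_space_tan(3)[OF assms]], of 2]]]) simp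

lemma deriv_cover: "x \<in> cover_space \<Longrightarrow> deriv cover x = - 2 * tan x * (1 + (tan x)\<^sup>2)"
  using has_field_derivative_cover DERIV_imp_deriv by blast

lemma deriv_cover_nonzero: "x \<in> cover_space \<Longrightarrow> deriv cover x \<noteq> 0"
  using deriv_cover cover_space_tan by simp

lemma cover_holomorphic: "cover holomorphic_on cover_space"
  using has_field_derivative_cover open_cover_space holomorphic_on_open by blast

lemma cover_not_0_1: "x \<in> cover_space \<Longrightarrow> cover x \<noteq> 0 \<and> cover x \<noteq> 1"
  using cover_space_tan[of x] by (auto simp: cover_def) (metis add.right_inverse minus_equation_iff)

lemma cover_deriv_holomorphic: "U holomorphic_on cover_space \<Longrightarrow> cover_deriv U holomorphic_on cover_space"
  unfolding cover_deriv_def[abs_def]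
  by (intro holomorphic_on_divide holomorphic_deriv open_cover_space cover_holomorphic deriv_cover_nonzero)

lemma cover_derivI:
  assumes "(U has_field_derivative W * deriv cover x) (at x)" "x \<in> cover_space"
  shows "cover_deriv U x = W"
  using DERIV_imp_deriv[OF assms(1)] deriv_cover_nonzero[OF assms(2)] by (simp add: cover_deriv_def)

lemma has_field_derivative_cover_deriv:
  assumes "U holomorphic_on cover_space" "x \<in> cover_space"
  shows "(U has_field_derivative cover_deriv U x * deriv cover x) (at x)"
  using holomorphic_derivI[OF assms(1) open_cover_space assms(2)] deriv_cover_nonzero[OF assms(2)]
  by (simp add: cover_deriv_def)

lemma cover_deriv_cong:
  assumes "\<And>x. x \<in> cover_space \<Longrightarrow> U x = V x" "x \<in> cover_space"
  shows "cover_deriv U x = cover_deriv V x"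
  unfolding cover_deriv_def using deriv_cong_open[OF open_cover_space assms(2) assms(1)] by simp

lemma cover_deriv_const: "x \<in> cover_space \<Longrightarrow> cover_deriv (\<lambda>_. c) x = 0"
  by (simp add: cover_deriv_def)

lemma cover_deriv_add:
  assumes "U holomorphic_on cover_space" "V holomorphic_on cover_space" "x \<in> cover_space"
  shows "cover_deriv (\<lambda>x. U x + V x) x = cover_deriv U x + cover_deriv V x"
  by (rule cover_derivI[OF _ assms(3)])
    (use DERIV_add[OF has_field_derivative_cover_deriv[OF assms(1,3)] has_field_derivative_cover_deriv[OF assms(2,3)]]
     in \<open>simp add: algebra_simps\<close>)

lemma cover_deriv_mult:
  assumes "U holomorphic_on cover_space" "V holomorphic_on cover_space" "x \<in> cover_space"
  shows "cover_deriv (\<lambda>x. U x * V x) x = cover_deriv U x * V x + U x * cover_deriv V x"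
  by (rule cover_derivI[OF _ assms(3)])
    (use DERIV_mult[OF has_field_derivative_cover_deriv[OF assms(1,3)] has_field_derivative_cover_deriv[OF assms(2,3)]]
     in \<open>simp add: algebra_simps\<close>)

lemma cover_deriv_cmult:
  assumes "U holomorphic_on cover_space" "x \<in> cover_space"
  shows "cover_deriv (\<lambda>x. c * U x) x = c * cover_deriv U x"
  using cover_deriv_mult[OF holomorphic_on_const assms, of c] cover_deriv_const[OF assms(2), of c] by simp

lemma cover_deriv_combination:
  assumes "U holomorphic_on cover_space" "V holomorphic_on cover_space" "x \<in> cover_space"
    and "(f has_field_derivative f') (at (cover x))" "(g has_field_derivative g') (at (cover x))"
  shows "cover_deriv (\<lambda>x. f (cover x) * U x + g (cover x) * V x) x
       = f' * U x + f (cover x) * cover_deriv U x + g' * V x + g (cover x) * cover_deriv V x"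
proof (rule cover_derivI[OF _ assms(3)])
  have c: "(cover has_field_derivative deriv cover x) (at x)"
    using has_field_derivative_cover[OF assms(3)] deriv_cover[OF assms(3)] by simp
  have "((\<lambda>x. f (cover x)) has_field_derivative f' * deriv cover x) (at x)"
    "((\<lambda>x. g (cover x)) has_field_derivative g' * deriv cover x) (at x)"
    using DERIV_chain2[OF assms(4) c] DERIV_chain2[OF assms(5) c] by auto
  note d = DERIV_add[OF DERIV_mult[OF this(1) has_field_derivative_cover_deriv[OF assms(1,3)]]
      DERIV_mult[OF this(2) has_field_derivative_cover_deriv[OF assms(2,3)]]]
  show "((\<lambda>x. f (cover x) * U x + g (cover x) * V x) has_field_derivative
      (f' * U x + f (cover x) * cover_deriv U x + g' * V x + g (cover x) * cover_deriv V x) * deriv cover x) (at x)"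
    by (rule DERIV_cong[OF d]) (simp add: algebra_simps)
qed

text \<open>The hypergeometric equation pulled back along the covering.\<close>

definition lifted_solution :: "complex \<Rightarrow> complex \<Rightarrow> complex \<Rightarrow> (complex \<Rightarrow> complex) \<Rightarrow> bool" where
  "lifted_solution A B C U \<longleftrightarrow> U holomorphic_on cover_space \<and>
     (\<forall>x\<in>cover_space. cover x * (1 - cover x) * cover_deriv (cover_deriv U) x
        + (C - (A + B + 1) * cover x) * cover_deriv U x - A * B * U x = 0)"

section \<open>Contiguity relations\<close>

text \<open>First-order operators \<open>f(z) d/dz + g(z)\<close>. They commute with the deck transformations,
  since both \<open>z\<close> and \<open>d/dz\<close> do.\<close>

definition cover_operator ::
    "(complex \<Rightarrow> complex) \<Rightarrow> (complex \<Rightarrow> complex) \<Rightarrow> (complex \<Rightarrow> complex) \<Rightarrow> complex \<Rightarrow> complex" where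
  "cover_operator f g U x = f (cover x) * cover_deriv U x + g (cover x) * U x"

lemma cover_operator_holomorphic:
  assumes "U holomorphic_on cover_space" "f holomorphic_on UNIV" "g holomorphic_on UNIV"
  shows "cover_operator f g U holomorphic_on cover_space"
proof -
  have "(f \<circ> cover) holomorphic_on cover_space" "(g \<circ> cover) holomorphic_on cover_space"
    using assms(2,3) by (auto intro!: holomorphic_on_compose_gen[OF cover_holomorphic])
  then show ?thesis
    unfolding cover_operator_def[abs_def] o_def
    using assms(1) by (intro holomorphic_intros cover_deriv_holomorphic)
qed

lemma cover_deriv_operator:
  assumes "U holomorphic_on cover_space" "x \<in> cover_space"
    and "(f has_field_derivative f') (at (cover x))" "(g has_field_derivative g') (at (cover x))"
  shows "cover_deriv (cover_operator f g U) x
       = f (cover x) * cover_deriv (cover_deriv U) x + (f' + g (cover x)) * cover_deriv U x + g' * U x"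
  using cover_deriv_combination[OF cover_deriv_holomorphic[OF assms(1)] assms(1,2,3,4)]
  unfolding cover_operator_def[abs_def] by (simp add: algebra_simps)

abbreviation "raise_A A \<equiv> cover_operator (\<lambda>z. z) (\<lambda>z. A)"
abbreviation "lower_A A B C \<equiv> cover_operator (\<lambda>z. z * (1 - z)) (\<lambda>z. - (B * z + 1 + A - C))"
abbreviation "lower_ABC A B C \<equiv> cover_operator (\<lambda>z. z * (1 - z)) (\<lambda>z. C - (A + B + 1) * z)"

text \<open>Put \<open>V = z U' + A U\<close>. The equation for \<open>U\<close> is equivalent to a first-order relation that
  expresses a multiple of \<open>U\<close> by \<open>V\<close> and \<open>V'\<close>. Differentiating this relation eliminates \<open>U\<close> and
  gives the equation for \<open>V\<close>, with no third derivative of \<open>U\<close>.\<close>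

lemma raise_A:
  assumes U: "lifted_solution A B C U"
  shows "x \<in> cover_space \<Longrightarrow> lower_A A B C (raise_A A U) x = A * (C - A - 1) * U x"
    and "lifted_solution (A + 1) B C (raise_A A U)"
proof -
  define V where "V = raise_A A U"
  have hU: "U holomorphic_on cover_space" using U unfolding lifted_solution_def by blast
  have hV: "V holomorphic_on cover_space"
    unfolding V_def by (rule cover_operator_holomorphic[OF hU]) (auto intro: holomorphic_intros)
  have V: "V x = cover x * cover_deriv U x + A * U x" for x by (simp add: V_def cover_operator_def)
  have dV: "cover_deriv V x = cover x * cover_deriv (cover_deriv U) x + (1 + A) * cover_deriv U x"
    if "x \<in> cover_space" for x
    unfolding V_def using cover_deriv_operator[OF hU that DERIV_ident DERIV_const] by simp
  have rel: "lower_A A B C V x = A * (C - A - 1) * U x" if "x \<in> cover_space" for x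
  proof -
    have "cover x * (1 - cover x) * cover_deriv (cover_deriv U) x
        + (C - (A + B + 1) * cover x) * cover_deriv U x - A * B * U x = 0"
      using U that unfolding lifted_solution_def by blast
    then show ?thesis unfolding cover_operator_def dV[OF that] V by algebra
  qed
  then show "x \<in> cover_space \<Longrightarrow> lower_A A B C (raise_A A U) x = A * (C - A - 1) * U x"
    unfolding V_def .
  show "lifted_solution (A + 1) B C (raise_A A U)"
    unfolding lifted_solution_def V_def[symmetric]
  proof (intro conjI hV ballI)
    fix x assume x: "x \<in> cover_space"
    have "cover_deriv (lower_A A B C V) x = cover_deriv (\<lambda>x. A * (C - A - 1) * U x) x"
      by (rule cover_deriv_cong[OF rel x])
    also have "\<dots> = A * (C - A - 1) * cover_deriv U x" by (rule cover_deriv_cmult[OF hU x])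
    also have "cover_deriv (lower_A A B C V) x = cover x * (1 - cover x) * cover_deriv (cover_deriv V) x
        + (1 - 2 * cover x - (B * cover x + 1 + A - C)) * cover_deriv V x - B * V x"
      by (subst cover_deriv_operator[OF hV x, where f' = "1 - 2 * cover x" and g' = "- B"])
        (auto intro!: derivative_eq_intros simp: algebra_simps)
    finally have "cover x * (cover x * (1 - cover x) * cover_deriv (cover_deriv V) x
        + (C - (A + 1 + B + 1) * cover x) * cover_deriv V x - (A + 1) * B * V x) = 0"
      using rel[OF x] V[of x] unfolding cover_operator_def by algebra
    then show "cover x * (1 - cover x) * cover_deriv (cover_deriv V) x
        + (C - (A + 1 + B + 1) * cover x) * cover_deriv V x - (A + 1) * B * V x = 0"
      using cover_not_0_1[OF x] by (metis mult_eq_0_iff)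
  qed
qed

text \<open>The same first-order system as for \<open>raise_A\<close>, read in the opposite direction.\<close>

lemma lower_A:
  assumes V: "lifted_solution (A + 1) B C V"
  shows "x \<in> cover_space \<Longrightarrow> raise_A A (lower_A A B C V) x = A * (C - A - 1) * V x"
    and "lifted_solution A B C (lower_A A B C V)"
proof -
  define U where "U = lower_A A B C V"
  have hV: "V holomorphic_on cover_space" using V unfolding lifted_solution_def by blast
  have hU: "U holomorphic_on cover_space"
    unfolding U_def by (rule cover_operator_holomorphic[OF hV]) (auto intro!: holomorphic_intros)
  have U: "U x = cover x * (1 - cover x) * cover_deriv V x - (B * cover x + 1 + A - C) * V x" for x
    by (simp add: U_def cover_operator_def algebra_simps)
  have dU: "cover_deriv U x = - A * (1 - cover x) * cover_deriv V x + A * B * V x"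
    if "x \<in> cover_space" for x
  proof -
    have "cover_deriv U x = cover x * (1 - cover x) * cover_deriv (cover_deriv V) x
        + (1 - 2 * cover x - (B * cover x + 1 + A - C)) * cover_deriv V x - B * V x"
      unfolding U_def
      by (subst cover_deriv_operator[OF hV that, where f' = "1 - 2 * cover x" and g' = "- B"])
        (auto intro!: derivative_eq_intros simp: algebra_simps)
    moreover have "cover x * (1 - cover x) * cover_deriv (cover_deriv V) x
        + (C - (A + 1 + B + 1) * cover x) * cover_deriv V x - (A + 1) * B * V x = 0"
      using V that unfolding lifted_solution_def by blast
    ultimately show ?thesis by algebra
  qed
  have rel: "raise_A A U x = A * (C - A - 1) * V x" if "x \<in> cover_space" for x
    unfolding cover_operator_def dU[OF that] U by algebra
  then show "x \<in> cover_space \<Longrightarrow> raise_A A (lower_A A B C V) x = A * (C - A - 1) * V x"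
    unfolding U_def .
  show "lifted_solution A B C (lower_A A B C V)"
    unfolding lifted_solution_def U_def[symmetric]
  proof (intro conjI hU ballI)
    fix x assume x: "x \<in> cover_space"
    have "cover_deriv (raise_A A U) x = cover_deriv (\<lambda>x. A * (C - A - 1) * V x) x"
      by (rule cover_deriv_cong[OF rel x])
    also have "\<dots> = A * (C - A - 1) * cover_deriv V x" by (rule cover_deriv_cmult[OF hV x])
    also have "cover_deriv (raise_A A U) x = cover x * cover_deriv (cover_deriv U) x + (1 + A) * cover_deriv U x"
      using cover_deriv_operator[OF hU x DERIV_ident DERIV_const] by simp
    finally have "cover x * (cover x * (1 - cover x) * cover_deriv (cover_deriv U) x
        + (C - (A + B + 1) * cover x) * cover_deriv U x - A * B * U x) = 0"
      using rel[OF x] U[of x] unfolding cover_operator_def by algebra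
    then show "cover x * (1 - cover x) * cover_deriv (cover_deriv U) x
        + (C - (A + B + 1) * cover x) * cover_deriv U x - A * B * U x = 0"
      using cover_not_0_1[OF x] by (metis mult_eq_0_iff)
  qed
qed

text \<open>Differentiating the equation itself shifts all three parameters.\<close>

lemma raise_ABC:
  assumes U: "lifted_solution A B C U"
  shows "x \<in> cover_space \<Longrightarrow> lower_ABC A B C (cover_deriv U) x = A * B * U x"
    and "lifted_solution (A + 1) (B + 1) (C + 1) (cover_deriv U)"
proof -
  define V where "V = cover_deriv U"
  have hU: "U holomorphic_on cover_space" using U unfolding lifted_solution_def by blast
  have hV: "V holomorphic_on cover_space" unfolding V_def by (rule cover_deriv_holomorphic[OF hU])
  have rel: "lower_ABC A B C V x = A * B * U x" if "x \<in> cover_space" for x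
    using U that unfolding lifted_solution_def cover_operator_def V_def by (simp add: algebra_simps)
  then show "x \<in> cover_space \<Longrightarrow> lower_ABC A B C (cover_deriv U) x = A * B * U x"
    unfolding V_def .
  show "lifted_solution (A + 1) (B + 1) (C + 1) (cover_deriv U)"
    unfolding lifted_solution_def V_def[symmetric]
  proof (intro conjI hV ballI)
    fix x assume x: "x \<in> cover_space"
    have "cover_deriv (lower_ABC A B C V) x = cover_deriv (\<lambda>x. A * B * U x) x"
      by (rule cover_deriv_cong[OF rel x])
    also have "\<dots> = A * B * V x" unfolding V_def by (rule cover_deriv_cmult[OF hU x])
    also have "cover_deriv (lower_ABC A B C V) x = cover x * (1 - cover x) * cover_deriv (cover_deriv V) x
        + (1 - 2 * cover x + (C - (A + B + 1) * cover x)) * cover_deriv V x - (A + B + 1) * V x"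
      by (subst cover_deriv_operator[OF hV x, where f' = "1 - 2 * cover x" and g' = "- (A + B + 1)"])
        (auto intro!: derivative_eq_intros simp: algebra_simps)
    finally show "cover x * (1 - cover x) * cover_deriv (cover_deriv V) x
        + (C + 1 - (A + 1 + (B + 1) + 1) * cover x) * cover_deriv V x - (A + 1) * (B + 1) * V x = 0"
      by algebra
  qed
qed

lemma lower_ABC:
  assumes V: "lifted_solution (A + 1) (B + 1) (C + 1) V"
  shows "x \<in> cover_space \<Longrightarrow> cover_deriv (lower_ABC A B C V) x = A * B * V x"
    and "lifted_solution A B C (lower_ABC A B C V)"
proof -
  define U where "U = lower_ABC A B C V"
  have hV: "V holomorphic_on cover_space" using V unfolding lifted_solution_def by blast
  have hU: "U holomorphic_on cover_space"
    unfolding U_def by (rule cover_operator_holomorphic[OF hV]) (auto intro!: holomorphic_intros)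
  have U: "U x = cover x * (1 - cover x) * cover_deriv V x + (C - (A + B + 1) * cover x) * V x" for x
    by (simp add: U_def cover_operator_def algebra_simps)
  have dU: "cover_deriv U x = A * B * V x" if "x \<in> cover_space" for x
  proof -
    have "cover_deriv U x = cover x * (1 - cover x) * cover_deriv (cover_deriv V) x
        + (1 - 2 * cover x + (C - (A + B + 1) * cover x)) * cover_deriv V x - (A + B + 1) * V x"
      unfolding U_def
      by (subst cover_deriv_operator[OF hV that, where f' = "1 - 2 * cover x" and g' = "- (A + B + 1)"])
        (auto intro!: derivative_eq_intros simp: algebra_simps)
    moreover have "cover x * (1 - cover x) * cover_deriv (cover_deriv V) x
        + (C + 1 - (A + 1 + (B + 1) + 1) * cover x) * cover_deriv V x - (A + 1) * (B + 1) * V x = 0"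
      using V that unfolding lifted_solution_def by blast
    ultimately show ?thesis by algebra
  qed
  then show "x \<in> cover_space \<Longrightarrow> cover_deriv (lower_ABC A B C V) x = A * B * V x"
    unfolding U_def .
  show "lifted_solution A B C (lower_ABC A B C V)"
    unfolding lifted_solution_def U_def[symmetric]
  proof (intro conjI hU ballI)
    fix x assume x: "x \<in> cover_space"
    have "cover_deriv (cover_deriv U) x = cover_deriv (\<lambda>x. A * B * V x) x"
      by (rule cover_deriv_cong[OF dU x])
    also have "\<dots> = A * B * cover_deriv V x" by (rule cover_deriv_cmult[OF hV x])
    finally show "cover x * (1 - cover x) * cover_deriv (cover_deriv U) x
        + (C - (A + B + 1) * cover x) * cover_deriv U x - A * B * U x = 0"
      using dU[OF x] U[of x] by algebra
  qed
qed

text \<open>The pair \<open>U, V\<close> spans the solutions. The reflection \<open>x \<mapsto> - x\<close> acts with eigenvalues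
  \<open>\<eta>, - \<eta>\<close> and the translation by \<open>\<pi>\<close> unipotently; \<open>c\<close> measures the logarithm. Linear
  independence is encoded by \<open>U\<close> and \<open>V\<close> not vanishing identically, which is enough because they
  have opposite parity.\<close>

definition equivariant_pair :: "complex \<Rightarrow> complex \<Rightarrow> complex \<Rightarrow> complex \<Rightarrow> complex \<Rightarrow>
    (complex \<Rightarrow> complex) \<Rightarrow> (complex \<Rightarrow> complex) \<Rightarrow> bool" where
  "equivariant_pair \<eta> c A B C U V \<longleftrightarrow>
     lifted_solution A B C U \<and> lifted_solution A B C V \<and>
     (\<forall>x\<in>cover_space. U (x + of_real pi) = U x \<and> V (x + of_real pi) = V x + c * U x \<and>
        U (- x) = \<eta> * U x \<and> V (- x) = - \<eta> * V x) \<and>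
     (\<exists>x\<in>cover_space. U x \<noteq> 0) \<and> (\<exists>x\<in>cover_space. V x \<noteq> 0)"

lemma cover_space_deck:
  "x + of_real pi \<in> cover_space \<longleftrightarrow> x \<in> cover_space" "- x \<in> cover_space \<longleftrightarrow> x \<in> cover_space"
  by (auto simp: cover_space_def sin_add cos_add simp flip: sin_of_real cos_of_real)

lemma cover_deck: "cover (x + of_real pi) = cover x" "cover (- x) = cover x"
proof -
  have "tan (x + of_real pi) = tan x"
    by (simp add: tan_def sin_add cos_add flip: sin_of_real cos_of_real)
  then show "cover (x + of_real pi) = cover x" "cover (- x) = cover x" by (simp_all add: cover_def)
qed

lemma cover_deriv_shift:
  assumes "U holomorphic_on cover_space" "x \<in> cover_space"
  shows "cover_deriv (\<lambda>x. U (x + of_real pi)) x = cover_deriv U (x + of_real pi)"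
proof (rule cover_derivI[OF _ assms(2)])
  have x: "x + of_real pi \<in> cover_space" using assms by (simp add: cover_space_deck)
  have "((\<lambda>x. U (x + of_real pi)) has_field_derivative cover_deriv U (x + of_real pi) * deriv cover (x + of_real pi) * 1) (at x)"
    by (rule DERIV_chain2[where g = "\<lambda>x. x + of_real pi", OF has_field_derivative_cover_deriv[OF assms(1) x]])
      (auto intro!: derivative_eq_intros)
  moreover have "deriv cover (x + of_real pi) = deriv cover x"
  proof -
    have "((\<lambda>x. cover (x + of_real pi)) has_field_derivative deriv cover (x + of_real pi) * 1) (at x)"
      by (rule DERIV_chain2[where g = "\<lambda>x. x + of_real pi", OF holomorphic_derivI[OF cover_holomorphic open_cover_space x]]) (auto intro!: derivative_eq_intros)
    then show ?thesis by (simp add: cover_deck DERIV_imp_deriv)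
  qed
  ultimately show "((\<lambda>x. U (x + of_real pi)) has_field_derivative cover_deriv U (x + of_real pi) * deriv cover x) (at x)"
    by simp
qed

lemma cover_deriv_reflect:
  assumes "U holomorphic_on cover_space" "x \<in> cover_space"
  shows "cover_deriv (\<lambda>x. U (- x)) x = cover_deriv U (- x)"
proof (rule cover_derivI[OF _ assms(2)])
  have x: "- x \<in> cover_space" using assms by (simp add: cover_space_deck)
  have "((\<lambda>x. U (- x)) has_field_derivative cover_deriv U (- x) * deriv cover (- x) * (- 1)) (at x)"
    by (rule DERIV_chain2[where g = uminus, OF has_field_derivative_cover_deriv[OF assms(1) x]])
      (auto intro!: derivative_eq_intros)
  moreover have "deriv cover (- x) * (- 1) = deriv cover x"
  proof -
    have "((\<lambda>x. cover (- x)) has_field_derivative deriv cover (- x) * (- 1)) (at x)"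
      by (rule DERIV_chain2[where g = uminus, OF holomorphic_derivI[OF cover_holomorphic open_cover_space x]]) (auto intro!: derivative_eq_intros)
    from DERIV_imp_deriv[OF this] show ?thesis by (simp add: cover_deck)
  qed
  ultimately show "((\<lambda>x. U (- x)) has_field_derivative cover_deriv U (- x) * deriv cover x) (at x)"
    by (metis mult.assoc)
qed

text \<open>An operator that commutes with the deck group and has a left inverse up to a nonzero
  factor carries such a pair to a pair with the same \<open>\<eta>\<close> and \<open>c\<close>.\<close>

lemma equivariant_pair_operator:
  assumes pair: "equivariant_pair \<eta> c A B C U V"
    and sol: "\<And>U. lifted_solution A B C U \<Longrightarrow> lifted_solution A' B' C' (cover_operator f g U)"
    and inv: "\<And>U x. lifted_solution A B C U \<Longrightarrow> x \<in> cover_space \<Longrightarrow>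
        cover_operator f' g' (cover_operator f g U) x = \<kappa> * U x" and "\<kappa> \<noteq> 0"
  shows "equivariant_pair \<eta> c A' B' C' (cover_operator f g U) (cover_operator f g V)"
proof -
  have U: "lifted_solution A B C U" "\<And>x. x \<in> cover_space \<Longrightarrow> U (x + of_real pi) = U x"
      "\<And>x. x \<in> cover_space \<Longrightarrow> U (- x) = \<eta> * U x" "\<exists>x\<in>cover_space. U x \<noteq> 0"
    and V: "lifted_solution A B C V" "\<And>x. x \<in> cover_space \<Longrightarrow> V (x + of_real pi) = V x + c * U x"
      "\<And>x. x \<in> cover_space \<Longrightarrow> V (- x) = - \<eta> * V x" "\<exists>x\<in>cover_space. V x \<noteq> 0"
    using pair unfolding equivariant_pair_def by auto
  have h: "U holomorphic_on cover_space" "V holomorphic_on cover_space"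
    using U V unfolding lifted_solution_def by auto
  have "cover_operator f g U (x + of_real pi) = cover_operator f g U x \<and>
      cover_operator f g V (x + of_real pi) = cover_operator f g V x + c * cover_operator f g U x \<and>
      cover_operator f g U (- x) = \<eta> * cover_operator f g U x \<and>
      cover_operator f g V (- x) = - \<eta> * cover_operator f g V x" if x: "x \<in> cover_space" for x
  proof -
    have "cover_deriv U (x + of_real pi) = cover_deriv U x"
      using cover_deriv_shift[OF h(1) x] cover_deriv_cong[OF U(2) x] by simp
    moreover have "cover_deriv V (x + of_real pi) = cover_deriv V x + c * cover_deriv U x"
      using cover_deriv_shift[OF h(2) x] cover_deriv_cong[OF V(2) x]
        cover_deriv_add[OF h(2) holomorphic_on_mult[OF holomorphic_on_const h(1)] x, of c] cover_deriv_cmult[OF h(1) x, of c] by simp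
    moreover have "cover_deriv U (- x) = \<eta> * cover_deriv U x"
      using cover_deriv_reflect[OF h(1) x] cover_deriv_cong[OF U(3) x] cover_deriv_cmult[OF h(1) x, of \<eta>] by simp
    moreover have "cover_deriv V (- x) = - \<eta> * cover_deriv V x"
      using cover_deriv_reflect[OF h(2) x] cover_deriv_cong[OF V(3) x] cover_deriv_cmult[OF h(2) x, of "- \<eta>"] by simp
    ultimately show ?thesis
      using U(2,3)[OF x] V(2,3)[OF x] by (simp add: cover_operator_def cover_deck algebra_simps)
  qed
  moreover have "\<exists>x\<in>cover_space. cover_operator f g W x \<noteq> 0"
    if W: "lifted_solution A B C W" "\<exists>x\<in>cover_space. W x \<noteq> 0" for W
  proof (rule ccontr)
    assume "\<not> ?thesis"
    then have 0: "\<And>x. x \<in> cover_space \<Longrightarrow> cover_operator f g W x = 0" by blast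
    obtain x where x: "x \<in> cover_space" "W x \<noteq> 0" using W by blast
    have "cover_deriv (cover_operator f g W) x = 0"
      using cover_deriv_cong[OF 0 x(1)] cover_deriv_const[OF x(1)] by simp
    then have "\<kappa> * W x = 0"
      using inv[OF W(1) x(1)] 0[OF x(1)] by (simp add: cover_operator_def[of f' g'])
    then show False using x \<open>\<kappa> \<noteq> 0\<close> by simp
  qed
  ultimately show ?thesis
    unfolding equivariant_pair_def using sol U V by blast
qed

lemma lifted_solution_swap: "lifted_solution A B C U \<longleftrightarrow> lifted_solution B A C U"
  unfolding lifted_solution_def by (simp add: add.commute mult.commute)

lemma equivariant_pair_swap:
  "equivariant_pair \<eta> c A B C U V \<longleftrightarrow> equivariant_pair \<eta> c B A C U V"
  unfolding equivariant_pair_def lifted_solution_swap[of A B] ..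

definition admits_equivariant_pair :: "complex \<Rightarrow> complex \<Rightarrow> complex \<Rightarrow> complex \<Rightarrow> complex \<Rightarrow> bool" where
  "admits_equivariant_pair \<eta> c A B C \<longleftrightarrow> (\<exists>U V. equivariant_pair \<eta> c A B C U V)"

lemma admits_swap: "admits_equivariant_pair \<eta> c A B C \<longleftrightarrow> admits_equivariant_pair \<eta> c B A C"
  unfolding admits_equivariant_pair_def equivariant_pair_swap[of \<eta> c A B] ..

lemma admits_raise_A:
  assumes "A \<noteq> 0" "C - A - 1 \<noteq> 0"
  shows "admits_equivariant_pair \<eta> c (A + 1) B C \<longleftrightarrow> admits_equivariant_pair \<eta> c A B C"
proof
  assume "admits_equivariant_pair \<eta> c A B C"
  then obtain U V where "equivariant_pair \<eta> c A B C U V" unfolding admits_equivariant_pair_def by blast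
  then have "equivariant_pair \<eta> c (A + 1) B C (raise_A A U) (raise_A A V)"
    by (rule equivariant_pair_operator[OF _ raise_A(2)[of A B C] raise_A(1)[of A B C]])
      (use assms in simp_all)
  then show "admits_equivariant_pair \<eta> c (A + 1) B C" unfolding admits_equivariant_pair_def by blast
next
  assume "admits_equivariant_pair \<eta> c (A + 1) B C"
  then obtain U V where "equivariant_pair \<eta> c (A + 1) B C U V" unfolding admits_equivariant_pair_def by blast
  then have "equivariant_pair \<eta> c A B C (lower_A A B C U) (lower_A A B C V)"
    by (rule equivariant_pair_operator[OF _ lower_A(2)[of A B C] lower_A(1)[of A B C]])
      (use assms in simp_all)
  then show "admits_equivariant_pair \<eta> c A B C" unfolding admits_equivariant_pair_def by blast
qed

lemma cover_operator_deriv: "cover_operator (\<lambda>_. 1) (\<lambda>_. 0) U = cover_deriv U"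
  by (simp add: cover_operator_def[abs_def])

lemma admits_raise_ABC:
  assumes "A \<noteq> 0" "B \<noteq> 0"
  shows "admits_equivariant_pair \<eta> c (A + 1) (B + 1) (C + 1) \<longleftrightarrow> admits_equivariant_pair \<eta> c A B C"
proof
  assume "admits_equivariant_pair \<eta> c A B C"
  then obtain U V where "equivariant_pair \<eta> c A B C U V" unfolding admits_equivariant_pair_def by blast
  then have "equivariant_pair \<eta> c (A + 1) (B + 1) (C + 1)
      (cover_operator (\<lambda>_. 1) (\<lambda>_. 0) U) (cover_operator (\<lambda>_. 1) (\<lambda>_. 0) V)"
    by (rule equivariant_pair_operator[OF _ raise_ABC(2)[of A B C, folded cover_operator_deriv]
          raise_ABC(1)[of A B C, folded cover_operator_deriv]])
      (use assms in simp_all)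
  then show "admits_equivariant_pair \<eta> c (A + 1) (B + 1) (C + 1)" unfolding admits_equivariant_pair_def by blast
next
  assume "admits_equivariant_pair \<eta> c (A + 1) (B + 1) (C + 1)"
  then obtain U V where "equivariant_pair \<eta> c (A + 1) (B + 1) (C + 1) U V" unfolding admits_equivariant_pair_def by blast
  then have "equivariant_pair \<eta> c A B C (lower_ABC A B C U) (lower_ABC A B C V)"
    by (rule equivariant_pair_operator[OF _ lower_ABC(2)[of A B C] lower_ABC(1)[of A B C, folded cover_operator_deriv]])
      (use assms in simp_all)
  then show "admits_equivariant_pair \<eta> c A B C" unfolding admits_equivariant_pair_def by blast
qed

lemma half_plus_int_nonzero: "of_int b + 1/2 + of_int m \<noteq> (0 :: complex)"
proof
  assume "of_int b + 1/2 + of_int m = (0 :: complex)"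
  then have "of_int (2 * (b + m) + 1) = (of_int 0 :: complex)" by (simp add: field_simps)
  then have "2 * (b + m) + 1 = 0" unfolding of_int_eq_iff .
  then show False by presburger
qed

lemma int_step_invariant:
  fixes P :: "int \<Rightarrow> bool"
  assumes step: "\<And>i. i \<noteq> 0 \<Longrightarrow> P (i + 1) = P i"
  shows "P i = P (if i \<le> 0 then 0 else 1)"
proof (cases "i \<le> 0")
  case True
  then have "P i = P 0"
  proof (induction i rule: int_le_induct)
    case (step i)
    then show ?case using assms[of "i - 1"] by simp
  qed simp
  then show ?thesis using True by simp
next
  case False
  then have "1 \<le> i" by simp
  then have "P i = P 1"
  proof (induction i rule: int_ge_induct)
    case (step i)
    then show ?case using assms[of i] by simp
  qed simp
  then show ?thesis using False by simp
qed

text \<open>All integer shifts of the parameters are available except those where the factor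
  \<open>A (C - A - 1)\<close>, its analogue with \<open>B\<close> in place of \<open>A\<close>, or \<open>A B\<close> vanishes, that is, except for
  the steps of \<open>a\<close> or \<open>m\<close> between \<open>0\<close> and \<open>1\<close>. So there are four classes, each with one simplest
  member.\<close>

lemma admits_equivariant_pair_class:
  fixes a b m :: int
  shows "admits_equivariant_pair \<eta> c (of_int a) (of_int b + 1/2) (of_int b + 1/2 + of_int m) \<longleftrightarrow>
    admits_equivariant_pair \<eta> c (if a \<le> 0 then 0 else 1) (1/2) (if m \<le> 0 then 1/2 else 3/2)"
proof -
  define G where "G a m b \<longleftrightarrow> admits_equivariant_pair \<eta> c (of_int a) (of_int b + 1/2) (of_int b + 1/2 + of_int m)" for a m b :: int
  have A: "G (a + 1) m b \<longleftrightarrow> G a m b" if "a \<noteq> 0" for a m b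
  proof -
    have "of_int b + 1/2 + of_int m - of_int a - 1 = of_int b + 1/2 + (of_int (m - a - 1) :: complex)" by simp
    then have "of_int b + 1/2 + of_int m - of_int a - 1 \<noteq> (0 :: complex)"
      using half_plus_int_nonzero[of b "m - a - 1"] by simp
    then show ?thesis
      using admits_raise_A[of "of_int a" "of_int b + 1/2 + of_int m" \<eta> c "of_int b + 1/2"] that by (simp add: G_def)
  qed
  have B: "G a (m - 1) (b + 1) \<longleftrightarrow> G a m b" if "m \<noteq> 1" for a m b
  proof -
    have "of_int b + 1/2 \<noteq> (0 :: complex)" using half_plus_int_nonzero[of b 0] by simp
    moreover have "of_int b + 1/2 + of_int m - (of_int b + 1/2) - 1 = (of_int (m - 1) :: complex)" by simp
    then have "of_int b + 1/2 + of_int m - (of_int b + 1/2) - 1 \<noteq> (0 :: complex)"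
      using that by (metis of_int_eq_0_iff right_minus_eq)
    ultimately have "admits_equivariant_pair \<eta> c (of_int a) (of_int b + 1/2 + 1) (of_int b + 1/2 + of_int m) \<longleftrightarrow> G a m b"
      using admits_raise_A[of "of_int b + 1/2" "of_int b + 1/2 + of_int m" \<eta> c "of_int a"]
      unfolding G_def by (simp add: admits_swap[of \<eta> c _ "of_int a"])
    moreover have "of_int (b + 1) + 1/2 = of_int b + 1/2 + (1 :: complex)" by simp
    moreover have "of_int (b + 1) + 1/2 + of_int (m - 1) = of_int b + 1/2 + (of_int m :: complex)" by simp
    ultimately show ?thesis unfolding G_def by metis
  qed
  have ABC: "G (a + 1) m (b + 1) \<longleftrightarrow> G a m b" if "a \<noteq> 0" for a m b
  proof -
    have "of_int b + 1/2 \<noteq> (0 :: complex)" using half_plus_int_nonzero[of b 0] by simp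
    then have "admits_equivariant_pair \<eta> c (of_int a + 1) (of_int b + 1/2 + 1) (of_int b + 1/2 + of_int m + 1) \<longleftrightarrow> G a m b"
      unfolding G_def by (intro admits_raise_ABC) (use that in simp_all)
    moreover have "of_int (b + 1) + 1/2 = of_int b + 1/2 + (1 :: complex)" "of_int (a + 1) = of_int a + (1 :: complex)"
      "of_int (b + 1) + 1/2 + of_int m = of_int b + 1/2 + of_int m + (1 :: complex)" by simp_all
    ultimately show ?thesis unfolding G_def by metis
  qed
  \<comment> \<open>Shift all parameters and undo the shift of \<open>a\<close>; for \<open>a = 0\<close> make a detour through \<open>a = -1\<close>.\<close>
  have b1: "G a m (b + 1) \<longleftrightarrow> G a m b" for a m b
  proof -
    have *: "G a m (b + 1) \<longleftrightarrow> G a m b" if "a \<noteq> 0" for a using A[OF that] ABC[OF that] by blast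
    then show ?thesis using A[of "-1"] by (cases "a = 0") auto
  qed
  have b0: "G a m b \<longleftrightarrow> G a m 0" for a m b
    using int_step_invariant[of "G a m" b] b1[of a m 0] b1 by (cases "b \<le> 0") auto
  have m1: "G a (m + 1) b \<longleftrightarrow> G a m b" if "m \<noteq> 0" for a m b
    using B[of "m + 1" a b] b1 that by simp
  have m0: "G a m b \<longleftrightarrow> G a (if m \<le> 0 then 0 else 1) b" for a m b
    using int_step_invariant[of "\<lambda>m. G a m b" m] m1 by blast
  have a0: "G a m b \<longleftrightarrow> G (if a \<le> 0 then 0 else 1) m b" for a m b
    using int_step_invariant[of "\<lambda>a. G a m b" a] A by blast
  have "G a m b \<longleftrightarrow> G (if a \<le> 0 then 0 else 1) (if m \<le> 0 then 0 else 1) 0"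
    using a0 m0 b0 by metis
  then show ?thesis unfolding G_def by simp
qed

section \<open>Elementary solutions\<close>

text \<open>The simplest members of the four classes have solutions that are polynomials in \<open>x\<close>,
  \<open>tan x\<close>, \<open>cot x\<close> and \<open>cos\<^sup>2 x\<close>. A name for the last one makes their verification an ideal
  membership problem.\<close>

definition cos_sq :: "complex \<Rightarrow> complex" where "cos_sq x = (cos x)\<^sup>2"

text \<open>These three relations generate the ideal of polynomial relations between the three
  functions, and they allow \<open>algebra\<close> to check the differential equations quickly.\<close>

lemma tan_cot_cos_sq:
  assumes "x \<in> cover_space"
  shows "tan x * cot x = 1" "(tan x)\<^sup>2 * cos_sq x = 1 - cos_sq x"
    "(cot x)\<^sup>2 * cos_sq x = (cot x)\<^sup>2 - cos_sq x"
proof -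
  have nz: "cos x \<noteq> 0" "sin x \<noteq> 0" using assms by (auto simp: cover_space_def)
  show "tan x * cot x = 1" using nz by (simp add: tan_def cot_def)
  show t: "(tan x)\<^sup>2 * cos_sq x = 1 - cos_sq x"
    using nz by (simp add: tan_def cos_sq_def power_divide sin_squared_eq)
  have "(cot x)\<^sup>2 - cos_sq x = (cot x)\<^sup>2 - (cot x)\<^sup>2 * (sin x)\<^sup>2"
    using nz by (simp add: cot_def cos_sq_def power_divide)
  also have "\<dots> = (cot x)\<^sup>2 * cos_sq x"
    by (simp add: cos_sq_def sin_squared_eq algebra_simps)
  finally show "(cot x)\<^sup>2 * cos_sq x = (cot x)\<^sup>2 - cos_sq x" by simp
qed

lemma has_field_derivative_trig:
  assumes "x \<in> cover_space"
  shows "(tan has_field_derivative 1 + (tan x)\<^sup>2) (at x)"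
    "(cot has_field_derivative - (1 + (cot x)\<^sup>2)) (at x)"
    "(cos_sq has_field_derivative - 2 * tan x * cos_sq x) (at x)"
proof -
  have nz: "cos x \<noteq> 0" "sin x \<noteq> 0" using assms by (auto simp: cover_space_def)
  show "(tan has_field_derivative 1 + (tan x)\<^sup>2) (at x)"
    by (rule has_field_derivative_tan_sq[OF nz(1)])
  have "((\<lambda>x. cos x / sin x) has_field_derivative (- sin x * sin x - cos x * cos x) / (sin x * sin x)) (at x)"
    by (rule DERIV_divide[OF DERIV_cos DERIV_sin nz(2)])
  then show "(cot has_field_derivative - (1 + (cot x)\<^sup>2)) (at x)"
    unfolding cot_def[abs_def] by (rule DERIV_cong) (use nz in \<open>simp add: diff_divide_distrib power2_eq_square\<close>)
  show "(cos_sq has_field_derivative - 2 * tan x * cos_sq x) (at x)"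
    unfolding cos_sq_def[abs_def]
    by (rule DERIV_cong[OF DERIV_power[OF DERIV_cos, of 2]]) (use nz in \<open>simp add: tan_def power2_eq_square\<close>)
qed

lemma deriv_cover_reciprocal:
  assumes "x \<in> cover_space" shows "(- cot x * cos_sq x / 2) * deriv cover x = 1"
  using tan_cot_cos_sq[OF assms] unfolding deriv_cover[OF assms] by algebra

lemma lifted_solutionI:
  assumes U: "\<And>x. x \<in> cover_space \<Longrightarrow> (U has_field_derivative U' x) (at x)"
    and W: "\<And>x. x \<in> cover_space \<Longrightarrow> U' x * (- cot x * cos_sq x / 2) = W x"
    and W': "\<And>x. x \<in> cover_space \<Longrightarrow> (W has_field_derivative W' x) (at x)"
    and eq: "\<And>x. x \<in> cover_space \<Longrightarrow> cover x * (1 - cover x) * (W' x * (- cot x * cos_sq x / 2))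
        + (C - (A + B + 1) * cover x) * W x - A * B * U x = 0"
  shows "lifted_solution A B C U"
proof -
  have h: "U holomorphic_on cover_space"
    using U open_cover_space holomorphic_on_open by blast
  have cd: "cover_deriv F x = F' * (- cot x * cos_sq x / 2)"
    if "(F has_field_derivative F') (at x)" "x \<in> cover_space" for F F' x
  proof (rule cover_derivI[OF _ that(2)])
    have "F' = F' * ((- cot x * cos_sq x / 2) * deriv cover x)"
      unfolding deriv_cover_reciprocal[OF that(2)] by simp
    then show "(F has_field_derivative F' * (- cot x * cos_sq x / 2) * deriv cover x) (at x)"
      using that(1) by (simp only: mult.assoc)
  qed
  have 1: "cover_deriv U x = W x" if "x \<in> cover_space" for x
    using cd[OF U[OF that] that] W[OF that] by simp
  have "cover_deriv (cover_deriv U) x = W' x * (- cot x * cos_sq x / 2)" if "x \<in> cover_space" for x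
    using cover_deriv_cong[OF 1 that] cd[OF W'[OF that] that] by simp
  then show ?thesis using h 1 eq unfolding lifted_solution_def by simp
qed

lemma one_in_cover_space: "1 \<in> cover_space"
proof -
  have "cos 1 > (0 :: real)" using cos_gt_zero_pi[of 1] pi_gt3 by simp
  moreover have "sin 1 > (0 :: real)" using sin_gt_zero[of 1] pi_gt3 by simp
  moreover have "sin (of_real 1 :: complex) = of_real (sin 1)" "cos (of_real 1 :: complex) = of_real (cos 1)"
    by (simp_all only: sin_of_real cos_of_real)
  ultimately show ?thesis unfolding cover_space_def by simp
qed

lemma trig_deck:
  "tan (x + of_real pi) = tan (x :: complex)" "cot (x + of_real pi) = cot x" "cos_sq (x + of_real pi) = cos_sq x"
  "cos_sq (- x) = cos_sq x"
  by (simp_all add: tan_def cot_def cos_sq_def sin_add cos_add flip: sin_of_real cos_of_real)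

lemma trig_nonzero: "x \<in> cover_space \<Longrightarrow> tan x \<noteq> 0 \<and> cot x \<noteq> 0 \<and> cos_sq x \<noteq> 0"
  by (auto simp: cover_space_def tan_def cot_def cos_sq_def)

lemma lifted_solution_constant: "lifted_solution 0 B C (\<lambda>_. 1)"
  by (rule lifted_solutionI[where U' = "\<lambda>_. 0" and W = "\<lambda>_. 0" and W' = "\<lambda>_. 0"]) auto

lemma lifted_solution_id: "lifted_solution 0 (1/2) (1/2) (\<lambda>x. x)"
proof (rule lifted_solutionI)
  fix x assume x: "x \<in> cover_space"
  note d = has_field_derivative_trig[OF x] and rel = tan_cot_cos_sq[OF x]
  show "((\<lambda>x. x) has_field_derivative (\<lambda>_. 1) x) (at x)" by simp
  show "(\<lambda>_. 1) x * (- cot x * cos_sq x / 2) = (\<lambda>x. - cot x * cos_sq x / 2) x" by simp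
  show "((\<lambda>x. - cot x * cos_sq x / 2) has_field_derivative (\<lambda>x. (3 + (cot x)\<^sup>2) * cos_sq x / 2) x) (at x)"
    by (rule DERIV_cong[OF DERIV_cdivide[OF DERIV_mult[OF DERIV_minus[OF d(2)] d(3)]]],
        rule arg_cong[where f = "\<lambda>u. u / 2"]) (use rel in algebra)
  show "cover x * (1 - cover x) * ((\<lambda>x. (3 + (cot x)\<^sup>2) * cos_sq x / 2) x * (- cot x * cos_sq x / 2))
        + (1/2 - (0 + 1/2 + 1) * cover x) * (\<lambda>x. - cot x * cos_sq x / 2) x - 0 * (1/2) * x = 0"
    using rel unfolding cover_def by algebra
qed

lemma lifted_solution_cot: "lifted_solution A (1/2) (3/2) cot"
proof (rule lifted_solutionI)
  fix x assume x: "x \<in> cover_space"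
  note d = has_field_derivative_trig[OF x] and rel = tan_cot_cos_sq[OF x]
  show "(cot has_field_derivative (\<lambda>x. - (1 + (cot x)\<^sup>2)) x) (at x)" using d by simp
  show "(\<lambda>x. - (1 + (cot x)\<^sup>2)) x * (- cot x * cos_sq x / 2) = (\<lambda>x. (cot x)^3 / 2) x" using rel by algebra
  show "((\<lambda>x. (cot x)^3 / 2) has_field_derivative (\<lambda>x. - 3/2 * (cot x)\<^sup>2 * (1 + (cot x)\<^sup>2)) x) (at x)"
    by (rule DERIV_cong[OF DERIV_cdivide[OF DERIV_power[OF d(2), of 3]]]) (simp add: algebra_simps power2_eq_square)
  show "cover x * (1 - cover x) * ((\<lambda>x. - 3/2 * (cot x)\<^sup>2 * (1 + (cot x)\<^sup>2)) x * (- cot x * cos_sq x / 2))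
        + (3/2 - (A + 1/2 + 1) * cover x) * (\<lambda>x. (cot x)^3 / 2) x - A * (1/2) * cot x = 0"
    using rel unfolding cover_def by algebra
qed

lemma lifted_solution_id_cot: "lifted_solution 1 (1/2) (3/2) (\<lambda>x. x * cot x)"
proof (rule lifted_solutionI)
  fix x assume x: "x \<in> cover_space"
  note d = has_field_derivative_trig[OF x] and rel = tan_cot_cos_sq[OF x]
  show "((\<lambda>x. x * cot x) has_field_derivative (\<lambda>x. cot x - x * (1 + (cot x)\<^sup>2)) x) (at x)"
    by (rule DERIV_cong[OF DERIV_mult[OF DERIV_ident d(2)]]) (simp add: algebra_simps)
  show "(\<lambda>x. cot x - x * (1 + (cot x)\<^sup>2)) x * (- cot x * cos_sq x / 2)
      = (\<lambda>x. x * ((cot x)^3 / 2) - (cot x)^2 * cos_sq x / 2) x" using rel by algebra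
  show "((\<lambda>x. x * ((cot x)^3 / 2) - (cot x)^2 * cos_sq x / 2) has_field_derivative
      (\<lambda>x. 3/2 * (cot x)^3 + cot x * cos_sq x - 3/2 * x * (cot x)\<^sup>2 * (1 + (cot x)\<^sup>2)) x) (at x)"
  proof -
    have "((\<lambda>x. (cot x)^3) has_field_derivative - 3 * (cot x)\<^sup>2 * (1 + (cot x)\<^sup>2)) (at x)"
      by (rule DERIV_cong[OF DERIV_power[OF d(2), of 3]]) (simp add: algebra_simps power2_eq_square)
    note D = DERIV_mult[OF DERIV_ident DERIV_cdivide[OF this, of 2]]
    have "((\<lambda>x. (cot x)\<^sup>2) has_field_derivative - 2 * cot x * (1 + (cot x)\<^sup>2)) (at x)"
      by (rule DERIV_cong[OF DERIV_power[OF d(2), of 2]]) (simp add: algebra_simps)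
    from DERIV_mult[OF this d(3)]
    have "((\<lambda>x. (cot x)\<^sup>2 * cos_sq x) has_field_derivative - 2 * ((cot x)^3 + cot x * cos_sq x)) (at x)"
      by (rule DERIV_cong) (use rel in algebra)
    from DERIV_diff[OF D DERIV_cdivide[OF this, of 2]] show ?thesis
      by (rule DERIV_cong) (simp add: field_simps)
  qed
  show "cover x * (1 - cover x) * ((\<lambda>x. 3/2 * (cot x)^3 + cot x * cos_sq x - 3/2 * x * (cot x)\<^sup>2 * (1 + (cot x)\<^sup>2)) x * (- cot x * cos_sq x / 2))
        + (3/2 - (1 + 1/2 + 1) * cover x) * (\<lambda>x. x * ((cot x)^3 / 2) - (cot x)^2 * cos_sq x / 2) x - 1 * (1/2) * (x * cot x) = 0"
    using rel unfolding cover_def by algebra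
qed

lemma lifted_solution_cos_sq: "lifted_solution 1 (1/2) (1/2) cos_sq"
proof (rule lifted_solutionI)
  fix x assume x: "x \<in> cover_space"
  note d = has_field_derivative_trig[OF x] and rel = tan_cot_cos_sq[OF x]
  show "(cos_sq has_field_derivative (\<lambda>x. - 2 * tan x * cos_sq x) x) (at x)" using d by simp
  show "(\<lambda>x. - 2 * tan x * cos_sq x) x * (- cot x * cos_sq x / 2) = (\<lambda>x. (cos_sq x)\<^sup>2) x" using rel by algebra
  show "((\<lambda>x. (cos_sq x)\<^sup>2) has_field_derivative (\<lambda>x. - 4 * tan x * (cos_sq x)\<^sup>2) x) (at x)"
    by (rule DERIV_cong[OF DERIV_power[OF d(3), of 2]]) (simp add: algebra_simps power2_eq_square)
  show "cover x * (1 - cover x) * ((\<lambda>x. - 4 * tan x * (cos_sq x)\<^sup>2) x * (- cot x * cos_sq x / 2))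
        + (1/2 - (1 + 1/2 + 1) * cover x) * (\<lambda>x. (cos_sq x)\<^sup>2) x - 1 * (1/2) * cos_sq x = 0"
    using rel unfolding cover_def by algebra
qed

lemma lifted_solution_tan_cos_sq: "lifted_solution 1 (1/2) (1/2) (\<lambda>x. tan x * cos_sq x)"
proof (rule lifted_solutionI)
  fix x assume x: "x \<in> cover_space"
  note d = has_field_derivative_trig[OF x] and rel = tan_cot_cos_sq[OF x]
  show "((\<lambda>x. tan x * cos_sq x) has_field_derivative (\<lambda>x. 2 * cos_sq x - 1) x) (at x)"
    by (rule DERIV_cong[OF DERIV_mult[OF d(1,3)]]) (use rel in algebra)
  show "(\<lambda>x. 2 * cos_sq x - 1) x * (- cot x * cos_sq x / 2) = (\<lambda>x. (1 - 2 * cos_sq x) * (cot x * cos_sq x) / 2) x"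
    by (simp add: field_simps)
  show "((\<lambda>x. (1 - 2 * cos_sq x) * (cot x * cos_sq x) / 2) has_field_derivative
      (\<lambda>x. (4 * (cos_sq x)\<^sup>2 + (2 * cos_sq x - 1) * ((cot x)\<^sup>2 + 2 * cos_sq x)) / 2) x) (at x)"
    by (rule DERIV_cong[OF DERIV_cdivide[OF DERIV_mult[OF DERIV_diff[OF DERIV_const DERIV_cmult[OF d(3)]] DERIV_mult[OF d(2,3)]]]],
        rule arg_cong[where f = "\<lambda>u. u / 2"]) (use rel in algebra)
  show "cover x * (1 - cover x) * ((\<lambda>x. (4 * (cos_sq x)\<^sup>2 + (2 * cos_sq x - 1) * ((cot x)\<^sup>2 + 2 * cos_sq x)) / 2) x * (- cot x * cos_sq x / 2))
        + (1/2 - (1 + 1/2 + 1) * cover x) * (\<lambda>x. (1 - 2 * cos_sq x) * (cot x * cos_sq x) / 2) x - 1 * (1/2) * (tan x * cos_sq x) = 0"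
    using rel unfolding cover_def by algebra
qed

text \<open>Each class with \<open>a\<close> and \<open>m\<close> on the same side has the function \<open>x\<close>, an inverse tangent of
  \<open>\<surd>(-z)\<close>, among its solutions up to an algebraic factor; this is the logarithm, and translation
  by \<open>\<pi>\<close> adds \<open>\<pi>\<close> to it. In the two other classes all solutions have period \<open>\<pi>\<close>.\<close>

lemma elementary_equivariant_pairs:
  "equivariant_pair 1 (of_real pi) 0 (1/2) (1/2) (\<lambda>_. 1) (\<lambda>x. x)"
  "equivariant_pair (- 1) (of_real pi) 1 (1/2) (3/2) cot (\<lambda>x. x * cot x)"
  "equivariant_pair 1 0 0 (1/2) (3/2) (\<lambda>_. 1) cot"
  "equivariant_pair 1 0 1 (1/2) (1/2) cos_sq (\<lambda>x. tan x * cos_sq x)"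
  unfolding equivariant_pair_def
  using one_in_cover_space trig_nonzero[OF one_in_cover_space]
  by (auto intro!: lifted_solution_constant lifted_solution_id lifted_solution_cot
      lifted_solution_id_cot lifted_solution_cos_sq lifted_solution_tan_cos_sq bexI[of _ 1]
      simp: trig_deck distrib_right)

lemma equivariant_pair_exists:
  fixes a b m :: int
  obtains \<eta> U V where "\<eta> \<in> {1, -1}"
    "equivariant_pair \<eta> (if a \<le> 0 \<longleftrightarrow> m \<le> 0 then of_real pi else 0)
       (of_int a) (of_int b + 1/2) (of_int b + 1/2 + of_int m) U V"
proof -
  have "\<exists>\<eta>\<in>{1, -1}. admits_equivariant_pair \<eta> (if a \<le> 0 \<longleftrightarrow> m \<le> 0 then of_real pi else 0)
      (if a \<le> 0 then 0 else 1) (1/2) (if m \<le> 0 then 1/2 else 3/2)"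
    (is "\<exists>\<eta>\<in>_. ?P \<eta>")
  proof -
    have pairs: "admits_equivariant_pair 1 (of_real pi) 0 (1/2) (1/2)" "admits_equivariant_pair (- 1) (of_real pi) 1 (1/2) (3/2)"
      "admits_equivariant_pair 1 0 0 (1/2) (3/2)" "admits_equivariant_pair 1 0 1 (1/2) (1/2)"
      unfolding admits_equivariant_pair_def using elementary_equivariant_pairs by blast+
    have "?P (if a > 0 \<and> m > 0 then - 1 else 1)"
      using pairs by (cases "a \<le> 0"; cases "m \<le> 0") simp_all
    then show ?thesis by (intro bexI) auto
  qed
  then obtain \<eta> where \<eta>: "\<eta> \<in> {1, -1}" and "?P \<eta>" by blast
  from this(2) obtain U V where "equivariant_pair \<eta> (if a \<le> 0 \<longleftrightarrow> m \<le> 0 then of_real pi else 0)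
       (of_int a) (of_int b + 1/2) (of_int b + 1/2 + of_int m) U V"
    unfolding admits_equivariant_pair_class[of _ _ a b m, symmetric] unfolding admits_equivariant_pair_def by blast
  with \<eta> show ?thesis by (rule that)
qed

section \<open>Deck transformations and sections of the covering\<close>

definition deck :: "int \<Rightarrow> int \<Rightarrow> complex \<Rightarrow> complex" where
  "deck \<epsilon> m x = of_int \<epsilon> * x + of_int m * of_real pi"

lemma deck_shift: "deck 1 m x \<in> cover_space \<longleftrightarrow> x \<in> cover_space" "cover (deck 1 m x) = cover x"
proof -
  have "(deck 1 m x \<in> cover_space \<longleftrightarrow> x \<in> cover_space) \<and> cover (deck 1 m x) = cover x"
  proof (induction m rule: int_induct[of _ 0])
    case base then show ?case by (simp add: deck_def)
  next
    case (step1 i)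
    have "deck 1 (i + 1) x = deck 1 i x + of_real pi" by (simp add: deck_def algebra_simps)
    then show ?case using step1 by (simp add: cover_space_deck cover_deck)
  next
    case (step2 i)
    have "deck 1 i x = deck 1 (i - 1) x + of_real pi" by (simp add: deck_def algebra_simps)
    then show ?case using step2 by (simp add: cover_space_deck cover_deck)
  qed
  then show "deck 1 m x \<in> cover_space \<longleftrightarrow> x \<in> cover_space" "cover (deck 1 m x) = cover x" by auto
qed

lemma deck_transformation:
  assumes "\<epsilon> \<in> {1, -1}"
  shows "deck \<epsilon> m x \<in> cover_space \<longleftrightarrow> x \<in> cover_space" "cover (deck \<epsilon> m x) = cover x"
proof -
  have "deck \<epsilon> m x = deck 1 m (if \<epsilon> = 1 then x else - x)" using assms by (auto simp: deck_def)
  then show "deck \<epsilon> m x \<in> cover_space \<longleftrightarrow> x \<in> cover_space" "cover (deck \<epsilon> m x) = cover x"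
    by (simp_all add: deck_shift cover_space_deck cover_deck)
qed

lemma tan_eq_imp_shift:
  assumes "x \<in> cover_space" "y \<in> cover_space" "tan y = tan x"
  shows "\<exists>m. y = x + of_int m * of_real pi"
proof -
  have "sin (y - x) = 0"
    using assms by (simp add: sin_diff tan_def cover_space_def field_simps)
  then obtain n :: int where "y - x = of_real (of_int n * pi)" unfolding sin_eq_0 by (auto simp: ac_simps)
  then show ?thesis by (intro exI[of _ n]) (simp add: algebra_simps)
qed

lemma cover_fibre:
  assumes "x \<in> cover_space" "y \<in> cover_space" "cover y = cover x"
  obtains \<epsilon> m where "\<epsilon> \<in> {1, -1}" "y = deck \<epsilon> m x"
proof -
  have "tan y = tan x \<or> tan y = tan (- x)"
    using assms(3) by (simp add: cover_def power2_eq_iff)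
  then show ?thesis
  proof
    assume "tan y = tan x"
    from tan_eq_imp_shift[OF assms(1,2) this] obtain m where "y = x + of_int m * of_real pi" by blast
    then show ?thesis using that[of 1 m] by (simp add: deck_def)
  next
    assume "tan y = tan (- x)"
    moreover have "- x \<in> cover_space" using assms(1) by (simp add: cover_space_deck)
    ultimately obtain m where "y = - x + of_int m * of_real pi" using tan_eq_imp_shift assms(2) by blast
    then show ?thesis using that[of "-1" m] by (simp add: deck_def)
  qed
qed

text \<open>The tangent as a function of the exponential. It reduces the inversion of the covering
  to a square root and a logarithm.\<close>

lemma tan_of_exp:
  assumes "1 - \<i> * s \<noteq> 0" "exp (2 * \<i> * w) = (1 + \<i> * s) / (1 - \<i> * s)"
  shows "tan w = s"
proof -
  define E where "E = exp (\<i> * w)"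
  have E0: "E \<noteq> 0" by (simp add: E_def)
  have E2: "exp (2 * \<i> * w) = E * E"
    unfolding E_def exp_add[symmetric] by (rule arg_cong[where f = exp]) (simp add: mult.assoc)
  have Em: "exp (- (\<i> * w)) = inverse E" by (simp add: E_def exp_minus)
  have eq: "E * E * (1 - \<i> * s) = 1 + \<i> * s"
    using assms(1) unfolding assms(2)[unfolded E2] by simp
  have s: "sin w = (E - inverse E) / (2 * \<i>)" and c: "cos w = (E + inverse E) / 2"
    unfolding sin_exp_eq cos_exp_eq by (simp_all add: E_def exp_minus)
  have "E * cos w * (1 - \<i> * s) = 1"
  proof -
    have "2 * (E * cos w * (1 - \<i> * s)) = E * E * (1 - \<i> * s) + (1 - \<i> * s)"
      unfolding c using E0 by (simp add: field_simps)
    then show ?thesis unfolding eq by simp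
  qed
  then have cnz: "cos w \<noteq> 0" by auto
  have "2 * \<i> * E * (sin w - s * cos w) = E * E * (1 - \<i> * s) - (1 + \<i> * s)"
    unfolding s c using E0 by (simp add: field_simps)
  then have "sin w - s * cos w = 0" using E0 eq by simp
  then show ?thesis using cnz by (simp add: tan_def field_simps)
qed

lemma exp_eq_tan:
  assumes "cos x \<noteq> 0"
  shows "exp (2 * \<i> * x) * (1 - \<i> * tan x) = 1 + \<i> * tan x"
proof -
  define E where "E = exp (\<i> * x)"
  have E0: "E \<noteq> 0" by (simp add: E_def)
  have E2: "exp (2 * \<i> * x) = E * E"
    unfolding E_def exp_add[symmetric] by (rule arg_cong[where f = exp]) (simp add: mult.assoc)
  have s: "sin x = (E - inverse E) / (2 * \<i>)" and c: "cos x = (E + inverse E) / 2"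
    unfolding sin_exp_eq cos_exp_eq by (simp_all add: E_def exp_minus)
  have "E * E * (cos x - \<i> * sin x) = cos x + \<i> * sin x"
    unfolding s c using E0 by (simp add: field_simps)
  then show ?thesis unfolding E2 using assms by (simp add: tan_def field_simps)
qed

lemma in_cover_space_iff: "x \<in> cover_space \<longleftrightarrow> cover x \<noteq> 0"
  by (auto simp: cover_space_def cover_def tan_def)

text \<open>On a disc that avoids \<open>0\<close> and \<open>1\<close> there are holomorphic branches of \<open>s = \<surd>(-z)\<close> and of
  \<open>log ((1 + i s) / (1 - i s)) = 2 i arctan s\<close>; the sign and the multiple of \<open>\<pi>\<close> are adjusted at
  the centre.\<close>

lemma cover_section:
  assumes "0 < r" "ball b r \<subseteq> - {0, 1}" "x \<in> cover_space" "cover x = b"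
  obtains h where "h holomorphic_on ball b r" "h b = x"
    "\<And>z. z \<in> ball b r \<Longrightarrow> h z \<in> cover_space" "\<And>z. z \<in> ball b r \<Longrightarrow> cover (h z) = z"
proof -
  have contr: "contractible (ball b r)" by (rule convex_imp_contractible) simp
  have bb: "b \<in> ball b r" using assms(1) by simp
  have z01: "z \<noteq> 0" "z \<noteq> 1" if "z \<in> ball b r" for z using assms(2) that by blast+
  have "(\<lambda>z. - z) holomorphic_on ball b r" by (intro holomorphic_intros)
  moreover have "- z \<noteq> 0" if "z \<in> ball b r" for z using z01[OF that] by simp
  ultimately obtain s0 where s0: "s0 holomorphic_on ball b r" "\<And>z. z \<in> ball b r \<Longrightarrow> - z = (s0 z)\<^sup>2"
    using contractible_imp_holomorphic_sqrt[OF _ contr] by metis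
  have "(s0 b)\<^sup>2 = (tan x)\<^sup>2" using s0(2)[OF bb, symmetric] unfolding assms(4)[symmetric] by (simp add: cover_def)
  then have sgn: "s0 b = tan x \<or> - s0 b = tan x" by (auto simp: power2_eq_iff)
  define s where "s z = (if s0 b = tan x then s0 z else - s0 z)" for z
  have s: "s holomorphic_on ball b r" "\<And>z. z \<in> ball b r \<Longrightarrow> (s z)\<^sup>2 = - z" "s b = tan x"
  proof -
    have "s = s0 \<or> s = (\<lambda>z. - s0 z)" by (auto simp: s_def fun_eq_iff)
    then show "s holomorphic_on ball b r" using s0(1) by (auto intro: holomorphic_on_minus)
    show "(s z)\<^sup>2 = - z" if "z \<in> ball b r" for z using s0(2)[OF that] by (simp add: s_def)
    show "s b = tan x" using sgn by (auto simp: s_def)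
  qed
  have nz: "1 - \<i> * s z \<noteq> 0" "1 + \<i> * s z \<noteq> 0" if "z \<in> ball b r" for z
  proof -
    have "(1 - \<i> * s z) * (1 + \<i> * s z) = 1 + (s z)\<^sup>2" by (simp add: algebra_simps power2_eq_square)
    also have "\<dots> \<noteq> 0" using s(2)[OF that] z01[OF that] by simp
    finally show "1 - \<i> * s z \<noteq> 0" "1 + \<i> * s z \<noteq> 0" by auto
  qed
  have hol: "(\<lambda>z. (1 + \<i> * s z) / (1 - \<i> * s z)) holomorphic_on ball b r"
    by (intro holomorphic_on_divide holomorphic_on_add holomorphic_on_diff holomorphic_on_mult holomorphic_on_const s(1) nz(1))
  have "(1 + \<i> * s z) / (1 - \<i> * s z) \<noteq> 0" if "z \<in> ball b r" for z using nz[OF that] by simp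
  from contractible_imp_holomorphic_log[OF hol contr this]
  obtain L where L: "L holomorphic_on ball b r" "\<And>z. z \<in> ball b r \<Longrightarrow> (1 + \<i> * s z) / (1 - \<i> * s z) = exp (L z)"
    by blast
  define h0 where "h0 z = L z / (2 * \<i>)" for z
  have h0: "h0 holomorphic_on ball b r" unfolding h0_def by (intro holomorphic_intros L) auto
  have tan: "tan (h0 z) = s z" if "z \<in> ball b r" for z
    by (rule tan_of_exp[OF nz(1)[OF that]]) (use L(2)[OF that] in \<open>simp add: h0_def\<close>)
  have cov: "cover (h0 z) = z" if "z \<in> ball b r" for z
    using tan[OF that] s(2)[OF that] by (simp add: cover_def)
  have dom: "h0 z \<in> cover_space" if "z \<in> ball b r" for z
    using cov[OF that] z01[OF that] by (simp add: in_cover_space_iff)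
  obtain m where m: "x = h0 b + of_int m * of_real pi"
    using tan_eq_imp_shift[OF dom[OF bb] assms(3)] tan[OF bb] s(3) by auto
  show ?thesis
  proof (rule that[of "\<lambda>z. deck 1 m (h0 z)"])
    show "(\<lambda>z. deck 1 m (h0 z)) holomorphic_on ball b r"
      unfolding deck_def by (intro holomorphic_intros h0)
  qed (use m cov dom deck_shift in \<open>auto simp: deck_def\<close>)
qed

lemma holomorphic_imp_isCont:
  "f holomorphic_on S \<Longrightarrow> open S \<Longrightarrow> z \<in> S \<Longrightarrow> isCont f z"
  using holomorphic_on_imp_differentiable_at field_differentiable_imp_continuous_at by blast

lemma isCont_eventually_nhds:
  assumes "isCont f a" "\<forall>\<^sub>F y in nhds (f a). P y"
  shows "\<forall>\<^sub>F x in nhds a. P (f x)"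
proof -
  have "filterlim f (nhds (f a)) (nhds a)"
    using assms(1) by (simp add: isCont_def tendsto_at_iff_tendsto_nhds)
  then show ?thesis by (rule eventually_compose_filterlim[OF assms(2)])
qed

text \<open>A section is injective, hence open, so its values fill a neighbourhood of \<open>x\<close>.\<close>

lemma cover_section_left_inverse:
  assumes "0 < r" "h holomorphic_on ball b r" "h b = x" "\<And>z. z \<in> ball b r \<Longrightarrow> cover (h z) = z"
  shows "\<forall>\<^sub>F x' in nhds x. h (cover x') = x'"
proof -
  have inj: "inj_on h S" if "S \<subseteq> ball b r" for S
    by (rule inj_on_inverseI[of _ cover]) (use assms(4) that in auto)
  have "filtermap h (nhds b) = nhds (h b)"
  proof (rule filtermap_nhds_open_map'[of _ _ "ball b r"])
    show "isCont h b"
      by (rule holomorphic_imp_isCont[OF assms(2) open_ball]) (use assms(1) in simp)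
    show "open (h ` S)" if "open S" "S \<subseteq> ball b r" for S
      using open_mapping_thm3[OF _ \<open>open S\<close> inj[OF that(2)]] assms(2) that(2) holomorphic_on_subset by blast
  qed (use assms(1) in auto)
  moreover have "\<forall>\<^sub>F z in nhds b. z \<in> ball b r"
    using assms(1) by (intro eventually_nhds_in_open) auto
  then have "\<forall>\<^sub>F z in nhds b. h (cover (h z)) = h z"
    by eventually_elim (simp only: assms(4))
  then have "\<forall>\<^sub>F x' in filtermap h (nhds b). h (cover x') = x'"
    unfolding eventually_filtermap .
  ultimately show ?thesis using assms(3) by simp
qed

lemma cover_nbhd:
  assumes "x \<in> cover_space"
  obtains r where "0 < r" "ball (cover x) r \<subseteq> - {0, 1}"
proof -
  have "open (- {0, 1 :: complex})" by (simp add: open_Compl)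
  then show ?thesis using that cover_not_0_1[OF assms] openE[of "- {0, 1 :: complex}" "cover x"] by auto
qed

lemma isCont_cover: "x \<in> cover_space \<Longrightarrow> isCont cover x"
  using has_field_derivative_cover DERIV_isCont by blast

text \<open>The covering is a local homeomorphism: germs at \<open>cover x\<close> are the same as germs at \<open>x\<close>.\<close>

lemma eventually_nhds_cover:
  assumes x: "x \<in> cover_space"
  shows "(\<forall>\<^sub>F z in nhds (cover x). P z) \<longleftrightarrow> (\<forall>\<^sub>F x' in nhds x. P (cover x'))"
proof
  assume "\<forall>\<^sub>F z in nhds (cover x). P z"
  then show "\<forall>\<^sub>F x' in nhds x. P (cover x')"
    by (rule isCont_eventually_nhds[OF isCont_cover[OF x]])
next
  assume ev: "\<forall>\<^sub>F x' in nhds x. P (cover x')"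
  obtain r where r: "0 < r" "ball (cover x) r \<subseteq> - {0, 1}" using cover_nbhd[OF x] .
  obtain h where h: "h holomorphic_on ball (cover x) r" "h (cover x) = x"
    "\<And>z. z \<in> ball (cover x) r \<Longrightarrow> cover (h z) = z"
    using cover_section[OF r x refl] by metis
  have "isCont h (cover x)"
    by (rule holomorphic_imp_isCont[OF h(1) open_ball]) (use r(1) in simp)
  from isCont_eventually_nhds[OF this, of "\<lambda>x. P (cover x)"]
  have "\<forall>\<^sub>F z in nhds (cover x). P (cover (h z))"
    using ev h(2) by simp
  moreover have "\<forall>\<^sub>F z in nhds (cover x). z \<in> ball (cover x) r"
    using r(1) by (intro eventually_nhds_in_open) auto
  ultimately show "\<forall>\<^sub>F z in nhds (cover x). P z"
    by eventually_elim (use h(3) in auto)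
qed

lemma germ_exists:
  assumes "U holomorphic_on cover_space" "x \<in> cover_space"
  obtains f where "f analytic_on {cover x}" "\<forall>\<^sub>F x' in nhds x. f (cover x') = U x'"
proof -
  obtain r where r: "0 < r" "ball (cover x) r \<subseteq> - {0, 1}" using cover_nbhd[OF assms(2)] .
  obtain h where h: "h holomorphic_on ball (cover x) r" "h (cover x) = x"
    "\<And>z. z \<in> ball (cover x) r \<Longrightarrow> h z \<in> cover_space" "\<And>z. z \<in> ball (cover x) r \<Longrightarrow> cover (h z) = z"
    using cover_section[OF r assms(2) refl] by metis
  have "(U \<circ> h) holomorphic_on ball (cover x) r"
    by (rule holomorphic_on_compose_gen[OF h(1) assms(1)]) (use h(3) in auto)
  then have "(\<lambda>z. U (h z)) analytic_on {cover x}"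
    unfolding analytic_at o_def using r(1) by (intro exI[of _ "ball (cover x) r"]) auto
  moreover have "\<forall>\<^sub>F x' in nhds x. h (cover x') = x'"
    by (rule cover_section_left_inverse[OF r(1) h(1,2)]) (rule h(4))
  then have "\<forall>\<^sub>F x' in nhds x. U (h (cover x')) = U x'"
    by eventually_elim simp
  ultimately show ?thesis by (rule that)
qed

text \<open>Paths are lifted in two steps, through the square and then through the exponential map,
  following the same formula as for sections.\<close>

lemma path_lift:
  assumes "path g" "path_image g \<subseteq> - {0, 1}" "pathstart g = cover x" "x \<in> cover_space"
  obtains \<gamma> where "path \<gamma>" "path_image \<gamma> \<subseteq> cover_space" "\<gamma> 0 = x" "\<And>t. t \<in> {0..1} \<Longrightarrow> cover (\<gamma> t) = g t"
proof -
  have g01: "g t \<noteq> 0 \<and> g t \<noteq> 1" if "t \<in> {0..1}" for t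
  proof -
    have "g t \<in> path_image g" using that unfolding path_image_def by blast
    then show ?thesis using assms(2) by auto
  qed
  have "path (\<lambda>t. - g t)" using assms(1) unfolding path_def by (intro continuous_intros)
  moreover have "path_image (\<lambda>t. - g t) \<subseteq> - {0}" using g01 by (auto simp: path_image_def)
  moreover have "pathstart (\<lambda>t. - g t) = (tan x)\<^sup>2" using assms(3) by (simp add: pathstart_def cover_def)
  moreover have "tan x \<in> - {0}" using cover_space_tan(1)[OF assms(4)] by simp
  ultimately obtain s where s: "path s" "path_image s \<subseteq> - {0}" "pathstart s = tan x" "\<And>t. t \<in> {0..1} \<Longrightarrow> (s t)\<^sup>2 = - g t"
    using covering_space_lift_path_strong[OF covering_space_square_punctured_plane, of "tan x" "\<lambda>t. - g t"] by metis
  have nz: "1 - \<i> * s t \<noteq> 0" "1 + \<i> * s t \<noteq> 0" if "t \<in> {0..1}" for t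
  proof -
    have "(1 - \<i> * s t) * (1 + \<i> * s t) = 1 + (s t)\<^sup>2" by (simp add: algebra_simps power2_eq_square)
    also have "\<dots> \<noteq> 0" using s(4)[OF that] g01[OF that] by auto
    finally show "1 - \<i> * s t \<noteq> 0" "1 + \<i> * s t \<noteq> 0" by auto
  qed
  define q where "q t = (1 + \<i> * s t) / (1 - \<i> * s t)" for t
  have "path q" using s(1) nz(1) unfolding path_def q_def by (intro continuous_intros) auto
  moreover have "path_image q \<subseteq> - {0}" using nz by (auto simp: path_image_def q_def)
  moreover have "pathstart q = exp (2 * \<i> * x)"
    using s(3) nz(1)[of 0] exp_eq_tan[OF cover_space_tan(3)[OF assms(4)]]
    by (simp add: pathstart_def q_def field_simps)
  ultimately obtain L where L: "path L" "pathstart L = 2 * \<i> * x" "\<And>t. t \<in> {0..1} \<Longrightarrow> exp (L t) = q t"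
    using covering_space_lift_path_strong[OF covering_space_exp_punctured_plane, of "2 * \<i> * x" q] by (metis UNIV_I)
  define \<gamma> where "\<gamma> t = L t / (2 * \<i>)" for t
  have "tan (\<gamma> t) = s t" if "t \<in> {0..1}" for t
    by (rule tan_of_exp[OF nz(1)[OF that]]) (use L(3)[OF that] in \<open>simp add: \<gamma>_def q_def\<close>)
  then have cov: "cover (\<gamma> t) = g t" if "t \<in> {0..1}" for t
    using s(4)[OF that] that by (simp add: cover_def)
  show ?thesis
  proof (rule that[of \<gamma>])
    show "path \<gamma>" using L(1) unfolding path_def \<gamma>_def by (intro continuous_intros) auto
    show "path_image \<gamma> \<subseteq> cover_space" using cov g01 by (auto simp: path_image_def in_cover_space_iff)
    show "\<gamma> 0 = x" using L(2) by (simp add: \<gamma>_def pathstart_def)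
  qed (rule cov)
qed

section \<open>Analytic continuation along lifted paths\<close>

text \<open>A function on the covering surface is its own analytic continuation: the germs of \<open>U\<close>
  along the lifted path, transported to the base, form a continuation along the path.\<close>

lemma continuation_of_lift:
  assumes U: "U holomorphic_on cover_space" and \<gamma>: "path \<gamma>" "path_image \<gamma> \<subseteq> cover_space"
    and g: "\<And>t. t \<in> {0..1} \<Longrightarrow> cover (\<gamma> t) = g t"
    and y: "\<forall>\<^sub>F x in nhds (\<gamma> 0). y (cover x) = U x" and w: "\<forall>\<^sub>F x in nhds (\<gamma> 1). w (cover x) = U x"
  shows "analytic_continuation_along g y w"
proof -
  have dom: "\<gamma> t \<in> cover_space" if "t \<in> {0..1}" for t
    using \<gamma>(2) that by (auto simp: path_image_def)
  have "\<exists>f. f analytic_on {g t} \<and> (\<forall>\<^sub>F x in nhds (\<gamma> t). f (cover x) = U x)" if "t \<in> {0..1}" for t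
    using germ_exists[OF U dom[OF that]] g[OF that] by metis
  then obtain F where F: "\<And>t. t \<in> {0..1} \<Longrightarrow> F t analytic_on {g t}"
    "\<And>t. t \<in> {0..1} \<Longrightarrow> \<forall>\<^sub>F x in nhds (\<gamma> t). F t (cover x) = U x" by metis
  have agree: "\<forall>\<^sub>F z in nhds (g t). f z = f' z"
    if "t \<in> {0..1}" "\<forall>\<^sub>F x in nhds (\<gamma> t). f (cover x) = U x" "\<forall>\<^sub>F x in nhds (\<gamma> t). f' (cover x) = U x" for t f f'
    unfolding g[OF that(1), symmetric] eventually_nhds_cover[OF dom[OF that(1)]]
    using that(2,3) by eventually_elim simp
  show ?thesis
    unfolding analytic_continuation_along_def
  proof (intro exI[of _ F] conjI ballI F(1))
    fix u :: real assume u: "u \<in> {0..1}"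
    obtain N where N: "open N" "\<gamma> u \<in> N" "\<And>x. x \<in> N \<Longrightarrow> F u (cover x) = U x"
      using F(2)[OF u] unfolding eventually_nhds by blast
    have "continuous (at u within {0..1}) \<gamma>"
      using \<gamma>(1) u unfolding path_def by (simp add: continuous_on_eq_continuous_within)
    then have "\<forall>\<^sub>F s in at u within {0..1}. \<gamma> s \<in> N"
      unfolding continuous_within using N(1,2) topological_tendstoD by blast
    moreover have "\<forall>\<^sub>F s in at u within {0..1}. s \<in> {0..1}"
      by (simp add: eventually_at_filter)
    ultimately show "\<forall>\<^sub>F s in at u within {0..1}. \<forall>\<^sub>F z in nhds (g s). F s z = F u z"
    proof eventually_elim
      case (elim s)
      have "\<forall>\<^sub>F x in nhds (\<gamma> s). F u (cover x) = U x"
        using eventually_nhds_in_open[OF N(1) elim(1)] by eventually_elim (rule N(3))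
      then show ?case using agree[OF elim(2) F(2)[OF elim(2)]] by blast
    qed
  next
    show "\<forall>\<^sub>F z in nhds (pathstart g). F 0 z = y z"
      unfolding pathstart_def by (rule agree) (use F(2)[of 0] y in auto)
    show "\<forall>\<^sub>F z in nhds (pathfinish g). F 1 z = w z"
      unfolding pathfinish_def by (rule agree) (use F(2)[of 1] w in auto)
  qed
qed

lemma eventually_eq_imp_eq_on_connected:
  fixes f g :: "complex \<Rightarrow> complex"
  assumes "f holomorphic_on S" "g holomorphic_on S" "open S" "connected S" "a \<in> S" "\<forall>\<^sub>F x in nhds a. f x = g x" "x \<in> S"
  shows "f x = g x"
proof -
  obtain N where N: "open N" "a \<in> N" "\<And>x. x \<in> N \<Longrightarrow> f x = g x"
    using assms(6) unfolding eventually_nhds by blast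
  show ?thesis
    by (rule analytic_continuation_open[of "N \<inter> S" S f g]) (use N assms in auto)
qed

text \<open>Uniqueness of the continuation. Whether the germ at time \<open>u\<close> is the germ of \<open>U\<close> at \<open>\<gamma> u\<close>
  is a locally constant property of \<open>u\<close>, by the identity theorem on a small disc around \<open>\<gamma> u\<close>.\<close>

lemma continuation_lifts:
  assumes U: "U holomorphic_on cover_space" and \<gamma>: "path \<gamma>" "path_image \<gamma> \<subseteq> cover_space"
    and g: "\<And>t. t \<in> {0..1} \<Longrightarrow> cover (\<gamma> t) = g t"
    and y: "\<forall>\<^sub>F x in nhds (\<gamma> 0). y (cover x) = U x" and cont: "analytic_continuation_along g y w"
  shows "\<forall>\<^sub>F x in nhds (\<gamma> 1). w (cover x) = U x"
proof -
  have dom: "\<gamma> t \<in> cover_space" if "t \<in> {0..1}" for t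
    using \<gamma>(2) that by (auto simp: path_image_def)
  obtain F where F: "\<And>u. u \<in> {0..1} \<Longrightarrow> F u analytic_on {g u}"
    "\<And>u. u \<in> {0..1} \<Longrightarrow> \<forall>\<^sub>F s in at u within {0..1}. \<forall>\<^sub>F z in nhds (g s). F s z = F u z"
    "\<forall>\<^sub>F z in nhds (pathstart g). F 0 z = y z" "\<forall>\<^sub>F z in nhds (pathfinish g). F 1 z = w z"
    using cont unfolding analytic_continuation_along_def by blast
  define P where "P u \<longleftrightarrow> (\<forall>\<^sub>F x in nhds (\<gamma> u). F u (cover x) = U x)" for u
  have lift: "\<forall>\<^sub>F x in nhds (\<gamma> t). f (cover x) = f' (cover x)"
    if "t \<in> {0..1}" "\<forall>\<^sub>F z in nhds (g t). f z = f' z" for t f f'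
    using that(2) unfolding g[OF that(1), symmetric] eventually_nhds_cover[OF dom[OF that(1)]] .
  have "P 1"
  proof (rule connected_induction_simple[of "{0..1 :: real}" 0 1 P])
    have "\<forall>\<^sub>F x in nhds (\<gamma> 0). F 0 (cover x) = y (cover x)"
      by (rule lift) (use F(3) in \<open>auto simp: pathstart_def\<close>)
    then show "P 0" unfolding P_def using y by eventually_elim simp
  next
    fix u :: real assume u: "u \<in> {0..1}"
    obtain e where e: "e > 0" "F u holomorphic_on ball (g u) e"
      using F(1)[OF u] unfolding analytic_on_def by blast
    have "open (cover -` ball (g u) e \<inter> cover_space)"
      using continuous_open_preimage[OF holomorphic_on_imp_continuous_on[OF cover_holomorphic] open_cover_space open_ball, of "g u" e]
      by (simp add: Int_commute)
    moreover have "\<gamma> u \<in> cover -` ball (g u) e \<inter> cover_space" using g[OF u] dom[OF u] e by simp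
    ultimately obtain d where d: "d > 0" "ball (\<gamma> u) d \<subseteq> cover -` ball (g u) e \<inter> cover_space" by (meson openE)
    let ?N = "ball (\<gamma> u) d"
    have "(F u \<circ> cover) holomorphic_on ?N"
      by (rule holomorphic_on_compose_gen[OF _ e(2)]) (use d cover_holomorphic holomorphic_on_subset in auto)
    then have holF: "(\<lambda>x. F u (cover x)) holomorphic_on ?N" by (simp add: o_def)
    have holU: "U holomorphic_on ?N" by (rule holomorphic_on_subset[OF U]) (use d in auto)
    have "continuous (at u within {0..1}) \<gamma>"
      using \<gamma>(1) u unfolding path_def by (simp add: continuous_on_eq_continuous_within)
    then have "\<forall>\<^sub>F s in at u within {0..1}. \<gamma> s \<in> ?N"
      unfolding continuous_within using d(1) topological_tendstoD[OF _ open_ball] by (metis centre_in_ball)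
    with F(2)[OF u] have "\<forall>\<^sub>F s in at u within {0..1}. \<gamma> s \<in> ?N \<and> (\<forall>\<^sub>F z in nhds (g s). F s z = F u z)"
      by eventually_elim simp
    then obtain T where T: "open T" "u \<in> T"
      "\<And>s. s \<in> T \<Longrightarrow> s \<noteq> u \<Longrightarrow> s \<in> {0..1} \<Longrightarrow> \<gamma> s \<in> ?N \<and> (\<forall>\<^sub>F z in nhds (g s). F s z = F u z)"
      unfolding eventually_at_topological by blast
    have T': "\<gamma> s \<in> ?N \<and> (\<forall>\<^sub>F z in nhds (g s). F s z = F u z)" if "s \<in> T" "s \<in> {0..1}" for s
      using T(3)[OF that(1) _ that(2)] d(1) by (cases "s = u") auto
    have iff: "P s \<longleftrightarrow> (\<forall>x\<in>?N. F u (cover x) = U x)" if s: "s \<in> T \<inter> {0..1}" for s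
    proof -
      have "\<forall>\<^sub>F x in nhds (\<gamma> s). F s (cover x) = F u (cover x)"
        by (rule lift) (use T' s in auto)
      then have "P s \<longleftrightarrow> (\<forall>\<^sub>F x in nhds (\<gamma> s). F u (cover x) = U x)"
        unfolding P_def by (intro eventually_cong) (auto elim!: eventually_mono)
      also have "\<dots> \<longleftrightarrow> (\<forall>x\<in>?N. F u (cover x) = U x)"
      proof
        assume "\<forall>\<^sub>F x in nhds (\<gamma> s). F u (cover x) = U x"
        then show "\<forall>x\<in>?N. F u (cover x) = U x"
          using eventually_eq_imp_eq_on_connected[OF holF holU open_ball connected_ball] T' s by blast
      next
        assume *: "\<forall>x\<in>?N. F u (cover x) = U x"
        show "\<forall>\<^sub>F x in nhds (\<gamma> s). F u (cover x) = U x"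
        proof -
          have "\<forall>\<^sub>F x in nhds (\<gamma> s). x \<in> ?N"
            using T' s by (intro eventually_nhds_in_open) auto
          then show ?thesis by eventually_elim (use * in blast)
        qed
      qed
      finally show ?thesis .
    qed
    show "\<exists>T. openin (top_of_set {0..1}) T \<and> u \<in> T \<and> (\<forall>s\<in>T. \<forall>s'\<in>T. P s \<longrightarrow> P s')"
    proof (intro exI[of _ "T \<inter> {0..1}"] conjI ballI impI)
      show "openin (top_of_set {0..1}) (T \<inter> {0..1})" using T(1) by (metis Int_commute openin_open_Int)
      show "P s'" if "s \<in> T \<inter> {0..1}" "s' \<in> T \<inter> {0..1}" "P s" for s s'
        using iff that by blast
    qed (use T u in auto)
  qed auto
  moreover have "\<forall>\<^sub>F x in nhds (\<gamma> 1). F 1 (cover x) = w (cover x)"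
    by (rule lift) (use F(4) in \<open>auto simp: pathfinish_def\<close>)
  ultimately show ?thesis unfolding P_def by eventually_elim simp
qed

section \<open>Monodromy matrices\<close>

lemma path_connected_cover_space: "path_connected cover_space"
proof -
  have "cover_space = - {x. sin (2 * x) = 0}"
    by (auto simp: cover_space_def sin_double)
  moreover have "countable {x :: complex. sin (2 * x) = 0}"
  proof (rule countable_subset)
    show "{x :: complex. sin (2 * x) = 0} \<subseteq> (\<lambda>n :: int. of_real (of_int n * pi) / 2) ` UNIV"
    proof
      fix x :: complex assume "x \<in> {x. sin (2 * x) = 0}"
      then obtain n :: int where "2 * x = of_real (of_int n * pi)" unfolding mem_Collect_eq sin_eq_0 by blast
      then have "x = of_real (of_int n * pi) / 2" by (simp add: field_simps)
      then show "x \<in> (\<lambda>n :: int. of_real (of_int n * pi) / 2) ` UNIV" by blast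
    qed
  qed simp
  ultimately show ?thesis
    using path_connected_complement_countable[of "{x :: complex. sin (2 * x) = 0}"] by simp
qed

lemma cover_surj:
  assumes "b \<noteq> 0" "b \<noteq> 1"
  obtains x where "x \<in> cover_space" "cover x = b"
proof -
  have "(csqrt (- b))\<^sup>2 \<noteq> - 1" using assms(2) by simp
  then have "tan (Arctan (csqrt (- b))) = csqrt (- b)" by (rule tan_Arctan)
  then have "cover (Arctan (csqrt (- b))) = b" by (simp add: cover_def)
  then show ?thesis using that assms(1) by (simp add: in_cover_space_iff)
qed

text \<open>Since \<open>cover \<circ> h\<close> is the identity, composition with \<open>h\<close> turns \<open>cover_deriv\<close> into the
  ordinary derivative.\<close>

lemma lifted_solution_section:
  assumes U: "lifted_solution A B C U" and S: "open S" and h: "h holomorphic_on S"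
    "\<And>z. z \<in> S \<Longrightarrow> h z \<in> cover_space" "\<And>z. z \<in> S \<Longrightarrow> cover (h z) = z"
  shows "hypergeometric_solution A B C S (\<lambda>z. U (h z))"
proof -
  have hol: "(\<lambda>z. F (h z)) holomorphic_on S" if "F holomorphic_on cover_space" for F
    using holomorphic_on_compose_gen[OF h(1) that] h(2) by (simp add: o_def image_subset_iff)
  have d: "deriv (\<lambda>z. F (h z)) z = cover_deriv F (h z)" if "F holomorphic_on cover_space" "z \<in> S" for F z
  proof -
    have dh: "(h has_field_derivative deriv h z) (at z)" using holomorphic_derivI[OF h(1) S that(2)] .
    have "((\<lambda>z. cover (h z)) has_field_derivative deriv cover (h z) * deriv h z) (at z)"
      by (rule DERIV_chain2[OF holomorphic_derivI[OF cover_holomorphic open_cover_space h(2)[OF that(2)]] dh])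
    then have "deriv (\<lambda>z. cover (h z)) z = deriv cover (h z) * deriv h z" by (rule DERIV_imp_deriv)
    moreover have "deriv (\<lambda>z. cover (h z)) z = deriv (\<lambda>z. z) z"
      by (rule deriv_cong_open[OF S that(2) h(3)])
    ultimately have 1: "deriv cover (h z) * deriv h z = 1" by simp
    have "((\<lambda>z. F (h z)) has_field_derivative cover_deriv F (h z) * deriv cover (h z) * deriv h z) (at z)"
      by (rule DERIV_chain2[OF has_field_derivative_cover_deriv[OF that(1) h(2)[OF that(2)]] dh])
    then show ?thesis using 1 by (simp add: DERIV_imp_deriv mult.assoc)
  qed
  have hU: "U holomorphic_on cover_space" using U unfolding lifted_solution_def by blast
  have d2: "deriv (deriv (\<lambda>z. U (h z))) z = cover_deriv (cover_deriv U) (h z)" if "z \<in> S" for z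
  proof -
    have "deriv (deriv (\<lambda>z. U (h z))) z = deriv (\<lambda>z. cover_deriv U (h z)) z"
      by (rule deriv_cong_open[OF S that d[OF hU]])
    also have "\<dots> = cover_deriv (cover_deriv U) (h z)"
      by (rule d[OF cover_deriv_holomorphic[OF hU] that])
    finally show ?thesis .
  qed
  show ?thesis
    unfolding hypergeometric_solution_def
  proof (intro conjI ballI hol[OF hU])
    fix z assume z: "z \<in> S"
    have "cover (h z) * (1 - cover (h z)) * cover_deriv (cover_deriv U) (h z)
        + (C - (A + B + 1) * cover (h z)) * cover_deriv U (h z) - A * B * U (h z) = 0"
      using U h(2)[OF z] unfolding lifted_solution_def by blast
    then show "z * (1 - z) * deriv (deriv (\<lambda>z. U (h z))) z
        + (C - (A + B + 1) * z) * deriv (\<lambda>z. U (h z)) z - A * B * U (h z) = 0"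
      unfolding d2[OF z] d[OF hU z] h(3)[OF z] .
  qed
qed

lemma equivariant_pair_deck:
  assumes pair: "equivariant_pair \<eta> c A B C U V" and x: "x \<in> cover_space"
  shows "U (deck 1 m x) = U x" "V (deck 1 m x) = V x + of_int m * c * U x"
    "U (deck (-1) m x) = \<eta> * U x" "V (deck (-1) m x) = \<eta> * (- V x + of_int m * c * U x)"
proof -
  have pi: "U (x + of_real pi) = U x" "V (x + of_real pi) = V x + c * U x" if "x \<in> cover_space" for x
    using pair that unfolding equivariant_pair_def by auto
  have neg: "U (- x) = \<eta> * U x" "V (- x) = - \<eta> * V x"
    using pair x unfolding equivariant_pair_def by auto
  have shift: "U (deck 1 m x) = U x \<and> V (deck 1 m x) = V x + of_int m * c * U x" if x: "x \<in> cover_space" for m x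
  proof (induction m rule: int_induct[of _ 0])
    case base then show ?case by (simp add: deck_def)
  next
    case (step1 i)
    have "deck 1 (i + 1) x = deck 1 i x + of_real pi" by (simp add: deck_def algebra_simps)
    then show ?case using step1 pi[of "deck 1 i x"] x by (simp add: deck_shift algebra_simps)
  next
    case (step2 i)
    have "deck 1 i x = deck 1 (i - 1) x + of_real pi" by (simp add: deck_def algebra_simps)
    then show ?case using step2 pi[of "deck 1 (i - 1) x"] x by (simp add: deck_shift algebra_simps)
  qed
  then show "U (deck 1 m x) = U x" "V (deck 1 m x) = V x + of_int m * c * U x" using x by blast+
  have *: "deck (-1) m x = deck 1 m (- x)" by (simp add: deck_def)
  have mx: "- x \<in> cover_space" using x by (simp only: cover_space_deck)
  note shift' = conjunct1[OF shift[OF mx, of m]] conjunct2[OF shift[OF mx, of m]]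
  show "U (deck (-1) m x) = \<eta> * U x"
    unfolding * shift' neg ..
  show "V (deck (-1) m x) = \<eta> * (- V x + of_int m * c * U x)"
    unfolding * shift' neg by (simp add: algebra_simps)
qed

text \<open>The action of \<open>x \<mapsto> \<epsilon> x + m \<pi>\<close> on the row vector \<open>(U, V)\<close>, by multiplication from the
  right. Composition of deck transformations reverses the order of the matrices.\<close>

definition deck_matrix :: "complex \<Rightarrow> complex \<Rightarrow> int \<Rightarrow> int \<Rightarrow> complex ^ 2 ^ 2" where
  "deck_matrix \<eta> c \<epsilon> m = (let \<kappa> = (if \<epsilon> = 1 then 1 else \<eta>) in
     vector [vector [\<kappa>, \<kappa> * of_int m * c], vector [0, \<kappa> * of_int \<epsilon>]])"

lemma deck_matrix_mult:
  assumes "\<eta> \<in> {1, -1}" "\<epsilon> \<in> {1, -1}" "\<epsilon>' \<in> {1, -1}"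
  shows "deck_matrix \<eta> c \<epsilon> m ** deck_matrix \<eta> c \<epsilon>' m' = deck_matrix \<eta> c (\<epsilon> * \<epsilon>') (m' + m * \<epsilon>')"
proof -
  have "(\<eta> = 1 \<or> \<eta> = -1) \<and> (\<epsilon> = 1 \<or> \<epsilon> = -1) \<and> (\<epsilon>' = 1 \<or> \<epsilon>' = -1)"
    using assms by blast
  then show ?thesis
    by (elim conjE disjE; simp only:)
      (simp_all add: deck_matrix_def matrix_matrix_mult_def vec_eq_iff forall_2 sum_2 algebra_simps)
qed

lemma deck_matrix_one: "deck_matrix \<eta> c 1 0 = mat 1"
  by (simp add: deck_matrix_def vec_eq_iff forall_2 mat_def)

abbreviation pair_vector :: "(complex \<Rightarrow> complex) \<Rightarrow> (complex \<Rightarrow> complex) \<Rightarrow> complex \<Rightarrow> complex ^ 2" where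
  "pair_vector U V x \<equiv> vector [U x, V x]"

lemma vector_matrix_mult_2: "(v v* (M :: complex ^ 2 ^ 2)) $ j = v $ 1 * M $ 1 $ j + v $ 2 * M $ 2 $ j"
  by (simp add: vector_matrix_mult_def sum_2)

lemma pair_vector_deck:
  assumes "equivariant_pair \<eta> c A B C U V" "x \<in> cover_space" "\<epsilon> \<in> {1, -1}"
  shows "pair_vector U V (deck \<epsilon> m x) = pair_vector U V x v* deck_matrix \<eta> c \<epsilon> m"
proof -
  note d = equivariant_pair_deck[OF assms(1,2), of m]
  consider "\<epsilon> = 1" | "\<epsilon> = -1" using assms(3) by blast
  then show ?thesis
  proof cases
    case 1
    show ?thesis unfolding 1 d
      by (simp add: vec_eq_iff forall_2 vector_matrix_mult_2 deck_matrix_def mult.commute)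
  next
    case 2
    show ?thesis unfolding 2 d
      by (simp add: vec_eq_iff forall_2 vector_matrix_mult_2 deck_matrix_def algebra_simps)
  qed
qed

text \<open>Evaluating a linear relation at \<open>x\<close> and at \<open>- x\<close> separates the two terms, because \<open>U\<close>
  and \<open>V\<close> have opposite parity.\<close>

lemma equivariant_pair_independent:
  assumes pair: "equivariant_pair \<eta> c A B C U V" and \<eta>: "\<eta> \<in> {1, -1}"
    and 0: "\<And>x. x \<in> cover_space \<Longrightarrow> U x * a + V x * b = 0"
  shows "a = 0 \<and> b = 0"
proof -
  have 1: "U x * a = 0 \<and> V x * b = 0" if "x \<in> cover_space" for x
  proof -
    have "- x \<in> cover_space" using that by (simp add: cover_space_deck)
    then have "\<eta> * (U x * a - V x * b) = 0"
      using 0[of "- x"] pair that unfolding equivariant_pair_def by (auto simp: algebra_simps)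
    then have "U x * a - V x * b = 0" using \<eta> by auto
    then show ?thesis using 0[OF that] by auto
  qed
  then show ?thesis using pair unfolding equivariant_pair_def by fastforce
qed

lemma pair_vector_matrix_eqI:
  fixes M M' :: "complex ^ 2 ^ 2"
  assumes pair: "equivariant_pair \<eta> c A B C U V" and \<eta>: "\<eta> \<in> {1, -1}"
    and eq: "\<And>x. x \<in> cover_space \<Longrightarrow> pair_vector U V x v* M = pair_vector U V x v* M'"
  shows "M = M'"
proof -
  have "M $ 1 $ j - M' $ 1 $ j = 0 \<and> M $ 2 $ j - M' $ 2 $ j = 0" for j
  proof (rule equivariant_pair_independent[OF pair \<eta>])
    fix x assume "x \<in> cover_space"
    from arg_cong[where f = "\<lambda>v. v $ j", OF eq[OF this]]
    show "U x * (M $ 1 $ j - M' $ 1 $ j) + V x * (M $ 2 $ j - M' $ 2 $ j) = 0"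
      by (simp add: vector_matrix_mult_2 algebra_simps)
  qed
  then show ?thesis by (simp add: vec_eq_iff forall_2)
qed

text \<open>The functions \<open>U, V\<close> descend to solutions on the disc and so have coordinates with
  respect to \<open>Y\<close>. The coordinate matrix \<open>P\<close> is injective since \<open>U\<close> and \<open>V\<close> are linearly
  independent.\<close>

lemma solution_basis_coordinates:
  assumes pair: "equivariant_pair \<eta> c A B C U V" and \<eta>: "\<eta> \<in> {1, -1}"
    and r: "0 < r" "ball b r \<subseteq> - {0, 1}" and Y: "solution_basis A B C (ball b r) Y"
    and x0: "x0 \<in> cover_space" "cover x0 = b"
  obtains P Q :: "complex ^ 2 ^ 2" where "P ** Q = mat 1" "Q ** P = mat 1"
    "\<forall>\<^sub>F x in nhds x0. (\<chi> i. Y i (cover x)) = pair_vector U V x v* Q"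
proof -
  obtain h where h: "h holomorphic_on ball b r" "h b = x0"
    "\<And>z. z \<in> ball b r \<Longrightarrow> h z \<in> cover_space" "\<And>z. z \<in> ball b r \<Longrightarrow> cover (h z) = z"
    using cover_section[OF r x0] by metis
  have lift: "lifted_solution A B C U" "lifted_solution A B C V"
    and hU: "U holomorphic_on cover_space" "V holomorphic_on cover_space"
    using pair unfolding equivariant_pair_def lifted_solution_def by auto
  have coord: "\<exists>d :: complex ^ 2. \<forall>z\<in>ball b r. F (h z) = (\<Sum>i\<in>UNIV. d $ i * Y i z)"
    if "lifted_solution A B C F" for F
    using Y lifted_solution_section[OF that open_ball h(1,3,4)] unfolding solution_basis_def by blast
  obtain dU dV :: "complex ^ 2" where d: "\<And>z. z \<in> ball b r \<Longrightarrow> U (h z) = (\<Sum>i\<in>UNIV. dU $ i * Y i z)"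
    "\<And>z. z \<in> ball b r \<Longrightarrow> V (h z) = (\<Sum>i\<in>UNIV. dV $ i * Y i z)"
    using coord[OF lift(1)] coord[OF lift(2)] by blast
  define P :: "complex ^ 2 ^ 2" where "P = (\<chi> i. vector [dU $ i, dV $ i])"
  have YP: "pair_vector U V (h z) = (\<chi> i. Y i z) v* P" if "z \<in> ball b r" for z
    using d[OF that] by (simp add: vec_eq_iff forall_2 vector_matrix_mult_2 P_def sum_2 mult.commute)
  have near: "\<forall>\<^sub>F x in nhds x0. h (cover x) = x"
    by (rule cover_section_left_inverse[OF r(1) h(1,2)]) (rule h(4))
  moreover have "\<forall>\<^sub>F x in nhds x0. cover x \<in> ball b r"
    by (rule isCont_eventually_nhds[OF isCont_cover[OF x0(1)]], rule eventually_nhds_in_open)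
      (use r(1) x0(2) in auto)
  ultimately have YP': "\<forall>\<^sub>F x in nhds x0. pair_vector U V x = (\<chi> i. Y i (cover x)) v* P"
    by eventually_elim (use YP in metis)
  \<comment> \<open>A vector in the kernel of \<open>P\<close> is a linear relation between \<open>U\<close> and \<open>V\<close>.\<close>
  have "v = 0" if "P *v v = 0" for v
  proof -
    have Pv: "dU $ i * v $ 1 + dV $ i * v $ 2 = 0" for i
      using arg_cong[where f = "\<lambda>w. w $ i", OF that] by (simp add: matrix_vector_mult_def sum_2 P_def)
    have ev: "\<forall>\<^sub>F x in nhds x0. U x * v $ 1 + V x * v $ 2 = 0"
      using YP'
    proof eventually_elim
      case (elim x)
      have "U x = Y 1 (cover x) * dU $ 1 + Y 2 (cover x) * dU $ 2"
        "V x = Y 1 (cover x) * dV $ 1 + Y 2 (cover x) * dV $ 2"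
        using elim by (simp_all add: vec_eq_iff forall_2 vector_matrix_mult_2 P_def)
      then show ?case using Pv[of 1] Pv[of 2] by algebra
    qed
    have "U x * v $ 1 + V x * v $ 2 = 0" if "x \<in> cover_space" for x
      by (rule eventually_eq_imp_eq_on_connected[where g = "\<lambda>_. 0", OF _ _ open_cover_space
            path_connected_imp_connected[OF path_connected_cover_space] x0(1) ev that])
        (intro holomorphic_on_add holomorphic_on_mult holomorphic_on_const hU)+
    then have "v $ 1 = 0 \<and> v $ 2 = 0" by (rule equivariant_pair_independent[OF pair \<eta>])
    then show "v = 0" by (simp add: vec_eq_iff forall_2)
  qed
  then obtain Q where Q: "Q ** P = mat 1" using matrix_left_invertible_ker[of P] by blast
  then have PQ: "P ** Q = mat 1" by (simp add: matrix_left_right_inverse)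
  have "\<forall>\<^sub>F x in nhds x0. (\<chi> i. Y i (cover x)) = pair_vector U V x v* Q"
    using YP' by eventually_elim (simp add: vector_matrix_mul_assoc PQ)
  then show ?thesis using that PQ Q by blast
qed

lemma deck_inverse: "\<epsilon> \<in> {1, -1} \<Longrightarrow> deck \<epsilon> m (deck \<epsilon> (- \<epsilon> * m) x) = x" "\<epsilon> \<in> {1, -1} \<Longrightarrow> deck \<epsilon> (- \<epsilon> * m) (deck \<epsilon> m x) = x"
  by (auto simp: deck_def)

lemma isCont_deck: "isCont (deck \<epsilon> m) x"
  unfolding deck_def[abs_def] by (intro continuous_intros)

lemma sum_coordinates: "(\<Sum>i\<in>UNIV. M $ i $ j * Y i z) = ((\<chi> i. Y i z) v* (M :: complex ^ 2 ^ 2)) $ j"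
  by (simp add: vector_matrix_mult_2 sum_2 mult.commute)

text \<open>A loop lifts to a path from a point \<open>x\<close> over \<open>b\<close> to \<open>deck \<epsilon> m x\<close> for some \<open>\<epsilon>, m\<close>, and
  its monodromy is the action of that deck transformation. Conversely every deck transformation
  arises, because the covering surface is path connected. The matrices \<open>P\<close> and \<open>Q\<close> change
  between the bases \<open>Y\<close> and \<open>U, V\<close>.\<close>

lemma carrier_monodromy_group:
  assumes pair: "equivariant_pair \<eta> c A B C U V" and \<eta>: "\<eta> \<in> {1, -1}"
    and r: "0 < r" "ball b r \<subseteq> - {0, 1}" and Y: "solution_basis A B C (ball b r) Y"
  obtains P Q :: "complex ^ 2 ^ 2" where "P ** Q = mat 1" "Q ** P = mat 1"
    "carrier (monodromy_group b Y) = {P ** deck_matrix \<eta> c \<epsilon> m ** Q | \<epsilon> m. \<epsilon> \<in> {1, -1}}"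
proof -
  have b: "b \<noteq> 0" "b \<noteq> 1" using r centre_in_ball by blast+
  obtain x0 where x0: "x0 \<in> cover_space" "cover x0 = b" using cover_surj[OF b] .
  obtain P Q :: "complex ^ 2 ^ 2" where PQ: "P ** Q = mat 1" "Q ** P = mat 1"
    and lift: "\<forall>\<^sub>F x in nhds x0. (\<chi> i. Y i (cover x)) = pair_vector U V x v* Q"
    using solution_basis_coordinates[OF pair \<eta> r Y x0] by blast
  have hUV: "U holomorphic_on cover_space" "V holomorphic_on cover_space"
    using pair unfolding equivariant_pair_def lifted_solution_def by auto
  define W where "W j x = (pair_vector U V x v* Q) $ j" for j x
  have hW: "W j holomorphic_on cover_space" for j
    unfolding W_def vector_matrix_mult_2 using hUV by (auto intro!: holomorphic_intros)
  have YW: "\<forall>\<^sub>F x in nhds x0. Y j (cover x) = W j x" for j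
    using lift by eventually_elim (metis W_def vec_lambda_beta)
  note conn = path_connected_imp_connected[OF path_connected_cover_space]
  have inv: "invertible (P ** deck_matrix \<eta> c \<epsilon> m ** Q)" if "\<epsilon> \<in> {1, -1}" for \<epsilon> m
  proof -
    have "deck_matrix \<eta> c \<epsilon> m ** deck_matrix \<eta> c \<epsilon> (- \<epsilon> * m) = mat 1"
      "deck_matrix \<eta> c \<epsilon> (- \<epsilon> * m) ** deck_matrix \<eta> c \<epsilon> m = mat 1"
      using that \<eta> by (auto simp: deck_matrix_mult deck_matrix_one)
    then have "invertible (deck_matrix \<eta> c \<epsilon> m)" unfolding invertible_def by blast
    moreover have "invertible P" "invertible Q" unfolding invertible_def using PQ by blast+
    ultimately show ?thesis by (intro invertible_mult)
  qed
  have "M \<in> carrier (monodromy_group b Y) \<longleftrightarrow> (\<exists>\<epsilon> m. \<epsilon> \<in> {1, -1} \<and> M = P ** deck_matrix \<eta> c \<epsilon> m ** Q)" for M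
  proof
    assume "M \<in> carrier (monodromy_group b Y)"
    then obtain g where g: "path g" "path_image g \<subseteq> - {0, 1}" "pathstart g = b" "pathfinish g = b"
      and cont: "\<And>j. analytic_continuation_along g (Y j) (\<lambda>z. \<Sum>i\<in>UNIV. M $ i $ j * Y i z)"
      unfolding monodromy_group_def by auto
    obtain \<gamma> where \<gamma>: "path \<gamma>" "path_image \<gamma> \<subseteq> cover_space" "\<gamma> 0 = x0" "\<And>t. t \<in> {0..1} \<Longrightarrow> cover (\<gamma> t) = g t"
      using path_lift[OF g(1,2) _ x0(1)] g(3) x0(2) by metis
    have "\<gamma> 1 \<in> cover_space" "cover (\<gamma> 1) = cover x0"
      using \<gamma>(2) \<gamma>(4)[of 1] g(4) x0(2) by (auto simp: path_image_def pathfinish_def)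
    then obtain \<epsilon> m where em: "\<epsilon> \<in> {1, -1}" "\<gamma> 1 = deck \<epsilon> m x0" using cover_fibre[OF x0(1)] by metis
    have "pair_vector U V x v* (deck_matrix \<eta> c \<epsilon> m ** Q) = pair_vector U V x v* (Q ** M)" if x: "x \<in> cover_space" for x
    proof -
      have "W j (deck \<epsilon> m x) = (pair_vector U V x v* (Q ** M)) $ j" for j
      proof (rule eventually_eq_imp_eq_on_connected[OF _ _ open_cover_space conn x0(1) _ x])
        have "(\<lambda>x. deck \<epsilon> m x) holomorphic_on cover_space" unfolding deck_def by (intro holomorphic_intros)
        from holomorphic_on_compose_gen[OF this hW[of j]]
        show "(\<lambda>x. W j (deck \<epsilon> m x)) holomorphic_on cover_space"
          using deck_transformation(1)[OF em(1)] by (simp add: o_def image_subset_iff)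
        show "(\<lambda>x. (pair_vector U V x v* (Q ** M)) $ j) holomorphic_on cover_space"
          unfolding vector_matrix_mult_2 using hUV by (auto intro!: holomorphic_intros)
        have "\<forall>\<^sub>F x in nhds (\<gamma> 1). (\<Sum>i\<in>UNIV. M $ i $ j * Y i (cover x)) = W j x"
          by (rule continuation_lifts[OF hW \<gamma>(1,2,4) _ cont]) (use YW \<gamma>(3) in simp_all)
        from isCont_eventually_nhds[OF isCont_deck this[unfolded em(2)]]
        have "\<forall>\<^sub>F x in nhds x0. (\<Sum>i\<in>UNIV. M $ i $ j * Y i (cover x)) = W j (deck \<epsilon> m x)"
          by (simp add: deck_transformation(2)[OF em(1)])
        with lift show "\<forall>\<^sub>F x in nhds x0. W j (deck \<epsilon> m x) = (pair_vector U V x v* (Q ** M)) $ j"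
        proof eventually_elim
          case (elim x)
          have "W j (deck \<epsilon> m x) = ((\<chi> i. Y i (cover x)) v* M) $ j" unfolding elim(2)[symmetric] by (rule sum_coordinates)
          then show ?case unfolding elim(1) by (simp add: vector_matrix_mul_assoc)
        qed
      qed
      then have "pair_vector U V (deck \<epsilon> m x) v* Q = pair_vector U V x v* (Q ** M)"
        unfolding W_def by (simp add: vec_eq_iff)
      then show ?thesis unfolding pair_vector_deck[OF pair x em(1)] by (simp add: vector_matrix_mul_assoc)
    qed
    then have "deck_matrix \<eta> c \<epsilon> m ** Q = Q ** M" by (rule pair_vector_matrix_eqI[OF pair \<eta>])
    then have "P ** deck_matrix \<eta> c \<epsilon> m ** Q = P ** (Q ** M)" by (simp add: matrix_mul_assoc[symmetric])
    also have "\<dots> = M" by (simp add: matrix_mul_assoc PQ)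
    finally show "\<exists>\<epsilon> m. \<epsilon> \<in> {1, -1} \<and> M = P ** deck_matrix \<eta> c \<epsilon> m ** Q" using em(1) by metis
  next
    assume "\<exists>\<epsilon> m. \<epsilon> \<in> {1, -1} \<and> M = P ** deck_matrix \<eta> c \<epsilon> m ** Q"
    then obtain \<epsilon> m where em: "\<epsilon> \<in> {1, -1}" and M: "M = P ** deck_matrix \<eta> c \<epsilon> m ** Q" by blast
    have "deck \<epsilon> m x0 \<in> cover_space" using deck_transformation(1)[OF em] x0(1) by simp
    then obtain \<gamma> where \<gamma>: "path \<gamma>" "path_image \<gamma> \<subseteq> cover_space" "pathstart \<gamma> = x0" "pathfinish \<gamma> = deck \<epsilon> m x0"
      using path_connected_cover_space x0(1) unfolding path_connected_def by metis
    define g where "g = cover \<circ> \<gamma>"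
    have "path g" unfolding g_def
      by (rule path_continuous_image[OF \<gamma>(1)])
        (use continuous_on_subset[OF holomorphic_on_imp_continuous_on[OF cover_holomorphic] \<gamma>(2)] in auto)
    moreover have "path_image g \<subseteq> - {0, 1}"
      unfolding g_def path_image_compose using \<gamma>(2) cover_not_0_1 by auto
    moreover have "pathstart g = b" "pathfinish g = b"
      unfolding g_def pathstart_compose pathfinish_compose \<gamma>(3,4) using x0(2) deck_transformation(2)[OF em] by simp_all
    moreover have "analytic_continuation_along g (Y j) (\<lambda>z. \<Sum>i\<in>UNIV. M $ i $ j * Y i z)" for j
    proof (rule continuation_of_lift[OF hW \<gamma>(1,2)])
      show "cover (\<gamma> t) = g t" for t by (simp add: g_def)
      show "\<forall>\<^sub>F x in nhds (\<gamma> 0). Y j (cover x) = W j x" using YW \<gamma>(3) by (simp add: pathstart_def)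
      let ?d = "deck \<epsilon> (- \<epsilon> * m)"
      have dd: "?d (deck \<epsilon> m x0) = x0" using deck_inverse(2)[OF em] .
      have "\<forall>\<^sub>F x in nhds (deck \<epsilon> m x0). (\<chi> i. Y i (cover (?d x))) = pair_vector U V (?d x) v* Q"
        by (rule isCont_eventually_nhds[OF isCont_deck]) (use lift dd in simp)
      moreover have "\<forall>\<^sub>F x in nhds (deck \<epsilon> m x0). x \<in> cover_space"
        by (intro eventually_nhds_in_open open_cover_space) (use deck_transformation(1)[OF em] x0(1) in simp)
      ultimately have "\<forall>\<^sub>F x in nhds (deck \<epsilon> m x0). (\<Sum>i\<in>UNIV. M $ i $ j * Y i (cover x)) = W j x"
      proof eventually_elim
        case (elim x)
        have dx: "?d x \<in> cover_space" "cover (?d x) = cover x" using deck_transformation[OF em] elim(2) by simp_all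
        have "(\<Sum>i\<in>UNIV. M $ i $ j * Y i (cover x)) = (pair_vector U V (?d x) v* Q v* M) $ j"
          unfolding sum_coordinates elim(1)[unfolded dx(2), symmetric] ..
        also have "pair_vector U V (?d x) v* Q v* M = pair_vector U V (?d x) v* deck_matrix \<eta> c \<epsilon> m v* Q"
          unfolding M vector_matrix_mul_assoc by (simp add: matrix_mul_assoc PQ)
        also have "\<dots> = pair_vector U V x v* Q"
          unfolding pair_vector_deck[OF pair dx(1) em, symmetric] deck_inverse(1)[OF em] ..
        finally show ?case unfolding W_def .
      qed
      then show "\<forall>\<^sub>F x in nhds (\<gamma> 1). (\<Sum>i\<in>UNIV. M $ i $ j * Y i (cover x)) = W j x"
        using \<gamma>(4) by (simp add: pathfinish_def)
    qed
    ultimately show "M \<in> carrier (monodromy_group b Y)"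
      using inv[OF em, of m] unfolding monodromy_group_def GL2_def M[symmetric] by auto
  qed
  then have "carrier (monodromy_group b Y) = {P ** deck_matrix \<eta> c \<epsilon> m ** Q | \<epsilon> m. \<epsilon> \<in> {1, -1}}" by blast
  with PQ show ?thesis by (rule that)
qed

section \<open>The two groups\<close>

lemma is_isoI:
  assumes bij: "bij_betw f (carrier H) (carrier G)"
    and mult: "\<And>x y. x \<in> carrier H \<Longrightarrow> y \<in> carrier H \<Longrightarrow> f (x \<otimes>\<^bsub>H\<^esub> y) = f x \<otimes>\<^bsub>G\<^esub> f y"
    and closed: "\<And>x y. x \<in> carrier H \<Longrightarrow> y \<in> carrier H \<Longrightarrow> x \<otimes>\<^bsub>H\<^esub> y \<in> carrier H"
  shows "G \<cong> H"
proof -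
  let ?g = "inv_into (carrier H) f"
  have g: "?g a \<in> carrier H" "f (?g a) = a" if "a \<in> carrier G" for a
    using bij that by (auto simp: bij_betw_def inv_into_into f_inv_into_f)
  have "?g (a \<otimes>\<^bsub>G\<^esub> a') = ?g a \<otimes>\<^bsub>H\<^esub> ?g a'" if "a \<in> carrier G" "a' \<in> carrier G" for a a'
  proof -
    have "a \<otimes>\<^bsub>G\<^esub> a' = f (?g a \<otimes>\<^bsub>H\<^esub> ?g a')" using mult g that by simp
    then show ?thesis using bij closed g that by (simp add: bij_betw_def inv_into_f_f)
  qed
  then have "?g \<in> iso G H"
    using bij_betw_inv_into[OF bij] g(1) unfolding iso_def hom_def by auto
  then show ?thesis unfolding is_iso_def by blast
qed

lemma monodromy_group_mult: "M \<otimes>\<^bsub>monodromy_group b Y\<^esub> M' = M ** M'"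
  by (simp add: monodromy_group_def GL2_def)

lemma conjugate_mult:
  fixes P Q N N' :: "complex ^ 2 ^ 2"
  assumes "Q ** P = mat 1"
  shows "(P ** N ** Q) ** (P ** N' ** Q) = P ** (N ** N') ** Q"
proof -
  have "(P ** N ** Q) ** (P ** N' ** Q) = P ** N ** (Q ** P) ** N' ** Q" by (simp only: matrix_mul_assoc)
  then show ?thesis by (simp add: assms matrix_mul_assoc)
qed

lemma conjugate_inject:
  fixes P Q N N' :: "complex ^ 2 ^ 2"
  assumes "Q ** P = mat 1" "P ** N ** Q = P ** N' ** Q"
  shows "N = N'"
proof -
  have "Q ** (P ** N ** Q) ** P = N" for N
  proof -
    have "Q ** (P ** N ** Q) ** P = (Q ** P) ** N ** (Q ** P)" by (simp only: matrix_mul_assoc)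
    then show ?thesis by (simp add: assms(1))
  qed
  then show ?thesis using assms(2) by metis
qed

lemma deck_matrix_inject:
  assumes "deck_matrix \<eta> c \<epsilon> m = deck_matrix \<eta> c \<epsilon>' m'" "\<eta> \<in> {1, -1}" "\<epsilon> \<in> {1, -1}" "\<epsilon>' \<in> {1, -1}" "c \<noteq> 0"
  shows "\<epsilon> = \<epsilon>' \<and> m = m'"
  using assms by (auto simp: deck_matrix_def vec_eq_iff forall_2)

lemma carrier_infinite_dihedral_group:
  "carrier infinite_dihedral_group = {\<lambda>x. c + \<epsilon> * x | c \<epsilon>. \<epsilon> \<in> {1, -1}}"
proof -
  have "(s = (\<lambda>x. c + x) \<or> s = (\<lambda>x. c - x)) \<longleftrightarrow> (\<exists>\<epsilon>. s = (\<lambda>x. c + \<epsilon> * x) \<and> \<epsilon> \<in> {1, -1})" for s and c :: int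
  proof -
    have "(\<exists>\<epsilon>. s = (\<lambda>x. c + \<epsilon> * x) \<and> \<epsilon> \<in> {1, -1}) \<longleftrightarrow> s = (\<lambda>x. c + 1 * x) \<or> s = (\<lambda>x. c + (- 1) * x)" by blast
    then show ?thesis by simp
  qed
  then show ?thesis unfolding infinite_dihedral_group_def by simp
qed

text \<open>For \<open>c \<noteq> 0\<close> the matrix determines \<open>\<epsilon>\<close> and \<open>m\<close>. The map \<open>x \<mapsto> a + \<epsilon> x\<close> is sent to the
  matrix with \<open>m = \<epsilon> a\<close>, which belongs to the inverse map up to the sign of \<open>m\<close>; this
  compensates for the reversed order of multiplication.\<close>

lemma conjugated_deck_matrices_infinite_dihedral:
  assumes G: "carrier (monodromy_group b Y) = {P ** deck_matrix \<eta> c \<epsilon> m ** Q | \<epsilon> m. \<epsilon> \<in> {1, -1}}"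
    and QP: "Q ** P = mat 1" and \<eta>: "\<eta> \<in> {1, -1}" and c: "c \<noteq> 0"
  shows "monodromy_group b Y \<cong> infinite_dihedral_group"
proof (rule is_isoI)
  \<comment> \<open>For \<open>s x = a + \<epsilon> x\<close> one has \<open>a = s 0\<close> and \<open>\<epsilon> = s 1 - s 0\<close>.\<close>
  define f :: "(int \<Rightarrow> int) \<Rightarrow> complex ^ 2 ^ 2"
    where "f s = P ** deck_matrix \<eta> c (s 1 - s 0) ((s 1 - s 0) * s 0) ** Q" for s
  have f: "f (\<lambda>x. a + \<epsilon> * x) = P ** deck_matrix \<eta> c \<epsilon> (\<epsilon> * a) ** Q" for a \<epsilon> by (simp add: f_def)
  show "bij_betw f (carrier infinite_dihedral_group) (carrier (monodromy_group b Y))"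
    unfolding bij_betw_def
  proof
    show "inj_on f (carrier infinite_dihedral_group)"
    proof (rule inj_onI)
      fix s s' assume "s \<in> carrier infinite_dihedral_group" "s' \<in> carrier infinite_dihedral_group" and eq: "f s = f s'"
      then obtain a \<epsilon> a' \<epsilon>' where s: "s = (\<lambda>x. a + \<epsilon> * x)" "\<epsilon> \<in> {1, -1}" and s': "s' = (\<lambda>x. a' + \<epsilon>' * x)" "\<epsilon>' \<in> {1, -1}"
        unfolding carrier_infinite_dihedral_group by blast
      have "deck_matrix \<eta> c \<epsilon> (\<epsilon> * a) = deck_matrix \<eta> c \<epsilon>' (\<epsilon>' * a')"
        using conjugate_inject[OF QP] eq unfolding s(1) s'(1) f by blast
      then have "\<epsilon> = \<epsilon>' \<and> \<epsilon> * a = \<epsilon>' * a'" by (rule deck_matrix_inject[OF _ \<eta> s(2) s'(2) c])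
      then show "s = s'" using s s' by auto
    qed
    show "f ` carrier infinite_dihedral_group = carrier (monodromy_group b Y)"
    proof (intro equalityI subsetI)
      fix M assume "M \<in> f ` carrier infinite_dihedral_group"
      then show "M \<in> carrier (monodromy_group b Y)" unfolding carrier_infinite_dihedral_group G by (force simp: f)
    next
      fix M assume "M \<in> carrier (monodromy_group b Y)"
      then obtain \<epsilon> m where em: "\<epsilon> \<in> {1, -1}" "M = P ** deck_matrix \<eta> c \<epsilon> m ** Q" unfolding G by blast
      then have "M = f (\<lambda>x. \<epsilon> * m + \<epsilon> * x)" unfolding f by auto
      then show "M \<in> f ` carrier infinite_dihedral_group" unfolding carrier_infinite_dihedral_group using em(1) by blast
    qed
  qed
  fix s s' assume "s \<in> carrier infinite_dihedral_group" "s' \<in> carrier infinite_dihedral_group"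
  then obtain a \<epsilon> a' \<epsilon>' where s: "s = (\<lambda>x. a + \<epsilon> * x)" "\<epsilon> \<in> {1, -1}" and s': "s' = (\<lambda>x. a' + \<epsilon>' * x)" "\<epsilon>' \<in> {1, -1}"
    unfolding carrier_infinite_dihedral_group by blast
  have comp: "s \<otimes>\<^bsub>infinite_dihedral_group\<^esub> s' = (\<lambda>x. (a + \<epsilon> * a') + (\<epsilon> * \<epsilon>') * x)"
    unfolding s s' by (simp add: infinite_dihedral_group_def fun_eq_iff algebra_simps)
  have sg: "\<epsilon> * \<epsilon>' \<in> {1, -1}" using s(2) s'(2) by auto
  show "s \<otimes>\<^bsub>infinite_dihedral_group\<^esub> s' \<in> carrier infinite_dihedral_group"
    unfolding comp carrier_infinite_dihedral_group using sg by blast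
  have "\<epsilon> * \<epsilon>' * (a + \<epsilon> * a') = \<epsilon>' * a' + \<epsilon> * a * \<epsilon>'" using s(2) by (auto simp: algebra_simps)
  then show "f (s \<otimes>\<^bsub>infinite_dihedral_group\<^esub> s') = f s \<otimes>\<^bsub>monodromy_group b Y\<^esub> f s'"
    unfolding comp f monodromy_group_mult unfolding s(1) s'(1) f conjugate_mult[OF QP] deck_matrix_mult[OF \<eta> s(2) s'(2)]
    by simp
qed

text \<open>For \<open>c = 0\<close> only the sign \<open>\<epsilon>\<close> matters: translations act trivially and reflections by an
  involution.\<close>

lemma conjugated_deck_matrices_order_two:
  assumes G: "carrier (monodromy_group b Y) = {P ** deck_matrix \<eta> 0 \<epsilon> m ** Q | \<epsilon> m. \<epsilon> \<in> {1, -1}}"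
    and QP: "Q ** P = mat 1" and \<eta>: "\<eta> \<in> {1, -1}"
  shows "monodromy_group b Y \<cong> integer_mod_group 2"
proof (rule is_isoI)
  define N where "N \<epsilon> = deck_matrix \<eta> 0 \<epsilon> 0" for \<epsilon>
  have N: "deck_matrix \<eta> 0 \<epsilon> m = N \<epsilon>" for \<epsilon> m by (simp add: N_def deck_matrix_def)
  have mult: "N \<epsilon> ** N \<epsilon>' = N (\<epsilon> * \<epsilon>')" if "\<epsilon> \<in> {1, -1}" "\<epsilon>' \<in> {1, -1}" for \<epsilon> \<epsilon>'
    unfolding N_def using deck_matrix_mult[OF \<eta> that, of 0 0 0] by simp
  have neq: "N 1 \<noteq> N (-1)" using \<eta> by (auto simp: N_def deck_matrix_def vec_eq_iff forall_2)
  define f :: "int \<Rightarrow> complex ^ 2 ^ 2" where "f k = P ** N (if k = 0 then 1 else - 1) ** Q" for k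
  have carrier: "carrier (integer_mod_group 2) = {0, 1}" by (auto simp: carrier_integer_mod_group)
  have G': "carrier (monodromy_group b Y) = {f 0, f 1}"
    unfolding G N by (auto simp: f_def)
  have "f 0 \<noteq> f 1" using conjugate_inject[OF QP] neq unfolding f_def by fastforce
  then show "bij_betw f (carrier (integer_mod_group 2)) (carrier (monodromy_group b Y))"
    unfolding bij_betw_def carrier G' by (auto simp: inj_on_def)
  fix x y :: int assume x: "x \<in> carrier (integer_mod_group 2)" and y: "y \<in> carrier (integer_mod_group 2)"
  show "x \<otimes>\<^bsub>integer_mod_group 2\<^esub> y \<in> carrier (integer_mod_group 2)"
    using x y unfolding carrier by auto
  show "f (x \<otimes>\<^bsub>integer_mod_group 2\<^esub> y) = f x \<otimes>\<^bsub>monodromy_group b Y\<^esub> f y"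
    using x y unfolding carrier monodromy_group_mult f_def conjugate_mult[OF QP] by (auto simp: mult)
qed

section \<open>Parameters with two half-integer differences\<close>

lemma solution_basis_swap: "solution_basis A B C S Y \<longleftrightarrow> solution_basis B A C S Y"
  unfolding solution_basis_def hypergeometric_solution_def by (simp add: add.commute mult.commute)

lemma sign_cases:
  assumes "x \<in> {y, - y :: complex}" obtains u :: int where "u \<in> {1, -1}" "x = of_int u * y"
  using assms that[of 1] that[of "-1"] by auto

text \<open>Here \<open>m = C - B = a \<plusminus> n\<close>. At \<open>z = 1\<close> the obstruction vanishes exactly if \<open>a\<close> and \<open>m\<close> lie
  on different sides of the gap between \<open>0\<close> and \<open>1\<close>, so the class of the parameters decides
  about logarithms.\<close>

lemma integer_parameter_class:
  fixes a b :: int and k l n :: nat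
  assumes ex: "exponent_differences (of_int a) (of_int b + 1/2) C (of_nat k + 1/2) (of_nat n) (of_nat l + 1/2)"
  obtains m where "C = of_int b + 1/2 + of_int m"
    "(a \<le> 0 \<longleftrightarrow> m \<le> 0) \<longleftrightarrow> (if even (n + k + l) then n \<le> k + l else int n < \<bar>int k - int l\<bar>)"
proof -
  let ?A = "of_int a :: complex" and ?B = "of_int b + 1/2 :: complex"
  have d: "1 - C \<in> {of_nat k + 1/2, - (of_nat k + 1/2)}" and e: "?A - ?B \<in> {of_nat l + 1/2, - (of_nat l + 1/2)}"
    and n: "C - ?A - ?B \<in> {of_nat n, - of_nat n}"
    using ex unfolding exponent_differences_def by auto
  have roots: "(\<exists>j<n. (of_nat j + of_int \<rho> + ?A) * (of_nat j + of_int \<rho> + ?B) = 0) \<longleftrightarrow> (\<exists>j<n. int j + \<rho> + a = 0)" for \<rho>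
  proof -
    have "of_nat j + of_int \<rho> + ?B \<noteq> 0" for j
      using half_plus_int_nonzero[of b "int j + \<rho>"] by (simp add: algebra_simps)
    moreover have "of_nat j + of_int \<rho> + ?A = of_int (int j + \<rho> + a)" for j by simp
    ultimately show ?thesis by (simp only: mult_eq_0_iff of_int_eq_0_iff) blast
  qed
  from n consider "C - ?A - ?B = of_nat n" | "C - ?A - ?B = - of_nat n" by blast
  then show ?thesis
  proof cases
    case 1
    have "2 * of_int 0 + of_nat n + ?A + ?B = 1 - (1 - C)" using 1 by (simp add: algebra_simps)
    from obstruction_iff[OF this d e]
    have "(if even (n + k + l) then n \<le> k + l else int n < \<bar>int k - int l\<bar>) \<longleftrightarrow> \<not> (\<exists>j<n. int j + 0 + a = 0)"
      unfolding roots by blast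
    also have "(\<exists>j<n. int j + 0 + a = 0) \<longleftrightarrow> a \<le> 0 \<and> \<not> a + int n \<le> 0"
    proof
      assume "a \<le> 0 \<and> \<not> a + int n \<le> 0"
      then show "\<exists>j<n. int j + 0 + a = 0" by (intro exI[of _ "nat (- a)"]) auto
    qed auto
    finally show ?thesis using 1 by (intro that[of "a + int n"]) (auto simp: algebra_simps)
  next
    case 2
    have "2 * of_int (- int n) + of_nat n + ?A + ?B = 1 - (1 - C)" using 2 by (simp add: algebra_simps)
    from obstruction_iff[OF this d e]
    have "(if even (n + k + l) then n \<le> k + l else int n < \<bar>int k - int l\<bar>) \<longleftrightarrow> \<not> (\<exists>j<n. int j + - int n + a = 0)"
      unfolding roots by blast
    also have "(\<exists>j<n. int j + - int n + a = 0) \<longleftrightarrow> \<not> a \<le> 0 \<and> a - int n \<le> 0"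
    proof
      assume "\<not> a \<le> 0 \<and> a - int n \<le> 0"
      then show "\<exists>j<n. int j + - int n + a = 0" by (intro exI[of _ "nat (int n - a)"]) auto
    qed auto
    finally show ?thesis using 2 by (intro that[of "a - int n"]) (auto simp: algebra_simps)
  qed
qed

text \<open>Both \<open>2 A\<close> and \<open>2 B\<close> are integers, and their difference is odd.\<close>

lemma integer_and_half_integer_parameters:
  fixes k l n :: nat
  assumes ex: "exponent_differences A B C (of_nat k + 1/2) (of_nat n) (of_nat l + 1/2)"
  obtains a b :: int where "A = of_int a \<and> B = of_int b + 1/2 \<or> B = of_int a \<and> A = of_int b + 1/2"
proof -
  obtain u :: int where u: "u \<in> {1, -1}" "1 - C = of_int u * (of_nat k + 1/2)"
    using ex sign_cases unfolding exponent_differences_def by blast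
  obtain v :: int where v: "v \<in> {1, -1}" "C - A - B = of_int v * of_nat n"
    using ex sign_cases unfolding exponent_differences_def by blast
  obtain w :: int where w: "w \<in> {1, -1}" "A - B = of_int w * (of_nat l + 1/2)"
    using ex sign_cases unfolding exponent_differences_def by blast
  have "even (2 - u * (2 * int k + 1) - 2 * v * int n + w * (2 * int l + 1))" using u(1) w(1) by auto
  then obtain p where p: "2 - u * (2 * int k + 1) - 2 * v * int n + w * (2 * int l + 1) = 2 * p" by (rule evenE)
  \<comment> \<open>The left side of the equation for \<open>p\<close> is \<open>4 A\<close>, so \<open>p = 2 A\<close> and \<open>q = 2 B\<close>.\<close>
  define q where "q = p - w * (2 * int l + 1)"
  have C: "C = 1 - of_int u * (of_nat k + 1/2)" using u(2) by (metis diff_diff_eq2 add_diff_cancel_left')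
  have AB: "A + B = C - of_int v * of_nat n" unfolding v(2)[symmetric] by simp
  have "4 * A = 2 * (A + B) + 2 * (A - B)" by simp
  also have "\<dots> = of_int (2 - u * (2 * int k + 1) - 2 * v * int n + w * (2 * int l + 1))"
    unfolding AB w(2) C by (simp add: algebra_simps)
  finally have A: "2 * A = of_int p" unfolding p by simp
  have "2 * B = 2 * A - 2 * (A - B)" by simp
  also have "\<dots> = of_int q" unfolding A w(2) by (simp add: q_def algebra_simps)
  finally have B: "2 * B = of_int q" .
  have "odd (p + q)" using w(1) by (auto simp: q_def)
  then consider "even p" "odd q" | "odd p" "even q" by auto
  then show ?thesis
  proof cases
    case 1
    then obtain a b where "p = 2 * a" "q = 2 * b + 1" by (meson evenE oddE)
    then show ?thesis using A B that[of a b] by (auto simp: field_simps)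
  next
    case 2
    then obtain a b where "q = 2 * a" "p = 2 * b + 1" by (meson evenE oddE)
    then show ?thesis using A B that[of a b] by (auto simp: field_simps)
  qed
qed

lemma monodromy_group_iso:
  fixes k l n :: nat
  assumes ex: "exponent_differences A B C (of_nat k + 1/2) (of_nat n) (of_nat l + 1/2)"
    and r: "0 < r" "ball b r \<subseteq> - {0, 1}" and Y: "solution_basis A B C (ball b r) Y"
  shows "if (if even (n + k + l) then n \<le> k + l else int n < \<bar>int k - int l\<bar>)
      then monodromy_group b Y \<cong> infinite_dihedral_group
      else monodromy_group b Y \<cong> integer_mod_group 2"
    (is "if ?L then _ else _")
proof -
  have main: ?thesis
    if ex: "exponent_differences (of_int p) (of_int q + 1/2) C (of_nat k + 1/2) (of_nat n) (of_nat l + 1/2)"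
      and Y: "solution_basis (of_int p) (of_int q + 1/2) C (ball b r) Y" for p q :: int
  proof -
    obtain m where m: "C = of_int q + 1/2 + of_int m" "(p \<le> 0 \<longleftrightarrow> m \<le> 0) \<longleftrightarrow> ?L"
      using integer_parameter_class[OF ex] by blast
    obtain \<eta> U V where \<eta>: "\<eta> \<in> {1, -1}" and pair: "equivariant_pair \<eta> (if p \<le> 0 \<longleftrightarrow> m \<le> 0 then of_real pi else 0)
       (of_int p) (of_int q + 1/2) (of_int q + 1/2 + of_int m) U V"
      using equivariant_pair_exists[of p m q] by blast
    obtain P Q :: "complex ^ 2 ^ 2" where PQ: "Q ** P = mat 1"
      and G: "carrier (monodromy_group b Y) = {P ** deck_matrix \<eta> (if p \<le> 0 \<longleftrightarrow> m \<le> 0 then of_real pi else 0) \<epsilon> m' ** Q | \<epsilon> m'. \<epsilon> \<in> {1, -1}}"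
      using carrier_monodromy_group[OF pair \<eta> r Y[unfolded m(1)]] by blast
    show ?thesis
    proof (cases ?L)
      case True
      then have *: "(p \<le> 0 \<longleftrightarrow> m \<le> 0) = True" using m(2) by blast
      have "monodromy_group b Y \<cong> infinite_dihedral_group"
        by (rule conjugated_deck_matrices_infinite_dihedral[OF G[unfolded * if_True] PQ \<eta>]) simp
      then show ?thesis using True by simp
    next
      case False
      then have *: "(p \<le> 0 \<longleftrightarrow> m \<le> 0) = False" using m(2) by blast
      have "monodromy_group b Y \<cong> integer_mod_group 2"
        by (rule conjugated_deck_matrices_order_two[OF G[unfolded * if_False] PQ \<eta>])
      then show ?thesis using False by simp
    qed
  qed
  obtain p q :: int where "A = of_int p \<and> B = of_int q + 1/2 \<or> B = of_int p \<and> A = of_int q + 1/2"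
    using integer_and_half_integer_parameters[OF ex] by blast
  then show ?thesis
  proof
    assume AB: "A = of_int p \<and> B = of_int q + 1/2"
    then show ?thesis using main[of p q] ex Y by blast
  next
    assume BA: "B = of_int p \<and> A = of_int q + 1/2"
    have "exponent_differences B A C (of_nat k + 1/2) (of_nat n) (of_nat l + 1/2)"
      using ex unfolding exponent_differences_def by (auto simp: algebra_simps)
    then show ?thesis using main[of p q] BA Y solution_basis_swap[of A B] by blast
  qed
qed

section \<open>Logarithmic solutions and monodromy\<close>

theorem theorem5p1:
  fixes k l n :: nat and A B C :: complex
  assumes "hypergeometric_E (of_nat k + 1/2) (of_nat l + 1/2) (of_nat n) A B C"
  shows "(has_logarithmic_solutions A B C \<longleftrightarrow>
            (if even (n + k + l) then n \<le> k + l else int n < \<bar>int k - int l\<bar>)) \<and>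
         (exponent_differences A B C (of_nat k + 1/2) (of_nat n) (of_nat l + 1/2) \<longrightarrow>
            (\<forall>b r Y. 0 < r \<and> ball b r \<subseteq> - {0, 1} \<and> solution_basis A B C (ball b r) Y \<longrightarrow>
               (if has_logarithmic_solutions A B C
                then monodromy_group b Y \<cong> infinite_dihedral_group
                else monodromy_group b Y \<cong> integer_mod_group 2)))"
  unfolding has_logarithmic_solutions_iff[OF assms] using monodromy_group_iso by blast

end
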